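(* Given $X_1,\ldots,X_n$, let $X_1^*,\ldots,X_n^*$ be i.i.d. draws from the empirical distribution of $X_1,\ldots,X_n$, and define $$U_n^*=\frac{(n-m)!}{n!}\sum_{I_n^m}a(i_1,\ldots,i_m)h(X_{i_1}^*,\ldots,X_{i_m}^* ).$$ Let $\sigma_n^2=\mathrm{Var}(U_n)$ and $V(n)=\mathrm{Var}\{n^{-1}\sum_{i=1}^n h_{1,i}(X_i)\}$. Assume that for each $n$ there is a constant $M(n)>0$ depending only on $n$ with $\max_{(i_1,\ldots,i_m)\in I_n^m}E\{h(X_{i_1},\ldots,X_{i_m})^{4}\}\le M(n)$, and that as $n\to\infty$ $$n^{-2}V(n)^{-1}A_{2,2}(n)M(n)^{1/2}\to 0,\qquad n^{-2}V(n)^{-3/2}A_{3,1}(n)M(n)^{3/4}\to 0 .$$ Assume also: (i) $$\limsup_{n\to\infty}\max_{1\le i_1,\ldots,i_m\le n}E\{h(X_{i_1},\ldots,X_{i_m})^2\}<\infty ;$$ (ii) $$\frac1n\sum_{i=1}^n\sum_{j=1}^n\Big\{\frac{h_{1,i}(X_j)}{n\sigma_n}\Big\}^2\stackrel{P}{\to}1,\qquad \frac1{n^2}\sum_{i=1}^n\Big\{\sum_{j=1}^n\frac{h_{1,i}(X_j)}{n\sigma_n}\Big\}^2\stackrel{P}{\to}0,$$ and $$n^{-1}\sigma_n^{-2}A_{2,1}(n)\{M_1(n)^2+M_2(n)+n^{-1}\}\to 0 .$$ Then $$\big|\mathrm{Var}^*(\sigma_n^{-1}U_n^* )-\mathrm{Var}(\sigma_n^{-1}U_n)\big|\stackrel{P}{\to}0,$$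 where $\mathrm{Var}^*(\cdot)$ denotes the conditional variance given $X_1,\ldots,X_n$.
   Context: Fix an integer $m\ge 1$ (with $m\ge 2$ whenever $A_{2,2}(n)$ appears, since $A_{K,q}(n)$ below is defined for $0\le q\le m$). For each $n$ let $X_1,\dots,X_n$ (short for $X_{n,1},\dots,X_{n,n}$, a triangular array) be independent random variables with values in a measurable space $(\mathcal X,\mathcal B_{\mathcal X})$, $X_i$ having distribution $P_i=P_{n,i}$; the $P_i$ need not be equal and may change with $n$. Write $[n]=\{1,\dots,n\}$. The weight function $a=a_n:\mathbb Z^m\to\mathbb R$ and the (measurable) kernel $h=h_n:\mathcal X^m\to\mathbb R$ may depend on $n$ and need not be symmetric. Let $I_n^m$ be the set of $m$-tuples $(i_1,\dots,i_m)\in[n]^m$ with pairwise distinct entries, and $$U_n=\frac{(n-m)!}{n!}\sum_{I_n^m}a(i_1,\ldots,i_m)h(X_{i_1},\ldots,X_{i_m}).$$ Let $\theta(i_1,\ldots,i_m)=E\{h(X_{i_1},\ldots,X_{i_m})\}$ for $(i_1,\dots,i_m)\in I_n^m$. For $l\in[m]$ let $\pi_l(y;y_1,\ldots,y_{m-1})=(y_1,\ldots,y_{l-1},y,y_l,\ldots,y_{m-1})$ and define $a^{(l)}(i;i_1,\ldots,i_{m-1})=a\{\pi_l(i;i_1,\ldots,i_{m-1})\}$, $h^{(l)}(x;x_1,\ldots,x_{m-1})=h\{\pi_l(x;x_1,\ldots,x_{m-1})\}$, $\theta^{(l)}(i;i_1,\ldots,i_{m-1})=\theta\{\pi_l(i;i_1,\ldots,i_{m-1})\}$,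 and $$f^{(l)}_{i_1,\ldots,i_{m-1}}(x)=\int h^{(l)}(x;y_1,\ldots,y_{m-1})\,dP_{i_1}(y_1)\cdots dP_{i_{m-1}}(y_{m-1}).$$ Let $I_{n-1}^{m-1}(-i)$ be the set of $(m-1)$-tuples of pairwise distinct elements of $[n]\setminus\{i\}$, and $$h_{1,i}(x)=\frac{(n-m)!}{(n-1)!}\sum_{I_{n-1}^{m-1}(-i)}\sum_{l=1}^m a^{(l)}(i;i_1,\ldots,i_{m-1})\big\{f^{(l)}_{i_1,\ldots,i_{m-1}}(x)-\theta^{(l)}(i;i_1,\ldots,i_{m-1})\big\}.$$ For integers $K\ge 2$, $0\le q\le m$, let $(I_n^m)_{\ge q}^{\otimes K}$ (resp. $(I_n^m)_{=q}^{\otimes K}$) be the set of $K$-tuples $(\boldsymbol i^{(1)},\dots,\boldsymbol i^{(K)})$ of elements $\boldsymbol i^{(k)}=(i^{(k)}_1,\dots,i^{(k)}_m)\in I_n^m$ with $\mathrm{card}\big(\bigcap_{k=1}^K\{i_1^{(k)},\ldots,i_m^{(k)}\}\big)\ge q$ (resp. $=q$), and $$A_{K,q}(n)=\frac{1}{\mathrm{card}\{(I_n^m)_{\ge q}^{\otimes K}\}}\sum_{(I_n^m)_{\ge q}^{\otimes K}}\big|a(\boldsymbol i^{(1)})\cdots a(\boldsymbol i^{(K)})\big|.$$ Heterogeneity measures: $$M_1(n)=\max_{(\boldsymbol i,\boldsymbol j)\in I_n^m\times I_n^m}|\theta(i_1,\ldots,i_m)-\theta(j_1,\ldots,j_m)|,$$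 $$M_2(n)=\max_{1\le p,q\le m}\ \max_{\substack{(\boldsymbol r,\boldsymbol s)\in(I_n^m)_{=1}^{\otimes 2}\\ \boldsymbol r\cap\boldsymbol s=r_p=s_q}}\ \max_{\substack{\boldsymbol k\in I_n^m\\ \boldsymbol k\cap\boldsymbol s=k_p=s_q}}\Big|E[E\{h(X_{r_1},\ldots,X_{r_m})h(X_{s_1},\ldots,X_{s_m})\mid X_{k_p}\}]-E[E\{h(X_{k_1},\ldots,X_{k_m})h(X_{s_1},\ldots,X_{s_m})\mid X_{k_p}\}]\Big|,$$ where $\boldsymbol r=(r_1,\dots,r_m)$ and similarly $\boldsymbol s,\boldsymbol k$; "$\boldsymbol r\cap\boldsymbol s=r_p=s_q$" means that the only index common to $\boldsymbol r$ and $\boldsymbol s$ is the one at position $p$ of $\boldsymbol r$ and position $q$ of $\boldsymbol s$, and similarly for $\boldsymbol k\cap\boldsymbol s=k_p=s_q$. $\stackrel{P}{\to}$ is convergence in probability.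
   Formalization: Condition (i) is imposed also with independent draws from the same law at repeated indices (integrals of h^2 over P_{i_1} x ... x P_{i_m}), since otherwise h_{1,i}(X_j) is uncontrolled and the claim fails; V(n) > 0 for all large n is made explicit. *)

theory Defs
  imports "HOL-Probability.Probability"
begin

text \<open>
  Tuples of length \<open>m\<close> are extensional functions on \<open>{1..m}\<close>; \<open>[n]\<close> is \<open>{1..n}\<close>.
  All definitions below concern one row of the triangular array: \<open>P\<close> is the underlying
  probability space, \<open>N\<close> the measurable space of values, \<open>X i\<close> the \<open>i\<close>-th observation.
  Weights are applied to tuples of indices only, so they are functions of tuples of naturals.
\<close>

definition distinct_tuples :: "nat set \<Rightarrow> nat \<Rightarrow> (nat \<Rightarrow> nat) set" where
  "distinct_tuples S m = {i \<in> {1..m} \<rightarrow>\<^sub>E S. inj_on i {1..m}}"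

definition insert_at :: "nat \<Rightarrow> nat \<Rightarrow> 'b \<Rightarrow> (nat \<Rightarrow> 'b) \<Rightarrow> nat \<Rightarrow> 'b" where
  "insert_at m l y ys =
     (\<lambda>k\<in>{1..m}. if k < l then ys k else if k = l then y else ys (k - 1))"

definition at_indices :: "nat \<Rightarrow> (nat \<Rightarrow> 'x) \<Rightarrow> (nat \<Rightarrow> nat) \<Rightarrow> nat \<Rightarrow> 'x" where
  "at_indices m x i = (\<lambda>k\<in>{1..m}. x (i k))"

definition wU ::
  "nat \<Rightarrow> nat \<Rightarrow> ((nat \<Rightarrow> nat) \<Rightarrow> real) \<Rightarrow> ((nat \<Rightarrow> 'x) \<Rightarrow> real) \<Rightarrow> (nat \<Rightarrow> 'x) \<Rightarrow> real" where
  "wU m n a h x =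
     fact (n - m) / fact n *
     (\<Sum>i\<in>distinct_tuples {1..n} m. a i * h (at_indices m x i))"

definition \<theta> ::
  "'w measure \<Rightarrow> (nat \<Rightarrow> 'w \<Rightarrow> 'x) \<Rightarrow> nat \<Rightarrow> ((nat \<Rightarrow> 'x) \<Rightarrow> real) \<Rightarrow> (nat \<Rightarrow> nat) \<Rightarrow> real" where
  "\<theta> P X m h i = (\<integral>\<omega>. h (at_indices m (\<lambda>j. X j \<omega>) i) \<partial>P)"

definition f_proj ::
  "'w measure \<Rightarrow> 'x measure \<Rightarrow> (nat \<Rightarrow> 'w \<Rightarrow> 'x) \<Rightarrow> nat \<Rightarrow> ((nat \<Rightarrow> 'x) \<Rightarrow> real)
     \<Rightarrow> nat \<Rightarrow> (nat \<Rightarrow> nat) \<Rightarrow> 'x \<Rightarrow> real" where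
  "f_proj P N X m h l i x =
     (\<integral>y. h (insert_at m l x y) \<partial>(\<Pi>\<^sub>M k\<in>{1..m - 1}. distr P N (X (i k))))"

definition h1 ::
  "'w measure \<Rightarrow> 'x measure \<Rightarrow> (nat \<Rightarrow> 'w \<Rightarrow> 'x) \<Rightarrow> nat \<Rightarrow> nat
     \<Rightarrow> ((nat \<Rightarrow> nat) \<Rightarrow> real) \<Rightarrow> ((nat \<Rightarrow> 'x) \<Rightarrow> real) \<Rightarrow> nat \<Rightarrow> 'x \<Rightarrow> real" where
  "h1 P N X m n a h i x =
     fact (n - m) / fact (n - 1) *
     (\<Sum>j\<in>distinct_tuples ({1..n} - {i}) (m - 1). \<Sum>l\<in>{1..m}.
        a (insert_at m l i j) * (f_proj P N X m h l j x - \<theta> P X m h (insert_at m l i j)))"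

definition overlap_ge :: "nat \<Rightarrow> nat \<Rightarrow> nat \<Rightarrow> nat \<Rightarrow> (nat \<Rightarrow> nat \<Rightarrow> nat) set" where
  "overlap_ge K q m n =
     {t \<in> {1..K} \<rightarrow>\<^sub>E distinct_tuples {1..n} m. card (\<Inter>k\<in>{1..K}. t k ` {1..m}) \<ge> q}"

definition A_avg :: "nat \<Rightarrow> nat \<Rightarrow> nat \<Rightarrow> nat \<Rightarrow> ((nat \<Rightarrow> nat) \<Rightarrow> real) \<Rightarrow> real" where
  "A_avg K q m n a =
     1 / card (overlap_ge K q m n) * (\<Sum>t\<in>overlap_ge K q m n. \<bar>\<Prod>k\<in>{1..K}. a (t k)\<bar>)"

text \<open>The maxima below are over nonempty sets as soon as \<open>n \<ge> 2 * m - 1\<close>.\<close>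

definition M1 ::
  "'w measure \<Rightarrow> (nat \<Rightarrow> 'w \<Rightarrow> 'x) \<Rightarrow> nat \<Rightarrow> nat \<Rightarrow> ((nat \<Rightarrow> 'x) \<Rightarrow> real) \<Rightarrow> real" where
  "M1 P X m n h =
     Max {\<bar>\<theta> P X m h i - \<theta> P X m h j\<bar> | i j.
       i \<in> distinct_tuples {1..n} m \<and> j \<in> distinct_tuples {1..n} m}"

definition meet_only_at :: "nat \<Rightarrow> (nat \<Rightarrow> nat) \<Rightarrow> (nat \<Rightarrow> nat) \<Rightarrow> nat \<Rightarrow> nat \<Rightarrow> bool" where
  "meet_only_at m r s p q \<longleftrightarrow> r ` {1..m} \<inter> s ` {1..m} = {r p} \<and> r p = s q"

definition cond_prod_mean ::
  "'w measure \<Rightarrow> 'x measure \<Rightarrow> (nat \<Rightarrow> 'w \<Rightarrow> 'x) \<Rightarrow> nat \<Rightarrow> ((nat \<Rightarrow> 'x) \<Rightarrow> real)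
     \<Rightarrow> (nat \<Rightarrow> nat) \<Rightarrow> (nat \<Rightarrow> nat) \<Rightarrow> nat \<Rightarrow> real" where
  "cond_prod_mean P N X m h r s j =
     (\<integral>\<omega>. real_cond_exp P (vimage_algebra (space P) (X j) N)
        (\<lambda>\<omega>'. h (at_indices m (\<lambda>i. X i \<omega>') r) * h (at_indices m (\<lambda>i. X i \<omega>') s)) \<omega> \<partial>P)"

definition M2 ::
  "'w measure \<Rightarrow> 'x measure \<Rightarrow> (nat \<Rightarrow> 'w \<Rightarrow> 'x) \<Rightarrow> nat \<Rightarrow> nat
     \<Rightarrow> ((nat \<Rightarrow> 'x) \<Rightarrow> real) \<Rightarrow> real" where
  "M2 P N X m n h =
     Max {\<bar>cond_prod_mean P N X m h r s (k p) - cond_prod_mean P N X m h k s (k p)\<bar> | p q r s k.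
       p \<in> {1..m} \<and> q \<in> {1..m} \<and>
       r \<in> distinct_tuples {1..n} m \<and> s \<in> distinct_tuples {1..n} m \<and>
       k \<in> distinct_tuples {1..n} m \<and>
       meet_only_at m r s p q \<and> meet_only_at m k s p q}"

text \<open>
  \<open>max_sq_obs\<close> and \<open>max_sq_indep\<close> differ only for tuples with repeated indices: there the
  repeated index stands for one and the same observation in \<open>max_sq_obs\<close>, and for independent
  draws from the same distribution in \<open>max_sq_indep\<close>. The former occurs in the bootstrap
  statistic, e.g. as \<open>h (X\<^sub>j, X\<^sub>j)\<close> for \<open>m = 2\<close>; the latter in \<open>h1 i (X\<^sub>j)\<close> with \<open>j \<noteq> i\<close>,
  which contains \<open>\<integral> h (X\<^sub>j, y) dP\<^sub>j(y)\<close>.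
\<close>

definition max_sq_obs ::
  "'w measure \<Rightarrow> (nat \<Rightarrow> 'w \<Rightarrow> 'x) \<Rightarrow> nat \<Rightarrow> nat \<Rightarrow> ((nat \<Rightarrow> 'x) \<Rightarrow> real) \<Rightarrow> ennreal" where
  "max_sq_obs P X m n h =
     (SUP i\<in>{1..m} \<rightarrow>\<^sub>E {1..n}. \<integral>\<^sup>+\<omega>. ennreal ((h (at_indices m (\<lambda>j. X j \<omega>) i))\<^sup>2) \<partial>P)"

definition max_sq_indep ::
  "'w measure \<Rightarrow> 'x measure \<Rightarrow> (nat \<Rightarrow> 'w \<Rightarrow> 'x) \<Rightarrow> nat \<Rightarrow> nat
     \<Rightarrow> ((nat \<Rightarrow> 'x) \<Rightarrow> real) \<Rightarrow> ennreal" where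
  "max_sq_indep P N X m n h =
     (SUP i\<in>{1..m} \<rightarrow>\<^sub>E {1..n}.
        \<integral>\<^sup>+x. ennreal ((h x)\<^sup>2) \<partial>(\<Pi>\<^sub>M k\<in>{1..m}. distr P N (X (i k))))"

definition empirical :: "nat \<Rightarrow> (nat \<Rightarrow> 'x) \<Rightarrow> 'x pmf" where
  "empirical n x = map_pmf x (pmf_of_set {1..n})"

text \<open>
  Given data \<open>x 1, \<dots>, x n\<close>, the conditional law of the bootstrap sample
  \<open>(X\<^sub>1*, \<dots>, X\<^sub>n*)\<close> is the \<open>n\<close>-fold product of the empirical distribution, and the
  conditional variance of the bootstrap statistic is its variance under this law.
\<close>

definition bootstrap_law :: "nat \<Rightarrow> (nat \<Rightarrow> 'x) \<Rightarrow> (nat \<Rightarrow> 'x) pmf" where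
  "bootstrap_law n x = Pi_pmf {1..n} undefined (\<lambda>_. empirical n x)"

definition bootstrap_variance :: "nat \<Rightarrow> (nat \<Rightarrow> 'x) \<Rightarrow> ((nat \<Rightarrow> 'x) \<Rightarrow> real) \<Rightarrow> real" where
  "bootstrap_variance n x T = measure_pmf.variance (bootstrap_law n x) T"

text \<open>Each row may live on its own probability space, so the limit is a constant.\<close>

definition tendsto_in_prob ::
  "(nat \<Rightarrow> 'w measure) \<Rightarrow> (nat \<Rightarrow> 'w \<Rightarrow> real) \<Rightarrow> real \<Rightarrow> bool" where
  "tendsto_in_prob P Y c \<longleftrightarrow>
     (\<forall>\<epsilon>>0. (\<lambda>n. measure (P n) {\<omega> \<in> space (P n). \<bar>Y n \<omega> - c\<bar> > \<epsilon>}) \<longlonglongrightarrow> 0)"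

end

theory Submission
  imports Defs
begin

text \<open>
  The variance of \<open>wU\<close> is a weighted sum, over pairs \<open>(r, s)\<close> of index tuples, of the
  covariances of \<open>h(X\<^sub>r)\<close> and \<open>h(X\<^sub>s)\<close>. If \<open>r\<close> and \<open>s\<close> have no index in common, the covariance
  vanishes. If they have exactly one, both kernels may be replaced by their conditional
  expectations given the shared observation, and the covariances that arise in this way are
  the ones that make up \<open>\<Sum>\<^sub>i Var(h1 i (X\<^sub>i) / n)\<close>. The pairs with two or more common indices
  are left over; their total weight \<open>overlap_mass 2\<close> is of order \<open>n\<^sup>-\<^sup>2 A_avg 2 2\<close>, so they
  contribute at most a constant times \<open>overlap_mass 2\<close> times the largest second moment of the
  kernel. This is lemma \<open>variance_wU_approx\<close>, valid for every independent sample.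

  It is used twice. Applied to the data, it gives \<open>\<bar>\<sigma>\<^sup>2 - V\<bar> = o(V)\<close>, whence \<open>V \<le> 2 \<sigma>\<^sup>2\<close>
  eventually, so that rates relative to \<open>V\<close> become rates relative to \<open>\<sigma>\<^sup>2\<close>. Applied
  conditionally on the data to the resampled indices, which are independent and uniform on
  \<open>{1..n}\<close>, it reduces the bootstrap variance to a sum over \<open>i\<close> of empirical variances
  (\<open>bootstrap_variance_approx\<close>). The summands have the form of the empirical variance of
  \<open>h1 i (X\<^sub>j) / n\<close> over \<open>j\<close>, but with the projection \<open>f_proj\<close> of the kernel under the true laws
  replaced by its bootstrap analogue \<open>boot_proj\<close>, an average of the kernel over all tuples of
  observations. With the true projections the sum, divided by \<open>\<sigma>\<^sup>2\<close>, is the difference of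
  the two quantities in the hypotheses on \<open>h1\<close>, so it tends to \<open>1\<close> in probability.

  There remains the mean square difference of the two kinds of projections
  (\<open>integral_total_error_le\<close>), which is again a sum over pairs of index tuples. For a pair with
  one common index, write the bootstrap projections as averages over tuples \<open>J\<close>, \<open>J'\<close> and let
  \<open>j\<close> be the index of the observation at which they are evaluated. When all the indices
  involved are different, independence turns the expectation into an alternating sum of four
  terms \<open>E(h(X\<^sub>u) h(X\<^sub>v))\<close> with \<open>u\<close> and \<open>v\<close> meeting in \<open>j\<close> only, and two applications of the
  heterogeneity measure \<open>M2\<close> bound it. The other choices of \<open>J\<close>, \<open>J'\<close>, \<open>j\<close> form a fraction
  \<open>O(1/n)\<close> and are controlled by the uniform second moments. Since the pairs with a common
  index have total weight of order \<open>n\<^sup>-\<^sup>1 A_avg 2 1\<close>, and those with several common indices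
  the weight \<open>overlap_mass 2\<close>, the error is negligible against \<open>\<sigma>\<^sup>2\<close>. Markov's inequality
  then gives the convergence in probability (\<open>prob_bootstrap_variance_far_le\<close>).
\<close>

section \<open>Tuples of indices\<close>

text \<open>
  The inverse of \<open>insert_at\<close>: it lists the entries of a tuple other than the one at position \<open>p\<close>.
  Together the two operations translate between pairs of an index \<open>i\<close> and a tuple avoiding \<open>i\<close>, as
  in \<open>h1\<close>, and full tuples with a marked position.
\<close>

definition drop_at :: "nat \<Rightarrow> nat \<Rightarrow> (nat \<Rightarrow> 'b) \<Rightarrow> nat \<Rightarrow> 'b" where
  "drop_at m p r = (\<lambda>k\<in>{1..m - 1}. if k < p then r k else r (k + 1))"

lemma insert_drop_at:
  assumes "r \<in> extensional {1..m}" "p \<in> {1..m}"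
  shows "insert_at m p i (drop_at m p r) = r(p := i)"
proof
  fix k show "insert_at m p i (drop_at m p r) k = (r(p := i)) k"
    using assms by (cases "k \<in> {1..m}")
      (auto simp: insert_at_def drop_at_def extensional_def restrict_def)
qed

lemma drop_insert_at:
  assumes "j \<in> extensional {1..m - 1}" "p \<in> {1..m}"
  shows "drop_at m p (insert_at m p i j) = j"
proof
  fix k show "drop_at m p (insert_at m p i j) k = j k"
    using assms by (cases "k \<in> {1..m - 1}")
      (auto simp: insert_at_def drop_at_def extensional_def restrict_def)
qed

lemma drop_at_fun_upd: "drop_at m p (r(p := i)) = drop_at m p r"
  by (auto simp: drop_at_def fun_eq_iff)

lemma drop_at_image:
  assumes "p \<in> {1..m}"
  shows "drop_at m p r ` {1..m - 1} = r ` ({1..m} - {p})"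
proof -
  have "(\<lambda>k. if k < p then k else k + 1) ` {1..m - 1} = {1..m} - {p}" (is "?l = ?r")
  proof
    show "?l \<subseteq> ?r" using assms by auto
    show "?r \<subseteq> ?l"
    proof
      fix x assume x: "x \<in> ?r"
      show "x \<in> ?l"
      proof (cases "x < p")
        case True then show ?thesis using x assms by (intro image_eqI[of _ _ x]) auto
      next
        case False then show ?thesis using x assms by (intro image_eqI[of _ _ "x - 1"]) auto
      qed
    qed
  qed
  then have "r ` ({1..m} - {p}) = r ` (\<lambda>k. if k < p then k else k + 1) ` {1..m - 1}"
    by simp
  also have "\<dots> = drop_at m p r ` {1..m - 1}"
    unfolding image_image by (intro image_cong) (auto simp: drop_at_def)
  finally show ?thesis by simp
qed

lemma drop_at_inj_on:
  assumes "inj_on r ({1..m} - {p})" "p \<in> {1..m}"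
  shows "inj_on (drop_at m p r) {1..m - 1}"
proof (rule inj_onI)
  fix k l assume kl: "k \<in> {1..m - 1}" "l \<in> {1..m - 1}" "drop_at m p r k = drop_at m p r l"
  define g where "g k = (if k < p then k else k + 1)" for k :: nat
  have "r (g k) = r (g l)"
    using kl by (auto simp: drop_at_def g_def split: if_splits)
  moreover have "g k \<in> {1..m} - {p}" "g l \<in> {1..m} - {p}"
    using kl assms(2) by (auto simp: g_def)
  ultimately have "g k = g l" using assms(1) by (auto dest: inj_onD)
  then show "k = l" by (auto simp: g_def split: if_splits)
qed

lemma insert_at_PiE:
  assumes "p \<in> {1..m}" "v \<in> S" "z \<in> {1..m - 1} \<rightarrow>\<^sub>E S"
  shows "insert_at m p v z \<in> {1..m} \<rightarrow>\<^sub>E S"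
proof
  fix k assume k: "k \<in> {1..m}"
  consider "k < p" "k \<in> {1..m - 1}" | "k = p" | "k > p" "k - 1 \<in> {1..m - 1}"
    using k assms(1) by force
  then show "insert_at m p v z k \<in> S"
    using k assms(2) PiE_mem[OF assms(3), of k] PiE_mem[OF assms(3), of "k - 1"]
    by cases (simp_all add: insert_at_def)
next
  fix k assume "k \<notin> {1..m}" then show "insert_at m p v z k = undefined"
    unfolding insert_at_def by (simp only: restrict_apply if_False)
qed

text \<open>
  Overwriting position \<open>p\<close> forgets the value found there, so each \<open>(m - 1)\<close>-tuple is
  counted once for every element of \<open>S\<close>. This is why \<open>boot_proj\<close> may average over full tuples.
\<close>

lemma sum_PiE_fun_upd:
  assumes p: "p \<in> {1..m}" and S: "finite S" and j: "j \<in> S"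
  shows "(\<Sum>J\<in>{1..m} \<rightarrow>\<^sub>E S. G (J(p := j))) =
    real (card S) * (\<Sum>z\<in>{1..m - 1} \<rightarrow>\<^sub>E S. (G (insert_at m p j z) :: real))"
proof -
  have d: "drop_at m p J \<in> {1..m - 1} \<rightarrow>\<^sub>E S" if "J \<in> {1..m} \<rightarrow>\<^sub>E S" for J
  proof
    fix k assume "k \<in> {1..m - 1}"
    then have "drop_at m p J k \<in> J ` ({1..m} - {p})" unfolding drop_at_image[OF p, symmetric] by (rule imageI)
    then show "drop_at m p J k \<in> S" using PiE_mem[OF that] by auto
  next
    fix k assume "k \<notin> {1..m - 1}" then show "drop_at m p J k = undefined"
      unfolding drop_at_def by (simp only: restrict_apply if_False)
  qed
  have ext: "J \<in> extensional {1..m}" if "J \<in> {1..m} \<rightarrow>\<^sub>E S" for J using that by (simp add: PiE_def)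
  have ext': "z \<in> extensional {1..m - 1}" if "z \<in> {1..m - 1} \<rightarrow>\<^sub>E S" for z using that by (simp add: PiE_def)
  have "(\<Sum>J\<in>{1..m} \<rightarrow>\<^sub>E S. G (J(p := j))) = (\<Sum>(v, z)\<in>S \<times> ({1..m - 1} \<rightarrow>\<^sub>E S). G (insert_at m p j z))"
  proof (rule sum.reindex_bij_witness[of _ "\<lambda>(v, z). insert_at m p v z" "\<lambda>J. (J p, drop_at m p J)"])
    fix J assume J: "J \<in> {1..m} \<rightarrow>\<^sub>E S"
    show "(case (J p, drop_at m p J) of (v, z) \<Rightarrow> insert_at m p v z) = J"
      using insert_drop_at[OF ext[OF J] p, of "J p"] by simp
    show "(J p, drop_at m p J) \<in> S \<times> ({1..m - 1} \<rightarrow>\<^sub>E S)" using d[OF J] PiE_mem[OF J p] by simp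
    show "(case (J p, drop_at m p J) of (v, z) \<Rightarrow> G (insert_at m p j z)) = G (J(p := j))"
      using insert_drop_at[OF ext[OF J] p, of j] by simp
  next
    fix x assume x: "x \<in> S \<times> ({1..m - 1} \<rightarrow>\<^sub>E S)"
    then obtain v z where vz: "x = (v, z)" "v \<in> S" "z \<in> {1..m - 1} \<rightarrow>\<^sub>E S" by auto
    show "(case x of (v, z) \<Rightarrow> insert_at m p v z) \<in> {1..m} \<rightarrow>\<^sub>E S"
      using insert_at_PiE[OF p vz(2,3)] by (simp add: vz(1))
    show "((case x of (v, z) \<Rightarrow> insert_at m p v z) p, drop_at m p (case x of (v, z) \<Rightarrow> insert_at m p v z)) = x"
      using drop_insert_at[OF ext'[OF vz(3)] p, of v] p by (simp add: vz(1) insert_at_def)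
  qed
  also have "\<dots> = (\<Sum>v\<in>S. \<Sum>z\<in>{1..m - 1} \<rightarrow>\<^sub>E S. G (insert_at m p j z))"
    by (rule sum.cartesian_product[symmetric])
  finally show ?thesis by simp
qed

lemma finite_distinct_tuples [simp]: "finite S \<Longrightarrow> finite (distinct_tuples S m)"
  unfolding distinct_tuples_def by (rule finite_subset[of _ "{1..m} \<rightarrow>\<^sub>E S"]) (auto intro: finite_PiE)

lemma distinct_tuplesD:
  assumes "r \<in> distinct_tuples S m"
  shows "r \<in> {1..m} \<rightarrow>\<^sub>E S" "inj_on r {1..m}" "r \<in> extensional {1..m}"
    "k \<in> {1..m} \<Longrightarrow> r k \<in> S"
  using assms by (auto simp: distinct_tuples_def PiE_iff)

lemma distinct_tuples_fun_upd:
  assumes "r \<in> distinct_tuples S m" "p \<in> {1..m}" "j \<in> S" "j \<notin> r ` ({1..m} - {p})"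
  shows "r(p := j) \<in> distinct_tuples S m"
proof -
  have "inj_on r ({1..m} - {p})"
    using distinct_tuplesD(2)[OF assms(1)] by (rule inj_on_subset) simp
  then have 1: "inj_on (r(p := j)) ({1..m} - {p})"
    by (rule inj_on_cong[THEN iffD1, rotated]) simp
  have "(r(p := j)) ` ({1..m} - {p}) = r ` ({1..m} - {p})"
    by (rule image_cong) simp_all
  with 1 assms(4) have "inj_on (r(p := j)) (insert p ({1..m} - {p}))"
    unfolding inj_on_insert by simp
  then have "inj_on (r(p := j)) {1..m}" using assms(2) by (simp add: insert_absorb)
  moreover have "r(p := j) \<in> {1..m} \<rightarrow>\<^sub>E S"
    using PiE_fun_upd[OF assms(3) distinct_tuplesD(1)[OF assms(1)], of p] assms(2)
    by (simp add: insert_absorb)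
  ultimately show ?thesis by (simp add: distinct_tuples_def)
qed

lemma distinct_Diff_image:
  assumes "s \<in> distinct_tuples S m" "q \<in> {1..m}"
  shows "s ` ({1..m} - {q}) = s ` {1..m} - {s q}"
  using distinct_tuplesD(2)[OF assms(1)] assms(2) by (subst inj_on_image_set_diff[of s "{1..m}"]) auto

lemma drop_at_distinct:
  assumes "r \<in> distinct_tuples S m" "p \<in> {1..m}"
  shows "drop_at m p r \<in> distinct_tuples (S - {r p}) (m - 1)"
proof -
  have "drop_at m p r ` {1..m - 1} \<subseteq> S - {r p}"
    unfolding drop_at_image[OF assms(2)] using distinct_tuplesD[OF assms(1)] assms(2)
    by (auto dest: inj_onD)
  moreover have "inj_on (drop_at m p r) {1..m - 1}"
    using distinct_tuplesD(2)[OF assms(1)] assms(2)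
    by (intro drop_at_inj_on) (auto intro: inj_on_subset)
  ultimately show ?thesis
    unfolding distinct_tuples_def by (auto simp: drop_at_def PiE_iff image_subset_iff)
qed

lemma insert_at_distinct:
  assumes "j \<in> distinct_tuples (S - {i}) (m - 1)" "p \<in> {1..m}" "i \<in> S"
  shows "insert_at m p i j \<in> distinct_tuples S m" "insert_at m p i j p = i"
proof -
  let ?r = "insert_at m p i j"
  show rp: "?r p = i" using assms(2) by (simp add: insert_at_def)
  have d: "drop_at m p ?r = j"
    using distinct_tuplesD(3)[OF assms(1)] assms(2) by (rule drop_insert_at)
  have im: "?r ` ({1..m} - {p}) = j ` {1..m - 1}"
    using drop_at_image[OF assms(2), of ?r] d by simp
  have jS: "j ` {1..m - 1} \<subseteq> S - {i}" using distinct_tuplesD(4)[OF assms(1)] by blast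
  have eq: "{1..m} = insert p ({1..m} - {p})" using assms(2) by auto
  have "?r ` {1..m} \<subseteq> S"
  proof (rule image_subsetI)
    fix k assume "k \<in> {1..m}"
    show "?r k \<in> S"
    proof (cases "k = p")
      case False
      then have "?r k \<in> ?r ` ({1..m} - {p})" using \<open>k \<in> {1..m}\<close> by (intro imageI) simp
      then have "?r k \<in> j ` {1..m - 1}" unfolding im .
      then show ?thesis using jS by auto
    qed (simp add: rp assms(3))
  qed
  moreover have "inj_on ?r {1..m}"
  proof -
    have "card (?r ` ({1..m} - {p})) = card ({1..m} - {p})"
      unfolding im using assms(2) distinct_tuplesD(2)[OF assms(1)] by (simp add: card_image)
    then have "inj_on ?r ({1..m} - {p})" by (intro eq_card_imp_inj_on) auto
    moreover have "i \<notin> ?r ` ({1..m} - {p})" using im jS by auto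
    ultimately have "inj_on ?r (insert p ({1..m} - {p}))"
      unfolding inj_on_insert rp by simp
    then show ?thesis using eq by simp
  qed
  ultimately show "?r \<in> distinct_tuples S m"
    unfolding distinct_tuples_def by (auto simp: insert_at_def PiE_iff image_subset_iff)
qed

text \<open>
  Summation over a tuple avoiding \<open>i\<close> and a position for \<open>i\<close>, as in \<open>h1\<close>, is summation over the
  full tuples that contain \<open>i\<close> and the place where they do.
\<close>

lemma sum_distinct_insert_at:
  assumes "i \<in> S" "finite S"
  shows "(\<Sum>j\<in>distinct_tuples (S - {i}) (m - 1). \<Sum>p\<in>{1..m}. g p j (insert_at m p i j)) =
    (\<Sum>r\<in>distinct_tuples S m. \<Sum>p | p \<in> {1..m} \<and> r p = i. (g p (drop_at m p r) r :: real))"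
proof -
  have "(\<Sum>j\<in>distinct_tuples (S - {i}) (m - 1). \<Sum>p\<in>{1..m}. g p j (insert_at m p i j)) =
      (\<Sum>p\<in>{1..m}. \<Sum>j\<in>distinct_tuples (S - {i}) (m - 1). g p j (insert_at m p i j))"
    by (rule sum.swap)
  also have "\<dots> = (\<Sum>p\<in>{1..m}. \<Sum>r | r \<in> distinct_tuples S m \<and> r p = i. g p (drop_at m p r) r)"
  proof (rule sum.cong[OF refl])
    fix p assume p: "p \<in> {1..m}"
    show "(\<Sum>j\<in>distinct_tuples (S - {i}) (m - 1). g p j (insert_at m p i j)) =
        (\<Sum>r | r \<in> distinct_tuples S m \<and> r p = i. g p (drop_at m p r) r)"
      by (rule sum.reindex_bij_witness[of _ "drop_at m p" "insert_at m p i"])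
        (use p assms in \<open>auto simp: insert_at_distinct drop_insert_at[OF distinct_tuplesD(3)]
          insert_drop_at[OF distinct_tuplesD(3)] drop_at_distinct[simplified]\<close>)
  qed
  also have "\<dots> = (\<Sum>p\<in>{1..m}. \<Sum>r\<in>distinct_tuples S m. if r p = i then g p (drop_at m p r) r else 0)"
    by (intro sum.cong refl sum.inter_filter) (use assms in auto)
  also have "\<dots> = (\<Sum>r\<in>distinct_tuples S m. \<Sum>p\<in>{1..m}. if r p = i then g p (drop_at m p r) r else 0)"
    by (rule sum.swap)
  also have "\<dots> = (\<Sum>r\<in>distinct_tuples S m. \<Sum>p | p \<in> {1..m} \<and> r p = i. g p (drop_at m p r) r)"
    by (intro sum.cong refl sum.inter_filter[symmetric]) auto
  finally show ?thesis .
qed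

lemma meet_only_at_sym: "meet_only_at m r s p q \<Longrightarrow> meet_only_at m s r q p"
  unfolding meet_only_at_def by (metis Int_commute)

text \<open>
  Two tuples whose remaining entries are disjoint can be made to meet in any fresh index \<open>j\<close>
  by writing \<open>j\<close> at one position of each.
\<close>

lemma meet_only_at_fun_upd:
  assumes "p \<in> {1..m}" "q \<in> {1..m}" "u ` ({1..m} - {p}) \<inter> v ` ({1..m} - {q}) = {}"
    "j \<notin> u ` ({1..m} - {p})" "j \<notin> v ` ({1..m} - {q})"
  shows "meet_only_at m (u(p := j)) (v(q := j)) p q"
proof -
  have im: "(w(l := j)) ` {1..m} = insert j (w ` ({1..m} - {l}))" if "l \<in> {1..m}" for w l
  proof -
    have "(w(l := j)) ` {1..m} = (w(l := j)) ` insert l ({1..m} - {l})" using that by (simp add: insert_absorb)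
    also have "\<dots> = insert j ((w(l := j)) ` ({1..m} - {l}))" by (simp only: image_insert fun_upd_same)
    also have "(w(l := j)) ` ({1..m} - {l}) = w ` ({1..m} - {l})" by (rule image_cong) simp_all
    finally show ?thesis .
  qed
  show ?thesis unfolding meet_only_at_def im[OF assms(1)] im[OF assms(2)] using assms(3-5) by auto
qed

lemma overlap_one_cases:
  assumes "r \<in> distinct_tuples S m" "s \<in> distinct_tuples S m" "card (r ` {1..m} \<inter> s ` {1..m}) = 1"
  obtains p q where "p \<in> {1..m}" "q \<in> {1..m}" "meet_only_at m r s p q"
proof -
  obtain v where v: "r ` {1..m} \<inter> s ` {1..m} = {v}" using assms(3) by (auto simp: card_1_singleton_iff)
  then have "v \<in> r ` {1..m}" "v \<in> s ` {1..m}" by auto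
  then obtain p q where "p \<in> {1..m}" "q \<in> {1..m}" "v = r p" "v = s q" by blast
  then show thesis using v by (intro that[of p q]) (simp_all add: meet_only_at_def)
qed

section \<open>Counting tuples with coincidences\<close>

lemma card_PiE_prescribed_le:
  assumes "finite A" "finite S" "B \<subseteq> A"
  shows "card {T \<in> A \<rightarrow>\<^sub>E S. \<forall>b\<in>B. T b = v b} \<le> card S ^ (card A - card B)"
proof -
  let ?E = "{T \<in> A \<rightarrow>\<^sub>E S. \<forall>b\<in>B. T b = v b}"
  have "inj_on (\<lambda>T. restrict T (A - B)) ?E"
  proof (rule inj_onI)
    fix T U assume T: "T \<in> ?E" and U: "U \<in> ?E" and eq: "restrict T (A - B) = restrict U (A - B)"
    show "T = U"
    proof
      fix x show "T x = U x"
      proof (cases "x \<in> A - B")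
        case True then show ?thesis using fun_cong[OF eq, of x] by simp
      next
        case False then show ?thesis using T U by (cases "x \<in> B") (auto simp: PiE_iff extensional_def)
      qed
    qed
  qed
  then have "card ?E = card ((\<lambda>T. restrict T (A - B)) ` ?E)" by (simp add: card_image)
  also have "\<dots> \<le> card ((A - B) \<rightarrow>\<^sub>E S)"
    by (intro card_mono finite_PiE) (use assms in auto)
  also have "\<dots> = card S ^ (card A - card B)"
    using assms by (simp add: card_PiE card_Diff_subset finite_subset)
  finally show ?thesis .
qed

text \<open>
  A union bound: each of the \<open>m\<^sup>2\<close> coincidences within the tuple and of the \<open>m * card R\<close>
  coincidences with \<open>R\<close> costs one degree of freedom.
\<close>

lemma card_nongeneric_le:
  assumes "finite R"
  shows "card {J \<in> {1..m} \<rightarrow>\<^sub>E {1..n}. \<not> (inj_on J {1..m} \<and> J ` {1..m} \<inter> R = {})}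
     \<le> m * (m + card R) * n ^ (m - 1)"
proof -
  let ?F = "{1..m} \<rightarrow>\<^sub>E {1..n}"
  have fin: "finite ?F" by (auto intro: finite_PiE)
  define D where "D = {(x, y) \<in> {1..m} \<times> {1..m}. x \<noteq> y}"
  have D: "D \<subseteq> {1..m} \<times> {1..m}" by (auto simp: D_def)
  have finD: "finite D" by (rule finite_subset[OF D]) auto
  define U1 where "U1 = (\<Union>xy\<in>D. {J \<in> ?F. J (fst xy) = J (snd xy)})"
  define U2 where "U2 = (\<Union>(x, v)\<in>{1..m} \<times> R. {J \<in> ?F. J x = v})"
  have sub: "{J \<in> ?F. \<not> (inj_on J {1..m} \<and> J ` {1..m} \<inter> R = {})} \<subseteq> U1 \<union> U2"
  proof
    fix J assume "J \<in> {J \<in> ?F. \<not> (inj_on J {1..m} \<and> J ` {1..m} \<inter> R = {})}"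
    then have J: "J \<in> ?F" and "\<not> inj_on J {1..m} \<or> J ` {1..m} \<inter> R \<noteq> {}" by auto
    from this(2) show "J \<in> U1 \<union> U2"
    proof
      assume "\<not> inj_on J {1..m}"
      then obtain x y where "(x, y) \<in> D" "J x = J y" unfolding inj_on_def D_def by blast
      then have "J \<in> U1" using J unfolding U1_def by (intro UN_I[of "(x, y)"]) auto
      then show ?thesis by simp
    next
      assume "J ` {1..m} \<inter> R \<noteq> {}"
      then obtain x v where "(x, v) \<in> {1..m} \<times> R" "J x = v" by blast
      then have "J \<in> U2" using J unfolding U2_def by (intro UN_I[of "(x, v)"]) auto
      then show ?thesis by simp
    qed
  qed
  have c1: "card {J \<in> ?F. J x = v} \<le> n ^ (m - 1)" if "x \<in> {1..m}" for x v
    using card_PiE_prescribed_le[of "{1..m}" "{1..n}" "{x}" "\<lambda>_. v"] that by simp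
  have c2: "card {J \<in> ?F. J x = J y} \<le> n ^ (m - 1)" if "x \<in> {1..m}" "y \<in> {1..m}" "x \<noteq> y" for x y
  proof -
    have m2: "m \<ge> 2" using that by auto
    have "{J \<in> ?F. J x = J y} \<subseteq> (\<Union>v\<in>{1..n}. {J \<in> ?F. \<forall>b\<in>{x, y}. J b = v})"
    proof
      fix J assume J: "J \<in> {J \<in> ?F. J x = J y}"
      then have "J y \<in> {1..n}" using that(2) PiE_mem by blast
      then show "J \<in> (\<Union>v\<in>{1..n}. {J \<in> ?F. \<forall>b\<in>{x, y}. J b = v})" using J by auto
    qed
    then have "card {J \<in> ?F. J x = J y} \<le> card (\<Union>v\<in>{1..n}. {J \<in> ?F. \<forall>b\<in>{x, y}. J b = v})"
      by (intro card_mono) (use fin in auto)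
    also have "\<dots> \<le> (\<Sum>v\<in>{1..n}. card {J \<in> ?F. \<forall>b\<in>{x, y}. J b = v})"
      by (rule card_UN_le) auto
    also have "\<dots> \<le> (\<Sum>v\<in>{1..n}. n ^ (m - 2))"
      by (intro sum_mono order_trans[OF card_PiE_prescribed_le]) (use that in \<open>auto simp: numeral_2_eq_2\<close>)
    also have "\<dots> = n ^ (m - 1)"
    proof -
      obtain k where "m = Suc (Suc k)" using m2 by (auto simp: le_iff_add)
      then show ?thesis by simp
    qed
    finally show ?thesis .
  qed
  have "card U1 \<le> (\<Sum>xy\<in>D. card {J \<in> ?F. J (fst xy) = J (snd xy)})"
    unfolding U1_def by (rule card_UN_le[OF finD])
  also have "\<dots> \<le> (\<Sum>xy\<in>D. n ^ (m - 1))"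
    by (intro sum_mono c2) (auto simp: D_def)
  also have "\<dots> = card D * n ^ (m - 1)" by simp
  also have "\<dots> \<le> m * m * n ^ (m - 1)"
    using card_mono[OF _ D] by (intro mult_right_mono) (auto simp: card_cartesian_product)
  finally have 1: "card U1 \<le> m * m * n ^ (m - 1)" .
  have finR: "finite ({1..m} \<times> R)" using assms by simp
  have "card U2 \<le> (\<Sum>xv\<in>{1..m} \<times> R. card {J \<in> ?F. J (fst xv) = snd xv})"
    unfolding U2_def case_prod_beta by (rule card_UN_le[OF finR])
  also have "\<dots> \<le> (\<Sum>xv\<in>{1..m} \<times> R. n ^ (m - 1))"
    by (intro sum_mono c1) auto
  also have "\<dots> = m * card R * n ^ (m - 1)" by (simp add: card_cartesian_product)
  finally have 2: "card U2 \<le> m * card R * n ^ (m - 1)" .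
  have "card {J \<in> ?F. \<not> (inj_on J {1..m} \<and> J ` {1..m} \<inter> R = {})} \<le> card (U1 \<union> U2)"
    by (rule card_mono[OF _ sub]) (rule finite_subset[OF _ fin], auto simp: U1_def U2_def)
  also have "\<dots> \<le> card U1 + card U2" by (rule card_Un_le)
  also have "\<dots> \<le> m * (m + card R) * n ^ (m - 1)" using 1 2 by (simp add: algebra_simps)
  finally show ?thesis .
qed

text \<open>
  Drawing a tuple at random from \<open>{1..n}\<close>, one expects its entries to be different from each other
  and from a few given indices.
\<close>

definition generic :: "nat \<Rightarrow> (nat \<Rightarrow> nat) \<Rightarrow> nat set \<Rightarrow> bool" where
  "generic m J R \<longleftrightarrow> inj_on J {1..m} \<and> J ` {1..m} \<inter> R = {}"

lemma sum_nongeneric_le: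
  assumes "finite R" "card R \<le> k" "0 < n"
  shows "(\<Sum>J\<in>{1..m} \<rightarrow>\<^sub>E {1..n}. of_bool (\<not> generic m J R)) / real n ^ m \<le> real m * (real m + k) / n"
proof (cases "m = 0")
  case False
  have fin: "finite ({1..m} \<rightarrow>\<^sub>E {1..n})" by (auto intro: finite_PiE)
  have "(\<Sum>J\<in>{1..m} \<rightarrow>\<^sub>E {1..n}. of_bool (\<not> generic m J R)) =
      real (card {J \<in> {1..m} \<rightarrow>\<^sub>E {1..n}. \<not> generic m J R})"
    using fin by (simp add: sum.If_cases of_bool_def Int_def)
  also have "\<dots> \<le> real (m * (m + card R) * n ^ (m - 1))"
    unfolding generic_def by (intro of_nat_mono card_nongeneric_le assms)
  also have "\<dots> \<le> real (m * (m + k) * n ^ (m - 1))"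
    using assms by (intro of_nat_mono mult_right_mono mult_left_mono) auto
  finally have "(\<Sum>J\<in>{1..m} \<rightarrow>\<^sub>E {1..n}. of_bool (\<not> generic m J R)) / real n ^ m
      \<le> real (m * (m + k) * n ^ (m - 1)) / real n ^ m"
    by (rule divide_right_mono) simp
  also have "\<dots> = real m * (real m + k) / n"
  proof -
    have "real n ^ m = real n ^ (m - 1) * real n" using False by (cases m) auto
    then show ?thesis using assms by (simp only: of_nat_mult of_nat_add of_nat_power) simp
  qed
  finally show ?thesis .
qed (simp add: generic_def)

lemma card_image_atLeastAtMost_le: "card (u ` {1..m}) \<le> m"
  using card_image_le[of "{1..m}" u] by simp

definition overlap_pairs :: "nat \<Rightarrow> nat \<Rightarrow> nat \<Rightarrow> ((nat \<Rightarrow> nat) \<times> (nat \<Rightarrow> nat)) set" where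
  "overlap_pairs q m n = {(r, s). r \<in> distinct_tuples {1..n} m \<and> s \<in> distinct_tuples {1..n} m \<and>
     q \<le> card (r ` {1..m} \<inter> s ` {1..m})}"

lemma finite_overlap_pairs [simp]: "finite (overlap_pairs q m n)"
  by (rule finite_subset[of _ "distinct_tuples {1..n} m \<times> distinct_tuples {1..n} m"])
    (auto simp: overlap_pairs_def)

text \<open>
  Given \<open>r\<close>, a tuple \<open>s\<close> sharing \<open>q\<close> indices with it is determined on some set \<open>B\<close> of \<open>q\<close>
  positions by a map \<open>e\<close> from positions of \<open>s\<close> to positions of \<open>r\<close>. The factor \<open>2\<^sup>m m\<^sup>m\<close> counts
  the pairs \<open>(B, e)\<close>.
\<close>

lemma card_overlap_pairs_le:
  assumes "q \<le> m"
  shows "card (overlap_pairs q m n) \<le> 2 ^ m * m ^ m * n ^ (2 * m - q)"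
proof -
  let ?F = "{1..m} \<rightarrow>\<^sub>E {1..n}"
  let ?K = "{B \<in> Pow {1..m}. card B = q} \<times> ({1..m} \<rightarrow>\<^sub>E {1..m})"
  let ?G = "\<lambda>(B, e). SIGMA r:?F. {s \<in> ?F. \<forall>b\<in>B. s b = r (e b)}"
  have fin: "finite ?F" by (auto intro: finite_PiE)
  have finK: "finite ?K" by (auto intro: finite_PiE)
  have "overlap_pairs q m n \<subseteq> (\<Union>k\<in>?K. ?G k)"
  proof
    fix x assume "x \<in> overlap_pairs q m n"
    then obtain r s where x: "x = (r, s)" and r: "r \<in> distinct_tuples {1..n} m" and s: "s \<in> distinct_tuples {1..n} m"
      and q: "q \<le> card (r ` {1..m} \<inter> s ` {1..m})" by (auto simp: overlap_pairs_def)
    obtain Q where Q: "Q \<subseteq> r ` {1..m} \<inter> s ` {1..m}" "card Q = q"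
      using obtain_subset_with_card_n[OF q] by blast
    define B where "B = {b \<in> {1..m}. s b \<in> Q}"
    define e where "e = (\<lambda>b\<in>{1..m}. if b \<in> B then inv_into {1..m} r (s b) else b)"
    have sB: "s ` B = Q" using Q by (auto simp: B_def)
    have "inj_on s B" using distinct_tuplesD(2)[OF s] by (rule inj_on_subset) (auto simp: B_def)
    then have "card B = q" using sB Q(2) card_image by metis
    moreover have eB: "e b \<in> {1..m} \<and> s b = r (e b)" if "b \<in> B" for b
    proof -
      have "s b \<in> r ` {1..m}" using that Q by (auto simp: B_def)
      then show ?thesis using that f_inv_into_f[of "s b" r "{1..m}"] inv_into_into[of "s b" r "{1..m}"]
        by (simp add: e_def B_def)
    qed
    moreover have "e \<in> {1..m} \<rightarrow>\<^sub>E {1..m}"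
    proof (intro PiE_I)
      fix b assume "b \<in> {1..m}"
      then show "e b \<in> {1..m}" using eB[of b] by (cases "b \<in> B") (auto simp: e_def)
    next
      fix b assume "b \<notin> {1..m}"
      then show "e b = undefined" unfolding e_def by (rule restrict_apply[THEN trans, OF if_not_P])
    qed
    moreover have "B \<subseteq> {1..m}" by (auto simp: B_def)
    ultimately have "(B, e) \<in> ?K" "x \<in> ?G (B, e)"
      using distinct_tuplesD(1)[OF r] distinct_tuplesD(1)[OF s] by (simp_all add: x)
    then show "x \<in> (\<Union>k\<in>?K. ?G k)" by blast
  qed
  then have "card (overlap_pairs q m n) \<le> card (\<Union>k\<in>?K. ?G k)"
    by (intro card_mono finite_UN_I finK) (use fin in auto)
  also have "\<dots> \<le> (\<Sum>k\<in>?K. card (?G k))" by (rule card_UN_le[OF finK])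
  also have "\<dots> \<le> (\<Sum>k\<in>?K. n ^ (2 * m - q))"
  proof (intro sum_mono)
    fix k assume k: "k \<in> ?K"
    obtain B e where ke: "k = (B, e)" by force
    have "card (?G k) = (\<Sum>r\<in>?F. card {s \<in> ?F. \<forall>b\<in>B. s b = r (e b)})"
      unfolding ke prod.case by (rule card_SigmaI) (use fin in auto)
    also have "\<dots> \<le> (\<Sum>r\<in>?F. n ^ (m - q))"
      by (intro sum_mono order_trans[OF card_PiE_prescribed_le]) (use k ke in auto)
    also have "\<dots> = n ^ (m + (m - q))" by (simp add: card_PiE power_add)
    also have "m + (m - q) = 2 * m - q" using assms by simp
    finally show "card (?G k) \<le> n ^ (2 * m - q)" .
  qed
  also have "\<dots> = card ?K * n ^ (2 * m - q)" by simp
  also have "card ?K \<le> card (Pow {1..m} \<times> ({1..m} \<rightarrow>\<^sub>E {1..m}))"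
    by (intro card_mono) (auto intro: finite_PiE)
  also have "\<dots> = 2 ^ m * m ^ m" by (simp add: card_cartesian_product card_Pow card_PiE)
  finally show ?thesis by simp
qed

section \<open>Weighted sums over pairs of tuples\<close>

definition tuple_weight :: "nat \<Rightarrow> nat \<Rightarrow> real" where
  "tuple_weight m n = fact (n - m) / fact n"

lemma tuple_weight_nonneg: "0 \<le> tuple_weight m n"
  by (simp add: tuple_weight_def)

text \<open>
  Each of the \<open>k\<close> factors of the falling factorial is at least \<open>n / 2\<close>.
\<close>

lemma half_power_fact_le:
  assumes "2 * k \<le> n"
  shows "(real n / 2) ^ k * fact (n - k) \<le> fact n"
  using assms
proof (induction k)
  case (Suc k)
  have "(real n / 2) ^ Suc k * fact (n - Suc k) = (real n / 2) ^ k * (real n / 2 * fact (n - Suc k))"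
    by simp
  also have "\<dots> \<le> (real n / 2) ^ k * (real (n - k) * fact (n - Suc k))"
    using Suc.prems by (intro mult_left_mono mult_right_mono) auto
  also have "real (n - k) * fact (n - Suc k) = fact (n - k)"
    using Suc.prems by (subst fact_num_eq_if[of "n - k"]) (auto simp: of_nat_diff)
  also have "(real n / 2) ^ k * fact (n - k) \<le> fact n" using Suc by simp
  finally show ?case .
qed simp

lemma tuple_weight_le:
  assumes "2 * m \<le> n"
  shows "tuple_weight m n \<le> 2 ^ m / real n ^ m"
proof (cases "n = 0")
  case False
  then have "0 < real n ^ m" by simp
  moreover have "real n ^ m * fact (n - m) \<le> 2 ^ m * fact n"
    using half_power_fact_le[OF assms] by (simp add: power_divide divide_le_eq mult.commute)
  ultimately show ?thesis
    unfolding tuple_weight_def by (simp add: pos_divide_le_eq pos_le_divide_eq mult.commute)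
next
  case True
  then show ?thesis using assms by (simp add: tuple_weight_def)
qed

text \<open>
  Up to a constant factor this is \<open>A_avg 2 q m n a / n\<^sup>q\<close>, see \<open>overlap_mass_le_A_avg\<close>. Unlike the
  averages, these masses decrease in \<open>q\<close>.
\<close>

definition overlap_mass :: "nat \<Rightarrow> nat \<Rightarrow> nat \<Rightarrow> ((nat \<Rightarrow> nat) \<Rightarrow> real) \<Rightarrow> real" where
  "overlap_mass q m n a = (tuple_weight m n)\<^sup>2 * (\<Sum>(r, s)\<in>overlap_pairs q m n. \<bar>a r * a s\<bar>)"

lemma sum_overlap_ge_2:
  "(\<Sum>t\<in>overlap_ge 2 q m n. g (t 1) (t 2)) = (\<Sum>(r, s)\<in>overlap_pairs q m n. g r s)"
proof (rule sum.reindex_bij_witness[of _ "\<lambda>(r, s). \<lambda>k\<in>{1..2}. if k = 1 then r else s" "\<lambda>t. (t 1, t 2)"])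
  have two: "{Suc 0..2} = {1, 2}" by auto
  fix t assume "t \<in> overlap_ge 2 q m n"
  then have t: "t \<in> {1..2} \<rightarrow>\<^sub>E distinct_tuples {1..n} m" "q \<le> card (\<Inter>k\<in>{1..2}. t k ` {1..m})"
    by (auto simp: overlap_ge_def)
  show "(case (t 1, t 2) of (r, s) \<Rightarrow> \<lambda>k\<in>{1..2}. if k = 1 then r else s) = t"
  proof
    fix k show "(case (t 1, t 2) of (r, s) \<Rightarrow> \<lambda>k\<in>{1..2}. if k = 1 then r else s) k = t k"
      using PiE_arb[OF t(1), of k] by (cases "k \<in> {1, 2}") (auto simp: two)
  qed
  show "(t 1, t 2) \<in> overlap_pairs q m n"
    using PiE_mem[OF t(1), of 1] PiE_mem[OF t(1), of 2] t(2) by (simp add: overlap_pairs_def two)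
  show "(case (t 1, t 2) of (r, s) \<Rightarrow> g r s) = g (t 1) (t 2)" by simp
next
  have two: "{Suc 0..2} = {1, 2}" by auto
  fix x assume x: "x \<in> overlap_pairs q m n"
  obtain r s where rs: "x = (r, s)" by force
  show "((case x of (r, s) \<Rightarrow> \<lambda>k\<in>{1..2::nat}. if k = 1 then r else s) 1,
         (case x of (r, s) \<Rightarrow> \<lambda>k\<in>{1..2::nat}. if k = 1 then r else s) 2) = x"
    by (simp add: rs)
  show "(case x of (r, s) \<Rightarrow> \<lambda>k\<in>{1..2}. if k = 1 then r else s) \<in> overlap_ge 2 q m n"
    using x by (simp add: rs overlap_ge_def overlap_pairs_def two PiE_def Pi_def extensional_def)
qed

lemma A_avg_nonneg: "0 \<le> A_avg K q m n a"
  by (simp add: A_avg_def sum_nonneg)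

lemma overlap_mass_nonneg: "0 \<le> overlap_mass q m n a"
  by (auto simp: overlap_mass_def intro!: mult_nonneg_nonneg sum_nonneg)

lemma sum_overlap_pairs_eq_A_avg:
  "(\<Sum>(r, s)\<in>overlap_pairs q m n. \<bar>a r * a s\<bar>) = card (overlap_pairs q m n) * A_avg 2 q m n a"
proof -
  have two: "{Suc 0..2} = {1, 2}" by auto
  have c: "card (overlap_ge 2 q m n) = card (overlap_pairs q m n)"
    using sum_overlap_ge_2[of "\<lambda>_ _. 1::nat" q m n] by simp
  have "A_avg 2 q m n a = 1 / card (overlap_pairs q m n) * (\<Sum>(r, s)\<in>overlap_pairs q m n. \<bar>a r * a s\<bar>)"
    unfolding A_avg_def c by (subst sum_overlap_ge_2[symmetric]) (simp add: two)
  then show ?thesis by (cases "card (overlap_pairs q m n) = 0") auto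
qed

lemma overlap_mass_le_A_avg:
  assumes "q \<le> m" "2 * m \<le> n" "0 < n"
  shows "overlap_mass q m n a \<le> 8 ^ m * real m ^ m / real n ^ q * A_avg 2 q m n a"
proof -
  have "(tuple_weight m n)\<^sup>2 * real (card (overlap_pairs q m n))
     \<le> (2 ^ m / real n ^ m)\<^sup>2 * real (2 ^ m * m ^ m * n ^ (2 * m - q))"
    by (intro mult_mono power_mono tuple_weight_le assms tuple_weight_nonneg of_nat_mono card_overlap_pairs_le) auto
  also have "\<dots> = 8 ^ m * real m ^ m / real n ^ q"
  proof -
    have n: "real n ^ m * real n ^ m = real n ^ (2 * m - q) * real n ^ q"
      using assms by (simp flip: power_add mult_2)
    have "(8::real) ^ m = 2 ^ m * 2 ^ m * 2 ^ m" by (simp flip: power_mult_distrib)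
    then have "(2 ^ m / real n ^ m)\<^sup>2 * real (2 ^ m * m ^ m * n ^ (2 * m - q)) =
        8 ^ m * real m ^ m * real n ^ (2 * m - q) / (real n ^ m * real n ^ m)"
      by (simp add: power_divide power2_eq_square)
    also have "\<dots> = 8 ^ m * real m ^ m / real n ^ q"
      unfolding n using assms(3) by simp
    finally show ?thesis .
  qed
  finally have "(tuple_weight m n)\<^sup>2 * real (card (overlap_pairs q m n)) * A_avg 2 q m n a
    \<le> 8 ^ m * real m ^ m / real n ^ q * A_avg 2 q m n a"
    by (rule mult_right_mono[OF _ A_avg_nonneg])
  then show ?thesis unfolding overlap_mass_def sum_overlap_pairs_eq_A_avg by (simp add: mult.assoc)
qed

lemma overlap_mass_antimono:
  assumes "q \<le> q'"
  shows "overlap_mass q' m n a \<le> overlap_mass q m n a"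
proof -
  have "overlap_pairs q' m n \<subseteq> overlap_pairs q m n"
    using assms by (auto simp: overlap_pairs_def)
  then show ?thesis unfolding overlap_mass_def
    by (intro mult_left_mono sum_mono2) auto
qed

text \<open>
  The common frame of all variance estimates below: terms of a double sum over tuples are
  sorted according to whether the two tuples share no index, exactly one, or more.
\<close>

lemma overlap_sum_bound:
  assumes disj: "\<And>r s. r \<in> distinct_tuples {1..n} m \<Longrightarrow> s \<in> distinct_tuples {1..n} m \<Longrightarrow>
      r ` {1..m} \<inter> s ` {1..m} = {} \<Longrightarrow> z r s = 0"
    and one: "\<And>r s p q. r \<in> distinct_tuples {1..n} m \<Longrightarrow> s \<in> distinct_tuples {1..n} m \<Longrightarrow>
      p \<in> {1..m} \<Longrightarrow> q \<in> {1..m} \<Longrightarrow> meet_only_at m r s p q \<Longrightarrow> \<bar>z r s\<bar> \<le> e1"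
    and two: "\<And>r s. r \<in> distinct_tuples {1..n} m \<Longrightarrow> s \<in> distinct_tuples {1..n} m \<Longrightarrow> \<bar>z r s\<bar> \<le> e2"
    and nonneg: "0 \<le> e1" "0 \<le> e2"
  shows "\<bar>(tuple_weight m n)\<^sup>2 *
      (\<Sum>r\<in>distinct_tuples {1..n} m. \<Sum>s\<in>distinct_tuples {1..n} m. a r * a s * z r s)\<bar>
    \<le> e1 * overlap_mass 1 m n a + e2 * overlap_mass 2 m n a"
proof -
  let ?D = "distinct_tuples {1..n} m"
  define w where "w q = (\<lambda>(r, s). if (r, s) \<in> overlap_pairs q m n then \<bar>a r * a s\<bar> else 0)" for q
  have w: "(\<Sum>x\<in>?D \<times> ?D. w q x) = (\<Sum>(r, s)\<in>overlap_pairs q m n. \<bar>a r * a s\<bar>)" for q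
  proof -
    have "(\<Sum>x\<in>?D \<times> ?D. w q x) = (\<Sum>x\<in>{x \<in> ?D \<times> ?D. x \<in> overlap_pairs q m n}. case x of (r, s) \<Rightarrow> \<bar>a r * a s\<bar>)"
      by (subst sum.inter_filter) (auto simp: w_def intro!: sum.cong)
    also have "{x \<in> ?D \<times> ?D. x \<in> overlap_pairs q m n} = overlap_pairs q m n"
      by (auto simp: overlap_pairs_def)
    finally show ?thesis .
  qed
  have pt: "\<bar>a r * a s * z r s\<bar> \<le> e1 * w 1 (r, s) + e2 * w 2 (r, s)" if rs: "r \<in> ?D" "s \<in> ?D" for r s
  proof -
    consider "card (r ` {1..m} \<inter> s ` {1..m}) = 0" | "card (r ` {1..m} \<inter> s ` {1..m}) = 1"
      | "card (r ` {1..m} \<inter> s ` {1..m}) \<ge> 2" by linarith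
    then show ?thesis
    proof cases
      case 1
      then have "z r s = 0" by (intro disj rs) simp
      then show ?thesis using nonneg by (simp add: w_def)
    next
      case 2
      then obtain p q where "p \<in> {1..m}" "q \<in> {1..m}" "meet_only_at m r s p q"
        using overlap_one_cases[OF rs] by blast
      then have "\<bar>z r s\<bar> \<le> e1" by (intro one rs)
      then have "\<bar>a r * a s\<bar> * \<bar>z r s\<bar> \<le> \<bar>a r * a s\<bar> * e1" by (intro mult_left_mono) auto
      moreover have "w 1 (r, s) = \<bar>a r * a s\<bar>" "w 2 (r, s) = 0" using 2 rs by (auto simp: w_def overlap_pairs_def)
      ultimately show ?thesis by (simp add: abs_mult mult.commute)
    next
      case 3
      have "\<bar>a r * a s\<bar> * \<bar>z r s\<bar> \<le> \<bar>a r * a s\<bar> * e2" by (intro mult_left_mono two rs) auto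
      moreover have "w 2 (r, s) = \<bar>a r * a s\<bar>" using 3 rs by (auto simp: w_def overlap_pairs_def)
      moreover have "0 \<le> e1 * w 1 (r, s)" using nonneg by (auto simp: w_def)
      ultimately show ?thesis by (simp add: abs_mult mult.commute)
    qed
  qed
  have "\<bar>\<Sum>r\<in>?D. \<Sum>s\<in>?D. a r * a s * z r s\<bar> \<le> (\<Sum>r\<in>?D. \<Sum>s\<in>?D. \<bar>a r * a s * z r s\<bar>)"
    by (intro order_trans[OF sum_abs] sum_mono sum_abs)
  also have "\<dots> \<le> (\<Sum>r\<in>?D. \<Sum>s\<in>?D. e1 * w 1 (r, s) + e2 * w 2 (r, s))"
    by (intro sum_mono pt)
  also have "\<dots> = e1 * (\<Sum>x\<in>?D \<times> ?D. w 1 x) + e2 * (\<Sum>x\<in>?D \<times> ?D. w 2 x)"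
    by (simp add: sum.cartesian_product sum.distrib sum_distrib_left case_prod_beta)
  finally have "(tuple_weight m n)\<^sup>2 * \<bar>\<Sum>r\<in>?D. \<Sum>s\<in>?D. a r * a s * z r s\<bar>
      \<le> (tuple_weight m n)\<^sup>2 * (e1 * (\<Sum>x\<in>?D \<times> ?D. w 1 x) + e2 * (\<Sum>x\<in>?D \<times> ?D. w 2 x))"
    by (intro mult_left_mono) auto
  then show ?thesis unfolding w by (simp add: abs_mult overlap_mass_def algebra_simps)
qed

text \<open>
  The inner sum runs over all coincidences between the entries of two tuples; here there is a
  single one.
\<close>

lemma sum_matches_meet_only_at:
  assumes "r \<in> distinct_tuples S m" "s \<in> distinct_tuples S m" "p \<in> {1..m}" "q \<in> {1..m}"
    and meet: "meet_only_at m r s p q"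
  shows "(\<Sum>k\<in>{1..m}. \<Sum>l\<in>{1..m}. if r k = s l then g k l else 0) = (g p q :: real)"
proof -
  have "r k = s l \<longleftrightarrow> k = p \<and> l = q" if "k \<in> {1..m}" "l \<in> {1..m}" for k l
  proof
    assume "r k = s l"
    then have "r k \<in> r ` {1..m} \<inter> s ` {1..m}" using that by (metis IntI image_eqI)
    then have "r k \<in> {r p}" using meet unfolding meet_only_at_def by blast
    then have "r k = r p" "s l = s q" using meet \<open>r k = s l\<close> by (simp_all add: meet_only_at_def)
    then show "k = p \<and> l = q"
      using that assms(3,4) distinct_tuplesD(2)[OF assms(1)] distinct_tuplesD(2)[OF assms(2)]
      by (auto dest: inj_onD)
  qed (use meet in \<open>simp add: meet_only_at_def\<close>)
  then have "(\<Sum>k\<in>{1..m}. \<Sum>l\<in>{1..m}. if r k = s l then g k l else 0) =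
      (\<Sum>k\<in>{1..m}. \<Sum>l\<in>{1..m}. if k = p then if l = q then g k l else 0 else 0)"
    by (intro sum.cong refl) auto
  also have "\<dots> = (\<Sum>k\<in>{1..m}. if k = p then g k q else 0)"
    using assms(4) by (intro sum.cong refl) auto
  also have "\<dots> = g p q" using assms(3) by simp
  finally show ?thesis .
qed

lemma sum_matches_disjoint:
  assumes "r ` {1..m} \<inter> s ` {1..m} = {}"
  shows "(\<Sum>k\<in>{1..m}. \<Sum>l\<in>{1..m}. if r k = s l then g k l else 0) = (0 :: real)"
proof (intro sum.neutral ballI)
  fix k l assume "k \<in> {1..m}" "l \<in> {1..m}"
  then have "r k \<noteq> s l" using assms by (metis IntI empty_iff image_eqI)
  then show "(if r k = s l then g k l else 0) = 0" by simp
qed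

lemma abs_sum_matches_le:
  assumes "\<And>k l. k \<in> {1..m} \<Longrightarrow> l \<in> {1..m} \<Longrightarrow> r k = s l \<Longrightarrow> \<bar>g k l\<bar> \<le> (B::real)" "0 \<le> B"
  shows "\<bar>\<Sum>k\<in>{1..m}. \<Sum>l\<in>{1..m}. if r k = s l then g k l else 0\<bar> \<le> (real m)\<^sup>2 * B"
proof -
  have "\<bar>\<Sum>k\<in>{1..m}. \<Sum>l\<in>{1..m}. if r k = s l then g k l else 0\<bar>
     \<le> (\<Sum>k\<in>{1..m}. \<Sum>l\<in>{1..m}. \<bar>if r k = s l then g k l else 0\<bar>)"
    by (intro order_trans[OF sum_abs] sum_mono sum_abs)
  also have "\<dots> \<le> (\<Sum>k\<in>{1..m}. \<Sum>l\<in>{1..m}. B)"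
    by (intro sum_mono) (use assms in auto)
  finally show ?thesis by (simp add: power2_eq_square mult.assoc)
qed

definition incidences :: "nat \<Rightarrow> nat \<Rightarrow> nat \<Rightarrow> ((nat \<Rightarrow> nat) \<times> nat) set" where
  "incidences m n i = (SIGMA r:distinct_tuples {1..n} m. {p. p \<in> {1..m} \<and> r p = i})"

lemma finite_incidences [simp]: "finite (incidences m n i)"
  by (auto simp: incidences_def)

text \<open>
  A sum over \<open>i\<close> of expressions bilinear in the tuples containing \<open>i\<close> becomes a sum over pairs of
  tuples and their coincidences, the form to which \<open>overlap_sum_bound\<close> applies.
\<close>

lemma sum_incidences:
  "(\<Sum>i=1..n. \<Sum>x\<in>incidences m n i. \<Sum>y\<in>incidences m n i. g i x y) =
   (\<Sum>r\<in>distinct_tuples {1..n} m. \<Sum>s\<in>distinct_tuples {1..n} m. \<Sum>p\<in>{1..m}. \<Sum>q\<in>{1..m}.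
      if r p = s q then g (r p) (r, p) (s, q) else (0 :: real))"
proof -
  let ?D = "distinct_tuples {1..n} m"
  let ?K = "?D \<times> {1..m}"
  define v where "v = (\<lambda>(r :: nat \<Rightarrow> nat, p :: nat). r p)"
  have inc: "incidences m n i = {x \<in> ?K. v x = i}" for i
    by (auto simp: incidences_def v_def)
  have fin: "finite ?K" by simp
  have v: "v x \<in> {1..n}" if "x \<in> ?K" for x
    using that distinct_tuplesD(4)[of "fst x" "{1..n}" m "snd x"] by (simp add: v_def case_prod_beta mem_Times_iff)
  have "(\<Sum>i=1..n. \<Sum>x\<in>incidences m n i. \<Sum>y\<in>incidences m n i. g i x y) =
      (\<Sum>i=1..n. \<Sum>x\<in>?K. \<Sum>y\<in>?K. if v x = i \<and> v y = i then g i x y else 0)"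
  proof (rule sum.cong[OF refl])
    fix i
    show "(\<Sum>x\<in>incidences m n i. \<Sum>y\<in>incidences m n i. g i x y) =
      (\<Sum>x\<in>?K. \<Sum>y\<in>?K. if v x = i \<and> v y = i then g i x y else 0)"
      unfolding inc sum.inter_filter[OF fin] by (intro sum.cong refl) simp
  qed
  also have "\<dots> = (\<Sum>x\<in>?K. \<Sum>y\<in>?K. \<Sum>i=1..n. if v x = i \<and> v y = i then g i x y else 0)"
    by (subst sum.swap, rule sum.cong[OF refl], rule sum.swap)
  also have "\<dots> = (\<Sum>x\<in>?K. \<Sum>y\<in>?K. if v x = v y then g (v x) x y else 0)"
  proof (intro sum.cong refl)
    fix x y assume "x \<in> ?K"
    have "(\<Sum>i=1..n. if v x = i \<and> v y = i then g i x y else 0) =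
      (\<Sum>i=1..n. if v x = i then (if v x = v y then g i x y else 0) else 0)"
      by (intro sum.cong refl) auto
    also have "\<dots> = (if v x = v y then g (v x) x y else 0)"
      using v[OF \<open>x \<in> ?K\<close>] by (subst sum.delta') auto
    finally show "(\<Sum>i=1..n. if v x = i \<and> v y = i then g i x y else 0) = (if v x = v y then g (v x) x y else 0)" .
  qed
  also have "\<dots> = (\<Sum>r\<in>?D. \<Sum>p\<in>{1..m}. \<Sum>s\<in>?D. \<Sum>q\<in>{1..m}. if r p = s q then g (r p) (r, p) (s, q) else 0)"
    by (simp add: sum.cartesian_product' v_def cong: if_cong)
  also have "\<dots> = (\<Sum>r\<in>?D. \<Sum>s\<in>?D. \<Sum>p\<in>{1..m}. \<Sum>q\<in>{1..m}. if r p = s q then g (r p) (r, p) (s, q) else 0)"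
    by (intro sum.cong refl sum.swap)
  finally show ?thesis .
qed

section \<open>Square integrable functions and covariances\<close>

definition square_integrable :: "'a measure \<Rightarrow> ('a \<Rightarrow> real) \<Rightarrow> bool" where
  "square_integrable P f \<longleftrightarrow> f \<in> borel_measurable P \<and> integrable P (\<lambda>x. (f x)\<^sup>2)"

definition covar :: "'a measure \<Rightarrow> ('a \<Rightarrow> real) \<Rightarrow> ('a \<Rightarrow> real) \<Rightarrow> real" where
  "covar P f g = (\<integral>x. (f x - (\<integral>y. f y \<partial>P)) * (g x - (\<integral>y. g y \<partial>P)) \<partial>P)"

lemma abs_mult_le_sum_squares: "\<bar>x * y\<bar> \<le> (x\<^sup>2 + y\<^sup>2) / (2::real)"
  using sum_squares_bound[of "\<bar>x\<bar>" "\<bar>y\<bar>"] by (simp add: abs_mult)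

lemma square_integrable_mult:
  assumes "square_integrable P f" "square_integrable P g"
  shows "integrable P (\<lambda>x. f x * g x)"
proof (rule Bochner_Integration.integrable_bound)
  show "integrable P (\<lambda>x. ((f x)\<^sup>2 + (g x)\<^sup>2) / 2)" using assms by (auto simp: square_integrable_def)
  show "(\<lambda>x. f x * g x) \<in> borel_measurable P" using assms by (auto simp: square_integrable_def)
  show "AE x in P. norm (f x * g x) \<le> norm (((f x)\<^sup>2 + (g x)\<^sup>2) / 2)"
    using abs_mult_le_sum_squares by (intro AE_I2) auto
qed

lemma square_integrable_add:
  assumes "square_integrable P f" "square_integrable P g"
  shows "square_integrable P (\<lambda>x. f x + g x)"
  using assms square_integrable_mult[OF assms]
  by (auto simp: square_integrable_def power2_sum mult.assoc)

lemma square_integrable_cmult: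
  assumes "square_integrable P f"
  shows "square_integrable P (\<lambda>x. c * f x)"
  using assms by (auto simp: square_integrable_def power_mult_distrib)

lemma square_integrable_diff:
  assumes "square_integrable P f" "square_integrable P g"
  shows "square_integrable P (\<lambda>x. f x - g x)"
  using square_integrable_add[OF assms(1) square_integrable_cmult[OF assms(2), of "-1"]] by simp

lemma square_integrable_sum:
  assumes "finite K" "\<And>k. k \<in> K \<Longrightarrow> square_integrable P (u k)"
  shows "square_integrable P (\<lambda>x. \<Sum>k\<in>K. u k x)"
  using assms
proof (induction K rule: finite_induct)
  case empty show ?case by (simp add: square_integrable_def)
next
  case (insert k K) then show ?case by (simp add: square_integrable_add)
qed

lemma abs_integral_mult_le:
  assumes "square_integrable P f" "square_integrable P g"
  shows "\<bar>\<integral>x. f x * g x \<partial>P\<bar> \<le> ((\<integral>x. (f x)\<^sup>2 \<partial>P) + (\<integral>x. (g x)\<^sup>2 \<partial>P)) / 2"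
proof -
  have "\<bar>\<integral>x. f x * g x \<partial>P\<bar> \<le> (\<integral>x. \<bar>f x * g x\<bar> \<partial>P)" by (rule integral_abs_bound)
  also have "\<dots> \<le> (\<integral>x. ((f x)\<^sup>2 + (g x)\<^sup>2) / 2 \<partial>P)"
    using assms square_integrable_mult[OF assms] abs_mult_le_sum_squares
    by (intro integral_mono) (auto simp: square_integrable_def)
  also have "\<dots> = ((\<integral>x. (f x)\<^sup>2 \<partial>P) + (\<integral>x. (g x)\<^sup>2 \<partial>P)) / 2"
    using assms by (simp add: square_integrable_def)
  finally show ?thesis .
qed

lemma integral_diff_sq_le:
  assumes "square_integrable P f" "square_integrable P g"
  shows "(\<integral>x. (f x - g x)\<^sup>2 \<partial>P) \<le> 2 * (\<integral>x. (f x)\<^sup>2 \<partial>P) + 2 * (\<integral>x. (g x)\<^sup>2 \<partial>P)"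
proof -
  have "(u - v)\<^sup>2 \<le> 2 * u\<^sup>2 + 2 * v\<^sup>2" for u v :: real
    using zero_le_power2[of "u + v"] by (simp add: power2_eq_square algebra_simps)
  then have "(\<integral>x. (f x - g x)\<^sup>2 \<partial>P) \<le> (\<integral>x. 2 * (f x)\<^sup>2 + 2 * (g x)\<^sup>2 \<partial>P)"
    using assms square_integrable_diff[OF assms]
    by (intro integral_mono) (auto simp: square_integrable_def)
  also have "\<dots> = 2 * (\<integral>x. (f x)\<^sup>2 \<partial>P) + 2 * (\<integral>x. (g x)\<^sup>2 \<partial>P)"
    using assms by (simp add: square_integrable_def)
  finally show ?thesis .
qed

lemma integral_sum_power2:
  assumes "finite K" "\<And>k. k \<in> K \<Longrightarrow> square_integrable P (u k)"
  shows "(\<integral>x. (\<Sum>k\<in>K. c k * u k x)\<^sup>2 \<partial>P) = (\<Sum>k\<in>K. \<Sum>l\<in>K. c k * c l * (\<integral>x. u k x * u l x \<partial>P))"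
proof -
  have "(\<integral>x. (\<Sum>k\<in>K. c k * u k x)\<^sup>2 \<partial>P) = (\<integral>x. (\<Sum>k\<in>K. \<Sum>l\<in>K. c k * c l * (u k x * u l x)) \<partial>P)"
    by (simp add: power2_eq_square sum_product mult_ac)
  also have "\<dots> = (\<Sum>k\<in>K. \<Sum>l\<in>K. (\<integral>x. c k * c l * (u k x * u l x) \<partial>P))"
  proof -
    have "integrable P (\<lambda>x. c k * c l * (u k x * u l x))" if "k \<in> K" "l \<in> K" for k l
      by (intro integrable_mult_right square_integrable_mult assms that)
    then show ?thesis by (simp add: integral_sum)
  qed
  finally show ?thesis by simp
qed

context prob_space begin

lemma square_integrable_const [simp]: "square_integrable M (\<lambda>_. c)"
  by (simp add: square_integrable_def)

lemma square_integrable_integrable: "square_integrable M f \<Longrightarrow> integrable M f"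
  using square_integrable_mult[OF _ square_integrable_const[of 1], of f] by simp

lemma square_integrable_centered: "square_integrable M f \<Longrightarrow> square_integrable M (\<lambda>x. f x - c)"
  by (intro square_integrable_diff square_integrable_const)

lemma covar_eq:
  assumes "square_integrable M f" "square_integrable M g"
  shows "covar M f g = (\<integral>x. f x * g x \<partial>M) - (\<integral>x. f x \<partial>M) * (\<integral>x. g x \<partial>M)"
  using square_integrable_mult[OF assms] square_integrable_integrable[OF assms(1)]
    square_integrable_integrable[OF assms(2)]
  by (simp add: covar_def algebra_simps prob_space)

lemma covar_diff_const:
  assumes "square_integrable M f" "square_integrable M g"
  shows "covar M (\<lambda>x. f x - c) (\<lambda>x. g x - d) = covar M f g"
proof -
  have "expectation (\<lambda>x. f x - c) = expectation f - c" "expectation (\<lambda>x. g x - d) = expectation g - d"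
    using assms[THEN square_integrable_integrable] by (simp_all add: prob_space)
  then show ?thesis by (simp add: covar_def)
qed

lemma variance_le_second_moment:
  assumes "square_integrable M f"
  shows "(\<integral>x. (f x - (\<integral>y. f y \<partial>M))\<^sup>2 \<partial>M) \<le> (\<integral>x. (f x)\<^sup>2 \<partial>M)"
  using covar_eq[OF assms assms] by (simp add: covar_def power2_eq_square)

lemma abs_covar_le:
  assumes "square_integrable M f" "square_integrable M g"
    and "(\<integral>x. (f x)\<^sup>2 \<partial>M) \<le> B" "(\<integral>x. (g x)\<^sup>2 \<partial>M) \<le> B"
  shows "\<bar>covar M f g\<bar> \<le> B"
  using abs_integral_mult_le[OF square_integrable_centered[OF assms(1), of "\<integral>y. f y \<partial>M"]
      square_integrable_centered[OF assms(2), of "\<integral>y. g y \<partial>M"]]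
    variance_le_second_moment[OF assms(1)] variance_le_second_moment[OF assms(2)] assms(3,4)
  unfolding covar_def by argo

lemma variance_linear_combination:
  assumes "finite K" "\<And>k. k \<in> K \<Longrightarrow> square_integrable M (u k)"
  shows "variance (\<lambda>x. \<Sum>k\<in>K. c k * u k x) = (\<Sum>k\<in>K. \<Sum>l\<in>K. c k * c l * covar M (u k) (u l))"
proof -
  have int: "integrable M (u k)" if "k \<in> K" for k
    using assms(2)[OF that] by (rule square_integrable_integrable)
  have "expectation (\<lambda>x. \<Sum>k\<in>K. c k * u k x) = (\<Sum>k\<in>K. c k * expectation (u k))"
    using int by simp
  then have "variance (\<lambda>x. \<Sum>k\<in>K. c k * u k x) =
      expectation (\<lambda>x. (\<Sum>k\<in>K. c k * (u k x - expectation (u k)))\<^sup>2)"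
    by (simp add: sum_subtractf algebra_simps)
  also have "\<dots> = expectation (\<lambda>x. \<Sum>k\<in>K. \<Sum>l\<in>K. c k * c l *
      ((u k x - expectation (u k)) * (u l x - expectation (u l))))"
    by (simp add: power2_eq_square sum_product mult_ac)
  also have "\<dots> = (\<Sum>k\<in>K. \<Sum>l\<in>K. c k * c l * covar M (u k) (u l))"
  proof -
    have "integrable M (\<lambda>x. c k * c l * ((u k x - expectation (u k)) * (u l x - expectation (u l))))"
      if "k \<in> K" "l \<in> K" for k l
      by (intro integrable_mult_right square_integrable_mult square_integrable_centered assms that)
    then show ?thesis unfolding covar_def by (simp add: integral_sum)
  qed
  finally show ?thesis .
qed

text \<open>
  The variance of \<open>f\<^sup>2\<close> is not negative.
\<close>

lemma second_moment_le_sqrt_fourth: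
  assumes f: "f \<in> borel_measurable M" and K: "(\<integral>\<^sup>+x. ennreal (f x ^ 4) \<partial>M) \<le> ennreal K" "0 \<le> K"
  shows "(\<integral>\<^sup>+x. ennreal ((f x)\<^sup>2) \<partial>M) \<le> ennreal (sqrt K)"
proof -
  have "(\<integral>\<^sup>+x. ennreal (f x ^ 4) \<partial>M) < \<infinity>" using K by (simp add: order_le_less_trans)
  then have i4: "integrable M (\<lambda>x. f x ^ 4)" using f by (intro integrableI_nonneg) auto
  have sq: "square_integrable M (\<lambda>x. (f x)\<^sup>2)"
    using i4 f by (simp add: square_integrable_def)
  have "(\<integral>x. f x ^ 4 \<partial>M) \<le> K" using K i4 by (simp add: nn_integral_eq_integral)
  moreover have "0 \<le> covar M (\<lambda>x. (f x)\<^sup>2) (\<lambda>x. (f x)\<^sup>2)" by (simp add: covar_def)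
  ultimately have "(\<integral>x. (f x)\<^sup>2 \<partial>M)\<^sup>2 \<le> K"
    using covar_eq[OF sq sq] by (simp add: power2_eq_square power4_eq_xxxx mult.assoc)
  then have "(\<integral>x. (f x)\<^sup>2 \<partial>M) \<le> sqrt K" by (rule real_le_rsqrt)
  then show ?thesis
    using square_integrable_integrable[OF sq] by (simp add: nn_integral_eq_integral ennreal_leI)
qed

text \<open>
  The tower property: \<open>M2\<close> averages a conditional expectation, so it compares plain expectations of
  products of kernels.
\<close>

lemma cond_prod_mean_eq:
  assumes "X j \<in> measurable M N"
    and "integrable M (\<lambda>\<omega>. h (at_indices m (\<lambda>i. X i \<omega>) r) * h (at_indices m (\<lambda>i. X i \<omega>) s))"
  shows "cond_prod_mean M N X m h r s j =
    (\<integral>\<omega>. h (at_indices m (\<lambda>i. X i \<omega>) r) * h (at_indices m (\<lambda>i. X i \<omega>) s) \<partial>M)"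
proof -
  have "subalgebra M (vimage_algebra (space M) (X j) N)"
    using assms(1) by (auto simp: subalgebra_def sets_vimage_algebra2 measurable_space)
  then interpret finite_measure_subalgebra M "vimage_algebra (space M) (X j) N"
    by unfold_locales
  show ?thesis unfolding cond_prod_mean_def by (rule real_cond_exp_int(2)[OF assms(2)])
qed

end

section \<open>Projections of the kernel on one observation\<close>

text \<open>
  The projection of the kernel with its arguments other than the \<open>p\<close>-th integrated over the laws
  that \<open>r\<close> prescribes. It is indexed by a full tuple and a position in it, rather than by the
  \<open>(m - 1)\<close>-tuple of the remaining entries, so that all sums can run over full tuples.
\<close>

definition coord_proj ::
  "'w measure \<Rightarrow> 'x measure \<Rightarrow> (nat \<Rightarrow> 'w \<Rightarrow> 'x) \<Rightarrow> nat \<Rightarrow> ((nat \<Rightarrow> 'x) \<Rightarrow> real)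
     \<Rightarrow> (nat \<Rightarrow> nat) \<Rightarrow> nat \<Rightarrow> 'x \<Rightarrow> real" where
  "coord_proj P N X m h r p = f_proj P N X m h p (drop_at m p r)"

lemma h1_eq_sum_tuples:
  assumes "i \<in> {1..n}"
  shows "h1 P N X m n a h i x / real n = tuple_weight m n *
    (\<Sum>r\<in>distinct_tuples {1..n} m. \<Sum>p | p \<in> {1..m} \<and> r p = i.
      a r * (coord_proj P N X m h r p x - \<theta> P X m h r))"
proof -
  have "fact (n - m) / fact (n - 1) / real n = tuple_weight m n"
    using assms by (cases n) (auto simp: tuple_weight_def)
  then show ?thesis unfolding h1_def coord_proj_def
    by (subst sum_distinct_insert_at[symmetric])
      (use assms in \<open>auto simp: field_simps\<close>)
qed

text \<open>
  One row of the array. The locale is interpreted both by the data and, conditionally on the data,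
  by the resampled indices, the kernel then being a function of indices.
\<close>

locale independent_sample = prob_space P for P :: "'w measure" +
  fixes N :: "'x measure" and X :: "nat \<Rightarrow> 'w \<Rightarrow> 'x" and m n :: nat and h :: "(nat \<Rightarrow> 'x) \<Rightarrow> real"
  assumes indep: "indep_vars (\<lambda>_. N) X {1..n}"
    and h_meas [measurable]: "h \<in> borel_measurable (\<Pi>\<^sub>M k\<in>{1..m}. N)"
    and m_pos: "1 \<le> m" and m_le: "m \<le> n"
begin

abbreviation "dtuples \<equiv> distinct_tuples {1..n} m"

abbreviation "tuples \<equiv> {1..m} \<rightarrow>\<^sub>E {1..n}"

abbreviation "law j \<equiv> distr P N (X j)"

abbreviation "obs r \<omega> \<equiv> h (at_indices m (\<lambda>j. X j \<omega>) r)"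

abbreviation "proj \<equiv> coord_proj P N X m h"

abbreviation "obs_mean r s \<equiv> \<integral>\<omega>. obs r \<omega> * obs s \<omega> \<partial>P"

lemma X_measurable: "j \<in> {1..n} \<Longrightarrow> X j \<in> measurable P N"
  using indep by (auto simp: indep_vars_def)

lemma prob_space_law: "j \<in> {1..n} \<Longrightarrow> prob_space (law j)"
  by (intro prob_space_distr X_measurable)

lemma at_indices_measurable:
  assumes "\<And>k. k \<in> {1..m} \<Longrightarrow> r k \<in> {1..n}"
  shows "(\<lambda>\<omega>. at_indices m (\<lambda>j. X j \<omega>) r) \<in> measurable P (\<Pi>\<^sub>M k\<in>{1..m}. N)"
  unfolding at_indices_def by (intro measurable_restrict X_measurable assms)

lemma obs_measurable:
  assumes "\<And>k. k \<in> {1..m} \<Longrightarrow> r k \<in> {1..n}"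
  shows "obs r \<in> borel_measurable P"
  by (rule measurable_compose[OF at_indices_measurable h_meas]) (rule assms)

text \<open>
  The law of the whole sample is a product measure, and selecting coordinates with distinct
  indices reindexes it.
\<close>

lemma joint_law:
  assumes "inj_on f K" "f ` K \<subseteq> {1..n}"
  shows "distr P (\<Pi>\<^sub>M k\<in>K. N) (\<lambda>\<omega>. \<lambda>k\<in>K. X (f k) \<omega>) = (\<Pi>\<^sub>M k\<in>K. law (f k))"
proof -
  have ne: "{1..n} \<noteq> {}" using m_pos m_le by auto
  have sets: "sets (\<Pi>\<^sub>M k\<in>K. law (f k)) = sets (\<Pi>\<^sub>M k\<in>K. N)" for K f
    by (intro sets_PiM_cong) auto
  have "(\<Pi>\<^sub>M k\<in>K. law (f k)) = distr (\<Pi>\<^sub>M i\<in>{1..n}. law i) (\<Pi>\<^sub>M k\<in>K. law (f k)) (\<lambda>\<omega>. \<lambda>k\<in>K. \<omega> (f k))"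
    by (rule distr_PiM_reindex[symmetric]) (use assms prob_space_law in auto)
  also have "(\<Pi>\<^sub>M i\<in>{1..n}. law i) = distr P (\<Pi>\<^sub>M i\<in>{1..n}. N) (\<lambda>\<omega>. \<lambda>i\<in>{1..n}. X i \<omega>)"
    using indep_vars_iff_distr_eq_PiM'[OF ne, of X "\<lambda>_. N"] X_measurable indep by auto
  also have "distr (distr P (\<Pi>\<^sub>M i\<in>{1..n}. N) (\<lambda>\<omega>. \<lambda>i\<in>{1..n}. X i \<omega>)) (\<Pi>\<^sub>M k\<in>K. law (f k)) (\<lambda>\<omega>. \<lambda>k\<in>K. \<omega> (f k))
     = distr (distr P (\<Pi>\<^sub>M i\<in>{1..n}. N) (\<lambda>\<omega>. \<lambda>i\<in>{1..n}. X i \<omega>)) (\<Pi>\<^sub>M k\<in>K. N) (\<lambda>\<omega>. \<lambda>k\<in>K. \<omega> (f k))"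
    by (intro distr_cong sets refl)
  also have "\<dots> = distr P (\<Pi>\<^sub>M k\<in>K. N) ((\<lambda>\<omega>. \<lambda>k\<in>K. \<omega> (f k)) \<circ> (\<lambda>\<omega>. \<lambda>i\<in>{1..n}. X i \<omega>))"
    by (rule distr_distr) (use assms X_measurable in \<open>auto intro!: measurable_restrict measurable_component_singleton\<close>)
  also have "(\<lambda>\<omega>. \<lambda>k\<in>K. \<omega> (f k)) \<circ> (\<lambda>\<omega>. \<lambda>i\<in>{1..n}. X i \<omega>) = (\<lambda>\<omega>. \<lambda>k\<in>K. X (f k) \<omega>)"
    using assms by (auto simp: fun_eq_iff)
  finally show ?thesis by (rule sym)
qed

lemma insert_at_measurable:
  assumes "p \<in> {1..m}"
  shows "(\<lambda>(y, z). insert_at m p y z) \<in> measurable (N \<Otimes>\<^sub>M (\<Pi>\<^sub>M k\<in>{1..m - 1}. N)) (\<Pi>\<^sub>M k\<in>{1..m}. N)"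
  unfolding insert_at_def case_prod_beta
proof (rule measurable_restrict)
  fix k assume k: "k \<in> {1..m}"
  consider "k < p" | "k = p" | "k > p" by linarith
  then show "(\<lambda>x. if k < p then snd x k else if k = p then fst x else snd x (k - 1))
      \<in> measurable (N \<Otimes>\<^sub>M (\<Pi>\<^sub>M k\<in>{1..m - 1}. N)) N"
  proof cases
    case 1
    then have "k \<in> {1..m - 1}" using k assms by auto
    then have "(\<lambda>x. snd x k) \<in> measurable (N \<Otimes>\<^sub>M (\<Pi>\<^sub>M k\<in>{1..m - 1}. N)) N"
      by (intro measurable_compose[OF measurable_snd] measurable_component_singleton)
    then show ?thesis using 1 by simp
  next
    case 3
    then have "k - 1 \<in> {1..m - 1}" using k assms by auto
    then have "(\<lambda>x. snd x (k - 1)) \<in> measurable (N \<Otimes>\<^sub>M (\<Pi>\<^sub>M k\<in>{1..m - 1}. N)) N"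
      by (intro measurable_compose[OF measurable_snd] measurable_component_singleton)
    then show ?thesis using 3 by simp
  qed simp
qed

text \<open>
  Under a product law, an independent value may be supplied for one coordinate after the
  others. If \<open>j\<close> occurs among the indices \<open>i\<close>, which happens in \<open>h1 i (X\<^sub>j)\<close> with \<open>i \<noteq> j\<close>, the
  result is the law of independent draws rather than that of a tuple of observations.
\<close>

lemma insert_at_law:
  assumes p: "p \<in> {1..m}" and j: "j \<in> {1..n}" and i: "\<And>k. k \<in> {1..m - 1} \<Longrightarrow> i k \<in> {1..n}"
  shows "distr (law j \<Otimes>\<^sub>M (\<Pi>\<^sub>M k\<in>{1..m - 1}. law (i k))) (\<Pi>\<^sub>M k\<in>{1..m}. N) (\<lambda>(y, z). insert_at m p y z)
    = (\<Pi>\<^sub>M k\<in>{1..m}. law (insert_at m p j i k))"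
proof -
  define r where "r = (\<lambda>k. if k \<in> {1..m} then insert_at m p j i k else j)"
  define i' where "i' = (\<lambda>k. if k \<in> {1..m - 1} then i k else j)"
  have "insert_at m p j i k \<in> {1..n}" if k: "k \<in> {1..m}" for k
  proof -
    consider "k < p" "k \<in> {1..m - 1}" | "k = p" | "k > p" "k - 1 \<in> {1..m - 1}"
      using k p by force
    then show ?thesis using i[of k] i[of "k - 1"] j k by cases (simp_all add: insert_at_def)
  qed
  then have r: "r k \<in> {1..n}" for k using j by (simp add: r_def)
  have i': "i' k \<in> {1..n}" for k using i j by (auto simp: i'_def)
  let ?\<mu> = "law j \<Otimes>\<^sub>M Pi\<^sub>M {1..m - 1} (\<lambda>k. law (i' k))"
  let ?T = "distr ?\<mu> (Pi\<^sub>M {1..m} (\<lambda>k. N)) (\<lambda>(y, z). insert_at m p y z)"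
  interpret r: product_prob_space "\<lambda>k. law (r k)" "{1..m}"
    by (intro product_prob_spaceI prob_space_law r)
  interpret i: product_prob_space "\<lambda>k. law (i' k)" "{1..m - 1}"
    by (intro product_prob_spaceI prob_space_law i')
  interpret i: prob_space "\<Pi>\<^sub>M k\<in>{1..m - 1}. law (i' k)" by (rule i.prob_space_axioms)
  have eq1: "(\<Pi>\<^sub>M k\<in>{1..m}. law (insert_at m p j i k)) = (\<Pi>\<^sub>M k\<in>{1..m}. law (r k))"
    by (intro PiM_cong) (auto simp: r_def)
  have eq2: "(\<Pi>\<^sub>M k\<in>{1..m - 1}. law (i k)) = (\<Pi>\<^sub>M k\<in>{1..m - 1}. law (i' k))"
    by (intro PiM_cong) (auto simp: i'_def)
  show ?thesis unfolding eq1 eq2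
  proof (rule r.PiM_eqI)
    show "sets (?T) =
      sets (Pi\<^sub>M {1..m} (\<lambda>k. law (r k)))"
      by (simp, intro sets_PiM_cong) auto
    fix A assume A: "\<And>k. k \<in> {1..m} \<Longrightarrow> A k \<in> sets (law (r k))"
    then have AN: "k \<in> {1..m} \<Longrightarrow> A k \<in> sets N" for k by simp
    have AS: "k \<in> {1..m} \<Longrightarrow> A k \<subseteq> space N" for k using AN by (rule sets.sets_into_space)
    define g where "g k = (if k < p then k else k + 1)" for k :: nat
    have g: "k \<in> {1..m - 1} \<Longrightarrow> g k \<in> {1..m}" for k using p by (auto simp: g_def)
    have meas: "(\<lambda>(y, z). insert_at m p y z) \<in> measurable ?\<mu> (Pi\<^sub>M {1..m} (\<lambda>k. N))"
      using insert_at_measurable[OF p]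
      by (subst measurable_cong_sets[OF _ refl]) (auto intro!: sets_pair_measure_cong sets_PiM_cong)
    have pre: "(\<lambda>(y, z). insert_at m p y z) -` Pi\<^sub>E {1..m} A \<inter> space ?\<mu>
       = A p \<times> Pi\<^sub>E {1..m - 1} (\<lambda>k. A (g k))" (is "?L = ?R")
    proof (intro equalityI subsetI)
      fix x assume "x \<in> ?L"
      moreover obtain y z where x: "x = (y, z)" by force
      ultimately have 1: "insert_at m p y z \<in> Pi\<^sub>E {1..m} A" and 2: "z \<in> extensional {1..m - 1}"
        by (auto simp: space_pair_measure space_PiM PiE_iff)
      have "z k \<in> A (g k)" if "k \<in> {1..m - 1}" for k
        using PiE_mem[OF 1 g[OF that]] g[OF that] that p by (auto simp: insert_at_def g_def split: if_splits)
      then show "x \<in> ?R"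
        using PiE_mem[OF 1 p] p 2 by (auto simp: x insert_at_def PiE_iff)
    next
      fix x assume "x \<in> ?R"
      then obtain y z where x: "x = (y, z)" and y: "y \<in> A p" and z: "z \<in> Pi\<^sub>E {1..m - 1} (\<lambda>k. A (g k))" by auto
      have "insert_at m p y z k \<in> A k" if k: "k \<in> {1..m}" for k
      proof -
        consider "k < p" | "k = p" | "k > p" by linarith
        then show ?thesis
        proof cases
          case 1
          then have "k \<in> {1..m - 1}" using k p by auto
          from PiE_mem[OF z this] 1 show ?thesis using k by (simp add: insert_at_def g_def)
        next
          case 2 then show ?thesis using y k by (simp add: insert_at_def)
        next
          case 3
          then have "k - 1 \<in> {1..m - 1}" using k p by auto
          moreover have "g (k - 1) = k" using 3 by (auto simp: g_def)
          ultimately show ?thesis using PiE_mem[OF z, of "k - 1"] 3 k by (simp add: insert_at_def)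
        qed
      qed
      moreover have "z \<in> Pi\<^sub>E {1..m - 1} (\<lambda>k. space N)"
      proof (intro PiE_I)
        fix k assume k: "k \<in> {1..m - 1}"
        show "z k \<in> space N" using PiE_mem[OF z k] AS[OF g[OF k]] by blast
      next
        fix k assume "k \<notin> {1..m - 1}"
        with z show "z k = undefined" by (rule PiE_arb)
      qed
      moreover have "y \<in> space N" using y AS[OF p] by auto
      ultimately show "x \<in> ?L"
        by (simp add: x space_pair_measure space_PiM PiE_iff) (simp add: insert_at_def)
    qed
    have gr: "r (g k) = i' k" if "k \<in> {1..m - 1}" for k
      using that g[OF that] p by (auto simp: r_def g_def insert_at_def i'_def)
    have "emeasure (?T) (Pi\<^sub>E {1..m} A)
      = emeasure ?\<mu> (A p \<times> Pi\<^sub>E {1..m - 1} (\<lambda>k. A (g k)))"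
    proof -
      have "Pi\<^sub>E {1..m} A \<in> sets (Pi\<^sub>M {1..m} (\<lambda>k. N))"
        by (rule sets_PiM_I_finite) (use AN in auto)
      from emeasure_distr[OF meas this] show ?thesis unfolding pre .
    qed
    also have "\<dots> = emeasure (law j) (A p) * emeasure (Pi\<^sub>M {1..m - 1} (\<lambda>k. law (i' k))) (Pi\<^sub>E {1..m - 1} (\<lambda>k. A (g k)))"
      by (rule i.emeasure_pair_measure_Times) (use AN p g in \<open>auto intro!: sets_PiM_I_finite\<close>)
    also have "emeasure (Pi\<^sub>M {1..m - 1} (\<lambda>k. law (i' k))) (Pi\<^sub>E {1..m - 1} (\<lambda>k. A (g k))) =
        (\<Prod>k\<in>{1..m - 1}. emeasure (law (i' k)) (A (g k)))"
      by (rule i.emeasure_PiM) (use AN g in auto)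
    also have "\<dots> = (\<Prod>k\<in>{1..m} - {p}. emeasure (law (r k)) (A k))"
    proof (rule prod.reindex_bij_witness[of _ "\<lambda>k. if k < p then k else k - 1" g])
      fix k assume k: "k \<in> {1..m - 1}"
      show "emeasure (law (r (g k))) (A (g k)) = emeasure (law (i' k)) (A (g k))" using gr[OF k] by simp
    qed (use p in \<open>auto simp: g_def\<close>)
    also have "emeasure (law j) (A p) = emeasure (law (r p)) (A p)" using p by (simp add: r_def insert_at_def)
    also have "emeasure (law (r p)) (A p) * (\<Prod>k\<in>{1..m} - {p}. emeasure (law (r k)) (A k)) =
       (\<Prod>k\<in>{1..m}. emeasure (law (r k)) (A k))"
      using p by (intro prod.remove[symmetric]) auto
    finally show "emeasure (?T) (Pi\<^sub>E {1..m} A)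
      = (\<Prod>k\<in>{1..m}. emeasure (law (r k)) (A k))" .
  qed simp
qed

lemma drop_at_mem:
  assumes "p \<in> {1..m}" "\<And>k. k \<in> {1..m} \<Longrightarrow> r k \<in> {1..n}" "k \<in> {1..m - 1}"
  shows "drop_at m p r k \<in> {1..n}"
proof -
  have "drop_at m p r k \<in> r ` ({1..m} - {p})" using assms drop_at_image[of p m r] by blast
  then show ?thesis using assms(2) by auto
qed

lemma tuple_law_prob_space:
  assumes "\<And>k. k \<in> K \<Longrightarrow> i k \<in> {1..n}"
  shows "prob_space (\<Pi>\<^sub>M k\<in>K. law (i k))"
  by (intro prob_space_PiM prob_space_law assms)

lemma sets_tuple_law [measurable_cong]: "sets (\<Pi>\<^sub>M k\<in>K. law (i k)) = sets (\<Pi>\<^sub>M k\<in>K. N)"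
  by (intro sets_PiM_cong) auto

lemma proj_eq: "proj r p y = (\<integral>z. h (insert_at m p y z) \<partial>(\<Pi>\<^sub>M k\<in>{1..m - 1}. law (drop_at m p r k)))"
  by (simp add: coord_proj_def f_proj_def)

lemma h_insert_at_measurable:
  assumes "p \<in> {1..m}"
  shows "(\<lambda>(y, z). h (insert_at m p y z)) \<in> borel_measurable (N \<Otimes>\<^sub>M (\<Pi>\<^sub>M k\<in>{1..m - 1}. N))"
  using measurable_compose[OF insert_at_measurable[OF assms] h_meas] by (simp add: case_prod_beta')

lemma proj_measurable:
  assumes "p \<in> {1..m}" "\<And>k. k \<in> {1..m} \<Longrightarrow> r k \<in> {1..n}"
  shows "proj r p \<in> borel_measurable N"
proof -
  interpret L: prob_space "\<Pi>\<^sub>M k\<in>{1..m - 1}. law (drop_at m p r k)"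
    by (rule tuple_law_prob_space) (rule drop_at_mem[OF assms])
  have "sets (N \<Otimes>\<^sub>M (\<Pi>\<^sub>M k\<in>{1..m - 1}. law (drop_at m p r k))) = sets (N \<Otimes>\<^sub>M (\<Pi>\<^sub>M k\<in>{1..m - 1}. N))"
    by (intro sets_pair_measure_cong sets_tuple_law refl)
  from measurable_cong_sets[OF this refl] have "(\<lambda>(y, z). h (insert_at m p y z)) \<in>
      borel_measurable (N \<Otimes>\<^sub>M (\<Pi>\<^sub>M k\<in>{1..m - 1}. law (drop_at m p r k)))"
    using h_insert_at_measurable[OF assms(1)] by blast
  then show ?thesis unfolding proj_eq by (rule L.borel_measurable_lebesgue_integral)
qed

text \<open>
  Jensen's inequality for the inner integral, followed by Fubini's theorem. For \<open>j\<close> occurring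
  elsewhere in \<open>r\<close> the right-hand side is a moment under independent draws from the same
  distribution, as in \<open>max_sq_indep\<close>.
\<close>

lemma nn_integral_proj_sq_le:
  assumes p: "p \<in> {1..m}" and r: "r \<in> tuples" and j: "j \<in> {1..n}"
  shows "(\<integral>\<^sup>+\<omega>. ennreal ((proj r p (X j \<omega>))\<^sup>2) \<partial>P)
    \<le> (\<integral>\<^sup>+x. ennreal ((h x)\<^sup>2) \<partial>(\<Pi>\<^sub>M k\<in>{1..m}. law ((r(p := j)) k)))"
proof -
  let ?i = "drop_at m p r"
  let ?L = "\<Pi>\<^sub>M k\<in>{1..m - 1}. law (?i k)"
  have rm: "k \<in> {1..m} \<Longrightarrow> r k \<in> {1..n}" for k using r by auto
  have im: "k \<in> {1..m - 1} \<Longrightarrow> ?i k \<in> {1..n}" for k by (rule drop_at_mem[OF p rm])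
  interpret L: prob_space ?L by (rule tuple_law_prob_space) (rule im)
  interpret lj: prob_space "law j" by (rule prob_space_law[OF j])
  have meas: "(\<lambda>(y, z). h (insert_at m p y z)) \<in> borel_measurable (law j \<Otimes>\<^sub>M ?L)"
    using h_insert_at_measurable[OF p]
    by (subst measurable_cong_sets[OF _ refl]) (auto intro!: sets_pair_measure_cong sets_tuple_law)
  have meas_y: "(\<lambda>z. h (insert_at m p y z)) \<in> borel_measurable ?L" if "y \<in> space (law j)" for y
    using measurable_compose[OF measurable_Pair1'[OF that, of ?L] meas] by simp
  have jensen: "ennreal ((proj r p y)\<^sup>2) \<le> (\<integral>\<^sup>+z. ennreal ((h (insert_at m p y z))\<^sup>2) \<partial>?L)"
    if y: "y \<in> space (law j)" for y
  proof (cases "(\<integral>\<^sup>+z. ennreal ((h (insert_at m p y z))\<^sup>2) \<partial>?L) < \<infinity>")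
    case True
    then have "integrable ?L (\<lambda>z. (h (insert_at m p y z))\<^sup>2)"
      using meas_y[OF y] by (intro integrableI_nonneg) auto
    then have sq: "square_integrable ?L (\<lambda>z. h (insert_at m p y z))"
      using meas_y[OF y] by (simp add: square_integrable_def)
    have "0 \<le> covar ?L (\<lambda>z. h (insert_at m p y z)) (\<lambda>z. h (insert_at m p y z))"
      by (simp add: covar_def)
    then have "(proj r p y)\<^sup>2 \<le> (\<integral>z. (h (insert_at m p y z))\<^sup>2 \<partial>?L)"
      using L.covar_eq[OF sq sq] by (simp add: proj_eq power2_eq_square)
    then show ?thesis using sq
      by (subst nn_integral_eq_integral) (auto simp: square_integrable_def intro: ennreal_leI)
  qed (simp add: not_less top.extremum_unique)
  have "(\<integral>\<^sup>+\<omega>. ennreal ((proj r p (X j \<omega>))\<^sup>2) \<partial>P) = (\<integral>\<^sup>+y. ennreal ((proj r p y)\<^sup>2) \<partial>law j)"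
    using proj_measurable[OF p rm] by (subst nn_integral_distr) (auto intro: X_measurable j)
  also have "\<dots> \<le> (\<integral>\<^sup>+y. (\<integral>\<^sup>+z. ennreal ((h (insert_at m p y z))\<^sup>2) \<partial>?L) \<partial>law j)"
    by (intro nn_integral_mono jensen)
  also have "\<dots> = (\<integral>\<^sup>+x. ennreal ((case x of (y, z) \<Rightarrow> h (insert_at m p y z))\<^sup>2) \<partial>(law j \<Otimes>\<^sub>M ?L))"
    using meas by (subst L.nn_integral_fst[symmetric]) auto
  also have "\<dots> = (\<integral>\<^sup>+x. ennreal ((h x)\<^sup>2) \<partial>distr (law j \<Otimes>\<^sub>M ?L) (\<Pi>\<^sub>M k\<in>{1..m}. N) (\<lambda>(y, z). insert_at m p y z))"
  proof (subst nn_integral_distr)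
    show "(\<lambda>(y, z). insert_at m p y z) \<in> measurable (law j \<Otimes>\<^sub>M ?L) (\<Pi>\<^sub>M k\<in>{1..m}. N)"
      using insert_at_measurable[OF p]
      by (subst measurable_cong_sets[OF _ refl]) (auto intro!: sets_pair_measure_cong sets_tuple_law)
    show "(\<lambda>x. ennreal ((h x)\<^sup>2)) \<in> borel_measurable (distr (law j \<Otimes>\<^sub>M ?L) (\<Pi>\<^sub>M k\<in>{1..m}. N) (\<lambda>(y, z). insert_at m p y z))"
      unfolding measurable_distr_eq1 by measurable
  qed (simp add: case_prod_beta)
  also have "distr (law j \<Otimes>\<^sub>M ?L) (\<Pi>\<^sub>M k\<in>{1..m}. N) (\<lambda>(y, z). insert_at m p y z) =
      (\<Pi>\<^sub>M k\<in>{1..m}. law ((r(p := j)) k))"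
    using insert_drop_at[OF _ p, of r j] r by (subst insert_at_law[OF p j im]) (auto simp: PiE_iff)
  finally show ?thesis .
qed

lemma nn_integral_tuple_law:
  assumes "r \<in> dtuples" and g: "g \<in> borel_measurable (\<Pi>\<^sub>M k\<in>{1..m}. N)"
  shows "(\<integral>\<^sup>+x. g x \<partial>(\<Pi>\<^sub>M k\<in>{1..m}. law (r k))) = (\<integral>\<^sup>+\<omega>. g (at_indices m (\<lambda>j. X j \<omega>) r) \<partial>P)"
proof -
  have "(\<Pi>\<^sub>M k\<in>{1..m}. law (r k)) = distr P (\<Pi>\<^sub>M k\<in>{1..m}. N) (\<lambda>\<omega>. at_indices m (\<lambda>j. X j \<omega>) r)"
    unfolding at_indices_def using distinct_tuplesD[OF assms(1)] by (intro joint_law[symmetric]) auto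
  then show ?thesis
    by (simp only:) (intro nn_integral_distr at_indices_measurable distinct_tuplesD(4)[OF assms(1)],
      simp_all only: measurable_distr_eq1 g)
qed

lemma nn_integral_h_sq_distinct:
  assumes "r \<in> dtuples"
  shows "(\<integral>\<^sup>+x. ennreal ((h x)\<^sup>2) \<partial>(\<Pi>\<^sub>M k\<in>{1..m}. law (r k))) = (\<integral>\<^sup>+\<omega>. ennreal ((obs r \<omega>)\<^sup>2) \<partial>P)"
  by (rule nn_integral_tuple_law[OF assms]) measurable

text \<open>
  The conditional expectation of \<open>h(X\<^sub>s)\<close>, given observations \<open>X\<^sub>A\<close> among which only \<open>X\<close> at \<open>s q\<close>
  occurs in \<open>X\<^sub>s\<close>, is the projection at that observation: the other arguments are independent of \<open>X\<^sub>A\<close>, so they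
  can be integrated out.
\<close>

lemma integral_mult_obs_eq_proj:
  assumes s: "s \<in> dtuples" and q: "q \<in> {1..m}"
    and A: "A \<subseteq> {1..n}" "s q \<in> A" "A \<inter> s ` ({1..m} - {q}) = {}"
    and U: "U \<in> borel_measurable (\<Pi>\<^sub>M k\<in>A. N)"
    and u: "\<And>\<omega>. u \<omega> = U (\<lambda>i\<in>A. X i \<omega>)"
    and int: "integrable P (\<lambda>\<omega>. u \<omega> * obs s \<omega>)"
  shows "(\<integral>\<omega>. u \<omega> * obs s \<omega> \<partial>P) = (\<integral>\<omega>. u \<omega> * proj s q (X (s q) \<omega>) \<partial>P)"
proof -
  let ?i = "drop_at m q s"
  let ?B = "s ` ({1..m} - {q})"
  define Z where "Z \<omega> = (\<lambda>i\<in>A. X i \<omega>)" for \<omega>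
  define Y where "Y \<omega> = (\<lambda>k\<in>{1..m - 1}. X (?i k) \<omega>)" for \<omega>
  have sn: "k \<in> {1..m} \<Longrightarrow> s k \<in> {1..n}" for k using distinct_tuplesD(4)[OF s] by auto
  have iB: "?i ` {1..m - 1} = ?B" by (rule drop_at_image[OF q])
  have in_n: "k \<in> {1..m - 1} \<Longrightarrow> ?i k \<in> {1..n}" for k by (rule drop_at_mem[OF q sn])
  have inj: "inj_on ?i {1..m - 1}"
    using distinct_tuplesD(2)[OF s] q by (intro drop_at_inj_on) (auto intro: inj_on_subset)
  have Zm: "Z \<in> measurable P (\<Pi>\<^sub>M k\<in>A. N)" unfolding Z_def using A by (intro measurable_restrict X_measurable) auto
  have Ym: "Y \<in> measurable P (\<Pi>\<^sub>M k\<in>{1..m - 1}. N)" unfolding Y_def by (intro measurable_restrict X_measurable in_n)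
  have "indep_var (\<Pi>\<^sub>M k\<in>A. N) Z (\<Pi>\<^sub>M k\<in>?B. N) (\<lambda>\<omega>. \<lambda>i\<in>?B. X i \<omega>)"
    unfolding Z_def by (rule indep_var_restrict[OF indep]) (use A sn in auto)
  then have "indep_var (\<Pi>\<^sub>M k\<in>A. N) (id \<circ> Z) (\<Pi>\<^sub>M k\<in>{1..m - 1}. N)
      ((\<lambda>z. \<lambda>k\<in>{1..m - 1}. z (?i k)) \<circ> (\<lambda>\<omega>. \<lambda>i\<in>?B. X i \<omega>))"
  proof (rule indep_var_compose)
    show "(\<lambda>z. \<lambda>k\<in>{1..m - 1}. z (?i k)) \<in> measurable (\<Pi>\<^sub>M k\<in>?B. N) (\<Pi>\<^sub>M k\<in>{1..m - 1}. N)"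
    proof (intro measurable_restrict measurable_component_singleton)
      fix k assume "k \<in> {1..m - 1}"
      then show "?i k \<in> ?B" unfolding iB[symmetric] by (rule imageI)
    qed
  qed (rule measurable_ident)
  moreover have "(\<lambda>z. \<lambda>k\<in>{1..m - 1}. z (?i k)) \<circ> (\<lambda>\<omega>. \<lambda>i\<in>?B. X i \<omega>) = Y"
  proof (intro ext)
    fix \<omega> k
    have "k \<in> {1..m - 1} \<Longrightarrow> ?i k \<in> ?B" unfolding iB[symmetric] by (rule imageI)
    then show "((\<lambda>z. \<lambda>k\<in>{1..m - 1}. z (?i k)) \<circ> (\<lambda>\<omega>. \<lambda>i\<in>?B. X i \<omega>)) \<omega> k = Y \<omega> k"
      by (simp add: Y_def)
  qed
  ultimately have indYZ: "indep_var (\<Pi>\<^sub>M k\<in>A. N) Z (\<Pi>\<^sub>M k\<in>{1..m - 1}. N) Y" by simp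
  let ?LZ = "distr P (\<Pi>\<^sub>M k\<in>A. N) Z"
  let ?LY = "\<Pi>\<^sub>M k\<in>{1..m - 1}. law (?i k)"
  have LY: "distr P (\<Pi>\<^sub>M k\<in>{1..m - 1}. N) Y = ?LY"
    unfolding Y_def using inj in_n by (intro joint_law) auto
  have joint: "?LZ \<Otimes>\<^sub>M ?LY = distr P ((\<Pi>\<^sub>M k\<in>A. N) \<Otimes>\<^sub>M (\<Pi>\<^sub>M k\<in>{1..m - 1}. N)) (\<lambda>\<omega>. (Z \<omega>, Y \<omega>))"
    using indYZ unfolding indep_var_distribution_eq LY by simp
  have ZYm: "(\<lambda>\<omega>. (Z \<omega>, Y \<omega>)) \<in> measurable P ((\<Pi>\<^sub>M k\<in>A. N) \<Otimes>\<^sub>M (\<Pi>\<^sub>M k\<in>{1..m - 1}. N))"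
    using Zm Ym by (rule measurable_Pair)
  interpret LY: prob_space ?LY by (rule tuple_law_prob_space) (rule in_n)
  interpret LZ: prob_space ?LZ by (rule prob_space_distr[OF Zm])
  interpret LZY: pair_prob_space ?LZ ?LY ..
  have evq: "(\<lambda>z. z (s q)) \<in> measurable (\<Pi>\<^sub>M k\<in>A. N) N" using A by (intro measurable_component_singleton)
  let ?\<Phi> = "\<lambda>(z, y). U z * h (insert_at m q (z (s q)) y)"
  have "(\<lambda>(z, y). (z (s q), y)) \<in> measurable ((\<Pi>\<^sub>M k\<in>A. N) \<Otimes>\<^sub>M (\<Pi>\<^sub>M k\<in>{1..m - 1}. N)) (N \<Otimes>\<^sub>M (\<Pi>\<^sub>M k\<in>{1..m - 1}. N))"
    unfolding case_prod_beta using measurable_compose[OF measurable_fst evq] measurable_snd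
    by (rule measurable_Pair)
  from measurable_compose[OF this h_insert_at_measurable[OF q]]
  have \<Phi>m: "?\<Phi> \<in> borel_measurable ((\<Pi>\<^sub>M k\<in>A. N) \<Otimes>\<^sub>M (\<Pi>\<^sub>M k\<in>{1..m - 1}. N))"
    using U by (simp add: case_prod_beta)
  have "insert_at m q (X (s q) \<omega>) (Y \<omega>) = at_indices m (\<lambda>j. X j \<omega>) s" for \<omega>
  proof -
    have "Y \<omega> = drop_at m q (at_indices m (\<lambda>j. X j \<omega>) s)"
    proof
      fix k show "Y \<omega> k = drop_at m q (at_indices m (\<lambda>j. X j \<omega>) s) k"
        by (cases "k \<in> {1..m - 1}") (auto simp: Y_def drop_at_def at_indices_def)
    qed
    moreover have "at_indices m (\<lambda>j. X j \<omega>) s \<in> extensional {1..m}" by (simp add: at_indices_def)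
    moreover have "at_indices m (\<lambda>j. X j \<omega>) s q = X (s q) \<omega>" using q by (simp add: at_indices_def)
    ultimately show ?thesis using q by (simp only: insert_drop_at fun_upd_idem)
  qed
  then have val: "?\<Phi> (Z \<omega>, Y \<omega>) = u \<omega> * obs s \<omega>" for \<omega>
    using A by (simp add: u Z_def)
  have "integrable (?LZ \<Otimes>\<^sub>M ?LY) ?\<Phi>"
    unfolding joint using int \<Phi>m ZYm by (subst integrable_distr_eq) (auto simp: val[simplified])
  then have "(\<integral>x. ?\<Phi> x \<partial>(?LZ \<Otimes>\<^sub>M ?LY)) = (\<integral>z. (\<integral>y. ?\<Phi> (z, y) \<partial>?LY) \<partial>?LZ)"
    by (rule LZY.integral_fst'[symmetric])
  also have "\<dots> = (\<integral>z. U z * proj s q (z (s q)) \<partial>?LZ)"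
    by (simp add: proj_eq)
  also have "\<dots> = (\<integral>\<omega>. U (Z \<omega>) * proj s q (Z \<omega> (s q)) \<partial>P)"
    using U evq proj_measurable[OF q sn]
    by (intro integral_distr Zm) (auto intro: measurable_compose[OF evq])
  also have "\<dots> = (\<integral>\<omega>. u \<omega> * proj s q (X (s q) \<omega>) \<partial>P)"
    using A by (simp add: u Z_def)
  also have "(\<integral>x. ?\<Phi> x \<partial>(?LZ \<Otimes>\<^sub>M ?LY)) = (\<integral>\<omega>. u \<omega> * obs s \<omega> \<partial>P)"
    unfolding joint using \<Phi>m ZYm by (subst integral_distr) (auto simp: val[simplified])
  finally show ?thesis by simp
qed

lemma indep_obs:
  assumes r: "r \<in> dtuples" and s: "s \<in> dtuples"
    and disj: "r ` {1..m} \<inter> s ` {1..m} = {}" and int: "integrable P (obs r)" "integrable P (obs s)"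
  shows "obs_mean r s = (\<integral>\<omega>. obs r \<omega> \<partial>P) * (\<integral>\<omega>. obs s \<omega> \<partial>P)"
proof -
  define T where "T r = (\<lambda>z. h (\<lambda>k\<in>{1..m}. z (r k)))" for r :: "nat \<Rightarrow> nat"
  have T: "T r \<in> borel_measurable (\<Pi>\<^sub>M i\<in>r ` {1..m}. N)" for r :: "nat \<Rightarrow> nat"
    unfolding T_def by (intro measurable_compose[OF _ h_meas] measurable_restrict measurable_component_singleton imageI)
  have TX: "T r \<circ> (\<lambda>\<omega>. \<lambda>i\<in>r ` {1..m}. X i \<omega>) = obs r" for r
    by (simp add: T_def fun_eq_iff at_indices_def cong: restrict_cong)
  have "indep_var (\<Pi>\<^sub>M i\<in>r ` {1..m}. N) (\<lambda>\<omega>. \<lambda>i\<in>r ` {1..m}. X i \<omega>)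
      (\<Pi>\<^sub>M i\<in>s ` {1..m}. N) (\<lambda>\<omega>. \<lambda>i\<in>s ` {1..m}. X i \<omega>)"
    by (rule indep_var_restrict[OF indep disj])
      (use distinct_tuplesD(4)[OF r] distinct_tuplesD(4)[OF s] in blast)+
  from indep_var_compose[OF this T T] have "indep_var borel (obs r) borel (obs s)" unfolding TX .
  then show ?thesis using int by (rule indep_var_lebesgue_integral)
qed

lemma obs_square_integrable:
  assumes "r \<in> tuples" "(\<integral>\<^sup>+\<omega>. ennreal ((obs r \<omega>)\<^sup>2) \<partial>P) \<le> ennreal B" "0 \<le> B"
  shows "square_integrable P (obs r)" "(\<integral>\<omega>. (obs r \<omega>)\<^sup>2 \<partial>P) \<le> B"
proof -
  have m: "obs r \<in> borel_measurable P" using assms(1) by (intro obs_measurable) auto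
  have "(\<integral>\<^sup>+\<omega>. ennreal ((obs r \<omega>)\<^sup>2) \<partial>P) < \<infinity>" using assms(2) by (simp add: order_le_less_trans)
  then have i: "integrable P (\<lambda>\<omega>. (obs r \<omega>)\<^sup>2)" using m by (intro integrableI_nonneg) auto
  then show "square_integrable P (obs r)" using m by (simp add: square_integrable_def)
  show "(\<integral>\<omega>. (obs r \<omega>)\<^sup>2 \<partial>P) \<le> B" using assms(2,3) i by (simp add: nn_integral_eq_integral)
qed

lemma proj_square_integrable:
  assumes "p \<in> {1..m}" "r \<in> tuples" "j \<in> {1..n}"
    and "(\<integral>\<^sup>+x. ennreal ((h x)\<^sup>2) \<partial>(\<Pi>\<^sub>M k\<in>{1..m}. law ((r(p := j)) k))) \<le> ennreal B" "0 \<le> B"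
  shows "square_integrable P (\<lambda>\<omega>. proj r p (X j \<omega>))" "(\<integral>\<omega>. (proj r p (X j \<omega>))\<^sup>2 \<partial>P) \<le> B"
proof -
  have "k \<in> {1..m} \<Longrightarrow> r k \<in> {1..n}" for k using assms(2) by auto
  from proj_measurable[OF assms(1) this]
  have m: "(\<lambda>\<omega>. proj r p (X j \<omega>)) \<in> borel_measurable P" by (rule measurable_compose[OF X_measurable[OF assms(3)]])
  have le: "(\<integral>\<^sup>+\<omega>. ennreal ((proj r p (X j \<omega>))\<^sup>2) \<partial>P) \<le> ennreal B"
    using nn_integral_proj_sq_le[OF assms(1-3)] assms(4) by (rule order_trans)
  then have "(\<integral>\<^sup>+\<omega>. ennreal ((proj r p (X j \<omega>))\<^sup>2) \<partial>P) < \<infinity>" by (simp add: order_le_less_trans)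
  then have i: "integrable P (\<lambda>\<omega>. (proj r p (X j \<omega>))\<^sup>2)" using m by (intro integrableI_nonneg) auto
  then show "square_integrable P (\<lambda>\<omega>. proj r p (X j \<omega>))" using m by (simp add: square_integrable_def)
  show "(\<integral>\<omega>. (proj r p (X j \<omega>))\<^sup>2 \<partial>P) \<le> B" using le assms(5) i by (simp add: nn_integral_eq_integral)
qed

end

section \<open>The variance of a weighted U-statistic\<close>

locale bounded_sample = independent_sample +
  fixes B :: real
  assumes B_nonneg: "0 \<le> B"
    and second_moment_le: "r \<in> distinct_tuples {1..n} m \<Longrightarrow>
      (\<integral>\<^sup>+\<omega>. ennreal ((h (at_indices m (\<lambda>j. X j \<omega>) r))\<^sup>2) \<partial>P) \<le> ennreal B"
begin

lemma obs_sq: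
  assumes "r \<in> dtuples"
  shows "square_integrable P (obs r)" "(\<integral>\<omega>. (obs r \<omega>)\<^sup>2 \<partial>P) \<le> B"
  using obs_square_integrable[OF distinct_tuplesD(1)[OF assms] second_moment_le[OF assms] B_nonneg] by auto

lemma proj_sq:
  assumes "r \<in> dtuples" "p \<in> {1..m}" "j \<in> {1..n}" "r(p := j) \<in> dtuples"
  shows "square_integrable P (\<lambda>\<omega>. proj r p (X j \<omega>))" "(\<integral>\<omega>. (proj r p (X j \<omega>))\<^sup>2 \<partial>P) \<le> B"
proof -
  have "(\<integral>\<^sup>+x. ennreal ((h x)\<^sup>2) \<partial>(\<Pi>\<^sub>M k\<in>{1..m}. law ((r(p := j)) k))) \<le> ennreal B"
    unfolding nn_integral_h_sq_distinct[OF assms(4)] by (rule second_moment_le[OF assms(4)])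
  from proj_square_integrable[OF assms(2) distinct_tuplesD(1)[OF assms(1)] assms(3) this B_nonneg]
  show "square_integrable P (\<lambda>\<omega>. proj r p (X j \<omega>))" "(\<integral>\<omega>. (proj r p (X j \<omega>))\<^sup>2 \<partial>P) \<le> B" by auto
qed

lemma proj_self_sq:
  assumes "r \<in> dtuples" "p \<in> {1..m}"
  shows "square_integrable P (\<lambda>\<omega>. proj r p (X (r p) \<omega>))" "(\<integral>\<omega>. (proj r p (X (r p) \<omega>))\<^sup>2 \<partial>P) \<le> B"
  using proj_sq[OF assms distinct_tuplesD(4)[OF assms]] assms(1) by simp_all

lemma integral_proj_self:
  assumes "s \<in> dtuples" "q \<in> {1..m}"
  shows "(\<integral>\<omega>. proj s q (X (s q) \<omega>) \<partial>P) = (\<integral>\<omega>. obs s \<omega> \<partial>P)"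
proof -
  have "(\<integral>\<omega>. 1 * obs s \<omega> \<partial>P) = (\<integral>\<omega>. 1 * proj s q (X (s q) \<omega>) \<partial>P)"
  proof (rule integral_mult_obs_eq_proj[OF assms, of "{s q}" "\<lambda>_. 1"])
    show "{s q} \<subseteq> {1..n}" using distinct_tuplesD(4)[OF assms] by blast
    show "{s q} \<inter> s ` ({1..m} - {q}) = {}" unfolding distinct_Diff_image[OF assms] by blast
    show "integrable P (\<lambda>\<omega>. 1 * obs s \<omega>)" using square_integrable_integrable[OF obs_sq(1)[OF assms(1)]] by simp
  qed auto
  then show ?thesis by simp
qed

text \<open>
  Two applications of \<open>integral_mult_obs_eq_proj\<close>, one for each factor. The second one starts from
  the already projected first factor, which depends on the shared observation only.
\<close>

lemma integral_mult_meet_only_at: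
  assumes r: "r \<in> dtuples" and s: "s \<in> dtuples"
    and p: "p \<in> {1..m}" and q: "q \<in> {1..m}" and meet: "meet_only_at m r s p q"
  shows "obs_mean r s = (\<integral>\<omega>. obs r \<omega> * proj s q (X (s q) \<omega>) \<partial>P)"
    and "obs_mean r s = (\<integral>\<omega>. proj r p (X (r p) \<omega>) * proj s q (X (s q) \<omega>) \<partial>P)"
proof -
  have eq: "r p = s q" and int: "r ` {1..m} \<inter> s ` {1..m} = {s q}"
    using meet by (auto simp: meet_only_at_def)
  show 1: "obs_mean r s = (\<integral>\<omega>. obs r \<omega> * proj s q (X (s q) \<omega>) \<partial>P)"
  proof (rule integral_mult_obs_eq_proj[OF s q, of "r ` {1..m}" "\<lambda>z. h (\<lambda>k\<in>{1..m}. z (r k))"])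
    show "r ` {1..m} \<subseteq> {1..n}" using distinct_tuplesD(4)[OF r] by blast
    show "s q \<in> r ` {1..m}" using eq p by (metis imageI)
    show "r ` {1..m} \<inter> s ` ({1..m} - {q}) = {}" unfolding distinct_Diff_image[OF s q] using int by blast
    show "(\<lambda>z. h (\<lambda>k\<in>{1..m}. z (r k))) \<in> borel_measurable (\<Pi>\<^sub>M i\<in>r ` {1..m}. N)"
      by (intro measurable_compose[OF _ h_meas] measurable_restrict measurable_component_singleton imageI)
    show "obs r \<omega> = h (\<lambda>k\<in>{1..m}. (\<lambda>i\<in>r ` {1..m}. X i \<omega>) (r k))" for \<omega>
      by (simp add: at_indices_def cong: restrict_cong)
    show "integrable P (\<lambda>\<omega>. obs r \<omega> * obs s \<omega>)" by (intro square_integrable_mult obs_sq r s)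
  qed
  have "(\<integral>\<omega>. proj s q (X (s q) \<omega>) * obs r \<omega> \<partial>P) = (\<integral>\<omega>. proj s q (X (s q) \<omega>) * proj r p (X (r p) \<omega>) \<partial>P)"
  proof (rule integral_mult_obs_eq_proj[OF r p, of "{r p}" "\<lambda>z. proj s q (z (s q))"])
    show "{r p} \<subseteq> {1..n}" using distinct_tuplesD(4)[OF r p] by blast
    show "{r p} \<inter> r ` ({1..m} - {p}) = {}" unfolding distinct_Diff_image[OF r p] by blast
    show "(\<lambda>z. proj s q (z (s q))) \<in> borel_measurable (\<Pi>\<^sub>M k\<in>{r p}. N)"
      by (intro measurable_compose[OF _ proj_measurable[OF q distinct_tuplesD(4)[OF s]]] measurable_component_singleton)
        (simp_all add: eq)
    show "integrable P (\<lambda>\<omega>. proj s q (X (s q) \<omega>) * obs r \<omega>)"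
      by (intro square_integrable_mult obs_sq proj_self_sq r s q)
  qed (auto simp: eq)
  then show "obs_mean r s = (\<integral>\<omega>. proj r p (X (r p) \<omega>) * proj s q (X (s q) \<omega>) \<partial>P)"
    using 1 by (simp add: mult.commute)
qed

lemma covar_obs_disjoint:
  assumes "r \<in> dtuples" "s \<in> dtuples" "r ` {1..m} \<inter> s ` {1..m} = {}"
  shows "covar P (obs r) (obs s) = 0"
  using indep_obs[OF assms] obs_sq(1)[OF assms(1)] obs_sq(1)[OF assms(2)]
  by (simp add: covar_eq square_integrable_integrable)

lemma covar_obs_meet_only_at:
  assumes "r \<in> dtuples" "s \<in> dtuples" "p \<in> {1..m}" "q \<in> {1..m}"
    and "meet_only_at m r s p q"
  shows "covar P (obs r) (obs s) = covar P (\<lambda>\<omega>. proj r p (X (r p) \<omega>)) (\<lambda>\<omega>. proj s q (X (s q) \<omega>))"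
  using integral_mult_meet_only_at(2)[OF assms] integral_proj_self[OF assms(1,3)] integral_proj_self[OF assms(2,4)]
    obs_sq(1)[OF assms(1)] obs_sq(1)[OF assms(2)] proj_self_sq(1)[OF assms(1,3)] proj_self_sq(1)[OF assms(2,4)]
  by (simp add: covar_eq)

abbreviation "h1_at a i \<equiv> h1 P N X m n a h i"

lemma h1_divide_n:
  assumes "i \<in> {1..n}"
  shows "h1_at a i y / real n = (\<Sum>(r, p)\<in>incidences m n i.
      (tuple_weight m n * a r) * (proj r p y - \<theta> P X m h r))"
proof -
  have "(\<Sum>(r, p)\<in>incidences m n i. (tuple_weight m n * a r) * (proj r p y - \<theta> P X m h r)) =
      (\<Sum>r\<in>dtuples. \<Sum>p | p \<in> {1..m} \<and> r p = i. (tuple_weight m n * a r) * (proj r p y - \<theta> P X m h r))"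
    unfolding incidences_def by (rule sum.Sigma[symmetric]) auto
  then show ?thesis
    unfolding h1_eq_sum_tuples[OF assms] by (simp add: sum_distrib_left mult.assoc)
qed

text \<open>
  Both variances are expanded into sums over pairs of tuples. Their difference has coefficient
  \<open>z r s\<close>, which vanishes for pairs with at most one common index; otherwise it consists of one
  covariance of kernels and at most \<open>m\<^sup>2\<close> covariances of projections, each at most \<open>B\<close>.
\<close>

lemma variance_wU_approx:
  "\<bar>variance (\<lambda>\<omega>. wU m n a h (\<lambda>i. X i \<omega>)) - (\<Sum>i=1..n. variance (\<lambda>\<omega>. h1_at a i (X i \<omega>) / real n))\<bar>
    \<le> ((real m)\<^sup>2 + 1) * B * overlap_mass 2 m n a"
proof -
  let ?D = "dtuples"
  let ?c = "tuple_weight m n"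
  define K where "K r p s q = covar P (\<lambda>\<omega>. proj r p (X (r p) \<omega>)) (\<lambda>\<omega>. proj s q (X (s q) \<omega>))" for r p s q
  have U: "variance (\<lambda>\<omega>. wU m n a h (\<lambda>i. X i \<omega>)) = ?c\<^sup>2 * (\<Sum>r\<in>?D. \<Sum>s\<in>?D. a r * a s * covar P (obs r) (obs s))"
  proof -
    have "variance (\<lambda>\<omega>. wU m n a h (\<lambda>i. X i \<omega>)) = variance (\<lambda>\<omega>. \<Sum>r\<in>?D. (?c * a r) * obs r \<omega>)"
      by (simp add: wU_def tuple_weight_def sum_distrib_left mult.assoc)
    also have "\<dots> = (\<Sum>r\<in>?D. \<Sum>s\<in>?D. (?c * a r) * (?c * a s) * covar P (obs r) (obs s))"
      by (rule variance_linear_combination) (auto intro: obs_sq)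
    finally show ?thesis by (simp add: sum_distrib_left power2_eq_square mult_ac)
  qed
  have H: "variance (\<lambda>\<omega>. h1_at a i (X i \<omega>) / real n) =
      (\<Sum>x\<in>incidences m n i. \<Sum>y\<in>incidences m n i.
        (?c * a (fst x)) * (?c * a (fst y)) * K (fst x) (snd x) (fst y) (snd y))" if i: "i \<in> {1..n}" for i
  proof -
    define u where "u x \<omega> = proj (fst x) (snd x) (X i \<omega>) - \<theta> P X m h (fst x)" for x \<omega>
    have sq: "square_integrable P (\<lambda>\<omega>. proj (fst x) (snd x) (X i \<omega>))" if "x \<in> incidences m n i" for x
      using that proj_self_sq(1)[of "fst x" "snd x"] by (auto simp: incidences_def)
    have "variance (\<lambda>\<omega>. h1_at a i (X i \<omega>) / real n) =
        variance (\<lambda>\<omega>. \<Sum>x\<in>incidences m n i. (?c * a (fst x)) * u x \<omega>)"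
      by (simp add: h1_divide_n[OF i] u_def case_prod_beta)
    also have "\<dots> = (\<Sum>x\<in>incidences m n i. \<Sum>y\<in>incidences m n i.
        (?c * a (fst x)) * (?c * a (fst y)) * covar P (u x) (u y))"
      unfolding u_def by (rule variance_linear_combination) (auto intro: square_integrable_centered sq)
    also have "\<dots> = (\<Sum>x\<in>incidences m n i. \<Sum>y\<in>incidences m n i.
        (?c * a (fst x)) * (?c * a (fst y)) * K (fst x) (snd x) (fst y) (snd y))"
    proof (intro sum.cong refl arg_cong2[of _ _ _ _ "(*)"])
      fix x y assume x: "x \<in> incidences m n i" and y: "y \<in> incidences m n i"
      then have "fst x (snd x) = i" "fst y (snd y) = i" by (auto simp: incidences_def)
      then show "covar P (u x) (u y) = K (fst x) (snd x) (fst y) (snd y)"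
        unfolding u_def K_def using covar_diff_const[OF sq[OF x] sq[OF y]] by simp
    qed
    finally show ?thesis .
  qed
  have "(\<Sum>i=1..n. variance (\<lambda>\<omega>. h1_at a i (X i \<omega>) / real n)) =
      (\<Sum>i=1..n. \<Sum>x\<in>incidences m n i. \<Sum>y\<in>incidences m n i.
        (?c * a (fst x)) * (?c * a (fst y)) * K (fst x) (snd x) (fst y) (snd y))"
    by (rule sum.cong[OF refl H])
  also have "\<dots> =
      (\<Sum>r\<in>?D. \<Sum>s\<in>?D. \<Sum>p\<in>{1..m}. \<Sum>q\<in>{1..m}. if r p = s q then (?c * a r) * (?c * a s) * K r p s q else 0)"
    unfolding sum_incidences by (simp only: fst_conv snd_conv)
  also have "\<dots> = ?c\<^sup>2 * (\<Sum>r\<in>?D. \<Sum>s\<in>?D. a r * a s * (\<Sum>p\<in>{1..m}. \<Sum>q\<in>{1..m}. if r p = s q then K r p s q else 0))"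
    unfolding sum_distrib_left by (intro sum.cong refl) (simp add: power2_eq_square)
  finally have V: "(\<Sum>i=1..n. variance (\<lambda>\<omega>. h1_at a i (X i \<omega>) / real n)) = \<dots>" .
  define z where "z r s = covar P (obs r) (obs s) - (\<Sum>p\<in>{1..m}. \<Sum>q\<in>{1..m}. if r p = s q then K r p s q else 0)" for r s
  have "\<bar>?c\<^sup>2 * (\<Sum>r\<in>?D. \<Sum>s\<in>?D. a r * a s * z r s)\<bar> \<le> 0 * overlap_mass 1 m n a + (((real m)\<^sup>2 + 1) * B) * overlap_mass 2 m n a"
  proof (rule overlap_sum_bound)
    fix r s assume rs: "r \<in> ?D" "s \<in> ?D"
    show "z r s = 0" if "r ` {1..m} \<inter> s ` {1..m} = {}"
      using covar_obs_disjoint[OF rs that] sum_matches_disjoint[OF that] by (simp add: z_def)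
    show "\<bar>z r s\<bar> \<le> 0" if "p \<in> {1..m}" "q \<in> {1..m}" "meet_only_at m r s p q" for p q
      using covar_obs_meet_only_at[OF rs that] sum_matches_meet_only_at[OF rs that, of "\<lambda>p q. K r p s q"]
      by (simp add: z_def K_def)
    have "\<bar>covar P (obs r) (obs s)\<bar> \<le> B" by (intro abs_covar_le obs_sq rs)
    moreover have "\<bar>\<Sum>p\<in>{1..m}. \<Sum>q\<in>{1..m}. if r p = s q then K r p s q else 0\<bar> \<le> (real m)\<^sup>2 * B"
      unfolding K_def by (intro abs_sum_matches_le abs_covar_le proj_self_sq rs B_nonneg)
    ultimately show "\<bar>z r s\<bar> \<le> ((real m)\<^sup>2 + 1) * B"
      unfolding z_def by (simp add: algebra_simps)
  qed (simp_all add: B_nonneg)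
  moreover have "?c\<^sup>2 * (\<Sum>r\<in>?D. \<Sum>s\<in>?D. a r * a s * z r s) =
      variance (\<lambda>\<omega>. wU m n a h (\<lambda>i. X i \<omega>)) - (\<Sum>i=1..n. variance (\<lambda>\<omega>. h1_at a i (X i \<omega>) / real n))"
    unfolding U V z_def by (simp add: sum_subtractf algebra_simps)
  ultimately show ?thesis by simp
qed

lemma h1_measurable:
  assumes "i \<in> {1..n}"
  shows "h1_at a i \<in> borel_measurable N"
proof -
  have "(\<lambda>y. real n * (\<Sum>(r, p)\<in>incidences m n i. (tuple_weight m n * a r) * (proj r p y - \<theta> P X m h r)))
      \<in> borel_measurable N"
    unfolding case_prod_beta
    by (intro borel_measurable_times borel_measurable_const borel_measurable_sum borel_measurable_diff proj_measurable)
      (auto simp: incidences_def dest: distinct_tuplesD(4))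
  then show ?thesis unfolding h1_divide_n[OF assms, symmetric] using assms by simp
qed

lemma h1_square_integrable:
  assumes i: "i \<in> {1..n}"
  shows "square_integrable P (\<lambda>\<omega>. h1_at a i (X i \<omega>) / real n)"
  unfolding h1_divide_n[OF i] case_prod_beta
proof (intro square_integrable_sum square_integrable_cmult square_integrable_centered)
  fix x assume "x \<in> incidences m n i"
  then have "fst x \<in> dtuples" "snd x \<in> {1..m}" "fst x (snd x) = i"
    by (auto simp: incidences_def)
  with proj_self_sq(1)[of "fst x" "snd x"]
  show "square_integrable P (\<lambda>\<omega>. proj (fst x) (snd x) (X i \<omega>))" by simp
qed simp

lemma variance_sum_h1:
  "variance (\<lambda>\<omega>. 1 / real n * (\<Sum>i=1..n. h1_at a i (X i \<omega>))) =
   (\<Sum>i=1..n. variance (\<lambda>\<omega>. h1_at a i (X i \<omega>) / real n))"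
proof -
  let ?u = "\<lambda>i \<omega>. h1_at a i (X i \<omega>) / real n"
  have 0: "covar P (?u i) (?u j) = 0" if ij: "i \<in> {1..n}" "j \<in> {1..n}" "i \<noteq> j" for i j
  proof -
    define T where "T i z = h1_at a i (z i) / real n" for i z
    have T: "T i \<in> borel_measurable (\<Pi>\<^sub>M k\<in>{i}. N)" if "i \<in> {1..n}" for i
    proof -
      have "(\<lambda>z. z i) \<in> measurable (\<Pi>\<^sub>M k\<in>{i}. N) N" by (rule measurable_component_singleton) simp
      from measurable_compose[OF this h1_measurable[OF that]] show ?thesis
        unfolding T_def by (intro borel_measurable_divide borel_measurable_const)
    qed
    have TX: "T i \<circ> (\<lambda>\<omega>. \<lambda>k\<in>{i}. X k \<omega>) = ?u i" for i by (simp add: T_def fun_eq_iff)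
    have "indep_var (\<Pi>\<^sub>M k\<in>{i}. N) (\<lambda>\<omega>. \<lambda>k\<in>{i}. X k \<omega>) (\<Pi>\<^sub>M k\<in>{j}. N) (\<lambda>\<omega>. \<lambda>k\<in>{j}. X k \<omega>)"
      by (rule indep_var_restrict[OF indep]) (use ij in auto)
    from indep_var_compose[OF this T[OF ij(1)] T[OF ij(2)]]
    have "indep_var borel (?u i) borel (?u j)" unfolding TX .
    then have "(\<integral>\<omega>. ?u i \<omega> * ?u j \<omega> \<partial>P) = (\<integral>\<omega>. ?u i \<omega> \<partial>P) * (\<integral>\<omega>. ?u j \<omega> \<partial>P)"
      by (intro indep_var_lebesgue_integral square_integrable_integrable h1_square_integrable ij)
    then show ?thesis unfolding covar_eq[OF h1_square_integrable[OF ij(1)] h1_square_integrable[OF ij(2)]] by simp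
  qed
  have "variance (\<lambda>\<omega>. 1 / real n * (\<Sum>i=1..n. h1_at a i (X i \<omega>))) = variance (\<lambda>\<omega>. \<Sum>i=1..n. 1 * ?u i \<omega>)"
    by (simp add: sum_divide_distrib)
  also have "\<dots> = (\<Sum>i=1..n. \<Sum>j=1..n. 1 * 1 * covar P (?u i) (?u j))"
    by (intro variance_linear_combination h1_square_integrable) auto
  also have "\<dots> = (\<Sum>i=1..n. \<Sum>j=1..n. if j = i then covar P (?u i) (?u i) else 0)"
    by (intro sum.cong refl) (use 0 in auto)
  also have "\<dots> = (\<Sum>i=1..n. covar P (?u i) (?u i))"
    by (intro sum.cong refl) (subst sum.delta, auto)
  finally show ?thesis by (simp add: covar_def power2_eq_square)
qed

lemma finite_M2_set:
  "finite {\<bar>cond_prod_mean P N X m h r s (k p) - cond_prod_mean P N X m h k s (k p)\<bar> | p q r s k.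
       p \<in> {1..m} \<and> q \<in> {1..m} \<and>
       r \<in> dtuples \<and> s \<in> dtuples \<and>
       k \<in> dtuples \<and>
       meet_only_at m r s p q \<and> meet_only_at m k s p q}" (is "finite ?S")
proof -
  let ?D = "dtuples"
  have "?S \<subseteq> (\<lambda>(p, r, s, k). \<bar>cond_prod_mean P N X m h r s (k p) - cond_prod_mean P N X m h k s (k p)\<bar>)
      ` ({1..m} \<times> ?D \<times> ?D \<times> ?D)"
    by force
  then show ?thesis by (rule finite_subset) simp
qed

lemma abs_integral_diff_le_M2:
  assumes r: "r \<in> dtuples" and s: "s \<in> dtuples"
    and k: "k \<in> dtuples" and p: "p \<in> {1..m}" and q: "q \<in> {1..m}"
    and meet: "meet_only_at m r s p q" "meet_only_at m k s p q"
  shows "\<bar>obs_mean r s - obs_mean k s\<bar> \<le> M2 P N X m n h"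
proof -
  have Xk: "X (k p) \<in> measurable P N" by (rule X_measurable[OF distinct_tuplesD(4)[OF k p]])
  have "\<bar>cond_prod_mean P N X m h r s (k p) - cond_prod_mean P N X m h k s (k p)\<bar> \<le> M2 P N X m n h"
    unfolding M2_def by (rule Max_ge[OF finite_M2_set]) (use assms in blast)
  moreover have "cond_prod_mean P N X m h u s (k p) = obs_mean u s"
    if "u \<in> dtuples" for u
    by (intro cond_prod_mean_eq Xk square_integrable_mult obs_sq that s)
  ultimately show ?thesis using r k by simp
qed

text \<open>
  A maximum of absolute values is nonnegative once it is taken over a nonempty set. Two tuples
  sharing just the index \<open>1\<close> provide an element.
\<close>

lemma M2_nonneg:
  assumes "2 * m \<le> n"
  shows "0 \<le> M2 P N X m n h"
proof -
  \<comment> \<open>\<open>s\<close> has the entries \<open>1\<close> and \<open>m + 2, \<dots>, 2 m\<close>\<close>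
  define r where "r = (\<lambda>k\<in>{1..m}. k)"
  define s where "s = (\<lambda>k\<in>{1..m}. if k = 1 then 1 else m + k)"
  have D: "r \<in> dtuples" "s \<in> dtuples"
    using assms m_pos by (auto simp: distinct_tuples_def r_def s_def inj_on_def split: if_splits)
  have rim: "r ` {1..m} = {1..m}" by (auto simp: r_def)
  have s1: "1 \<in> s ` {1..m}" using m_pos by (intro image_eqI[of _ _ 1]) (auto simp: s_def)
  have s2: "s ` {1..m} \<subseteq> insert 1 {m<..}" by (auto simp: s_def)
  have "r ` {1..m} \<inter> s ` {1..m} = {1}"
  proof (intro equalityI subsetI)
    fix v assume v: "v \<in> r ` {1..m} \<inter> s ` {1..m}"
    then have "v \<le> m" "v \<in> insert 1 {m<..}" using s2 unfolding rim by auto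
    then show "v \<in> {1}" by auto
  next
    fix v :: nat assume "v \<in> {1}"
    then show "v \<in> r ` {1..m} \<inter> s ` {1..m}" using s1 m_pos unfolding rim by simp
  qed
  then have "meet_only_at m r s 1 1" using m_pos by (simp add: meet_only_at_def r_def s_def)
  from abs_integral_diff_le_M2[OF D D(1) _ _ this this] show ?thesis using m_pos by simp
qed

end

section \<open>The variance of the bootstrap statistic\<close>

text \<open>
  The product of uniform distributions is the uniform distribution on tuples. It is written as an
  image measure because a probability mass function lives on all functions and a product space on
  the extensional ones.
\<close>

lemma PiM_uniform_eq:
  fixes n :: nat
  assumes K: "finite K" "K \<noteq> {}" and n: "1 \<le> n"
  shows "(\<Pi>\<^sub>M k\<in>K. measure_pmf (pmf_of_set {1..n})) =
    distr (measure_pmf (pmf_of_set (K \<rightarrow>\<^sub>E {1..n}))) (\<Pi>\<^sub>M k\<in>K. count_space UNIV) (\<lambda>z. restrict z K)"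
proof -
  let ?Q = "Pi_pmf K undefined (\<lambda>_. pmf_of_set {1..n})"
  have "PiE_dflt K undefined (\<lambda>_. {1..n}) = K \<rightarrow>\<^sub>E {1..n}"
    by (auto simp: PiE_dflt_def PiE_def Pi_def extensional_def)
  then have Q: "?Q = pmf_of_set (K \<rightarrow>\<^sub>E {1..n})"
    using n by (subst Pi_pmf_of_set) (auto simp: K)
  have law: "distr (measure_pmf ?Q) (count_space UNIV) (\<lambda>f. f k) = measure_pmf (pmf_of_set {1..n})"
    if "k \<in> K" for k
    unfolding map_pmf_rep_eq[symmetric] using that by (simp add: Pi_pmf_component K)
  have "distr (measure_pmf ?Q) (\<Pi>\<^sub>M k\<in>K. count_space UNIV) (\<lambda>z. \<lambda>k\<in>K. z k) =
      (\<Pi>\<^sub>M k\<in>K. distr (measure_pmf ?Q) (count_space UNIV) (\<lambda>f. f k))"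
    by (rule prob_space.indep_vars_iff_distr_eq_PiM'[THEN iffD1, OF measure_pmf.prob_space_axioms])
      (auto simp: K indep_vars_Pi_pmf)
  also have "\<dots> = (\<Pi>\<^sub>M k\<in>K. measure_pmf (pmf_of_set {1..n}))"
    by (intro PiM_cong law refl)
  finally show ?thesis unfolding Q by (rule sym)
qed

lemma measurable_PiM_nat:
  assumes "finite K" and "\<And>z. z \<in> K \<rightarrow>\<^sub>E UNIV \<Longrightarrow> g z \<in> space M"
  shows "g \<in> measurable (\<Pi>\<^sub>M k\<in>K. count_space (UNIV :: nat set)) M"
  using assms by (simp add: count_space_PiM_finite)

lemma integral_PiM_uniform:
  fixes g :: "('k \<Rightarrow> nat) \<Rightarrow> real"
  assumes K: "finite K" "K \<noteq> {}" and n: "1 \<le> n"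
  shows "(\<integral>z. g z \<partial>(\<Pi>\<^sub>M k\<in>K. measure_pmf (pmf_of_set {1..n}))) =
      (\<Sum>z\<in>K \<rightarrow>\<^sub>E {1..n}. g z) / real n ^ card K"
proof -
  have S: "finite (K \<rightarrow>\<^sub>E {1..n})" "K \<rightarrow>\<^sub>E {1..n} \<noteq> {}"
    using K n by (auto intro: finite_PiE simp: PiE_eq_empty_iff)
  have "(\<integral>z. g z \<partial>(\<Pi>\<^sub>M k\<in>K. measure_pmf (pmf_of_set {1..n}))) =
      (\<integral>z. g (restrict z K) \<partial>measure_pmf (pmf_of_set (K \<rightarrow>\<^sub>E {1..n})))"
    unfolding PiM_uniform_eq[OF assms]
    by (rule integral_distr) (auto intro!: measurable_PiM_nat K simp: space_PiM)
  also have "\<dots> = (\<Sum>z\<in>K \<rightarrow>\<^sub>E {1..n}. g (restrict z K)) / card (K \<rightarrow>\<^sub>E {1..n})"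
    by (rule integral_pmf_of_set[OF S(2,1)])
  also have "(\<Sum>z\<in>K \<rightarrow>\<^sub>E {1..n}. g (restrict z K)) = (\<Sum>z\<in>K \<rightarrow>\<^sub>E {1..n}. g z)"
    by (intro sum.cong refl) (simp add: PiE_restrict)
  finally show ?thesis using K by (simp add: card_PiE)
qed

lemma nn_integral_PiM_uniform:
  fixes g :: "('k \<Rightarrow> nat) \<Rightarrow> real"
  assumes K: "finite K" "K \<noteq> {}" and n: "1 \<le> n" and g: "\<And>z. 0 \<le> g z"
  shows "(\<integral>\<^sup>+z. ennreal (g z) \<partial>(\<Pi>\<^sub>M k\<in>K. measure_pmf (pmf_of_set {1..n}))) =
      ennreal ((\<Sum>z\<in>K \<rightarrow>\<^sub>E {1..n}. g z) / real n ^ card K)"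
proof -
  have S: "finite (K \<rightarrow>\<^sub>E {1..n})" "K \<rightarrow>\<^sub>E {1..n} \<noteq> {}"
    using K n by (auto intro: finite_PiE simp: PiE_eq_empty_iff)
  have "(\<integral>\<^sup>+z. ennreal (g z) \<partial>(\<Pi>\<^sub>M k\<in>K. measure_pmf (pmf_of_set {1..n}))) =
      (\<integral>\<^sup>+z. ennreal (g (restrict z K)) \<partial>measure_pmf (pmf_of_set (K \<rightarrow>\<^sub>E {1..n})))"
    unfolding PiM_uniform_eq[OF K n]
    by (rule nn_integral_distr) (auto intro!: measurable_PiM_nat K simp: space_PiM)
  also have "\<dots> = (\<integral>\<^sup>+z. ennreal (g z) \<partial>measure_pmf (pmf_of_set (K \<rightarrow>\<^sub>E {1..n})))"
    by (intro nn_integral_cong_AE, unfold AE_measure_pmf_iff set_pmf_of_set[OF S(2,1)]) (simp add: PiE_restrict)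
  also have "\<dots> = ennreal (\<integral>z. g z \<partial>measure_pmf (pmf_of_set (K \<rightarrow>\<^sub>E {1..n})))"
    by (intro nn_integral_eq_integral integrable_measure_pmf_finite AE_I2 g)
      (simp only: set_pmf_of_set[OF S(2,1)] S)
  also have "(\<integral>z. g z \<partial>measure_pmf (pmf_of_set (K \<rightarrow>\<^sub>E {1..n}))) = (\<Sum>z\<in>K \<rightarrow>\<^sub>E {1..n}. g z) / card (K \<rightarrow>\<^sub>E {1..n})"
    by (rule integral_pmf_of_set[OF S(2,1)])
  finally show ?thesis using K by (simp add: card_PiE)
qed

text \<open>
  The variance under the uniform distribution on \<open>{1..n}\<close>, in the form in which the two
  hypotheses on \<open>h1\<close> provide it.
\<close>

definition unif_var :: "nat \<Rightarrow> (nat \<Rightarrow> real) \<Rightarrow> real" where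
  "unif_var n g = (\<Sum>j=1..n. (g j)\<^sup>2) / n - ((\<Sum>j=1..n. g j) / n)\<^sup>2"

lemma unif_var_diff_const:
  assumes "1 \<le> n"
  shows "unif_var n (\<lambda>j. g j - c) = unif_var n g"
proof -
  have 1: "(\<Sum>j=1..n. g j - c) = (\<Sum>j=1..n. g j) - n * c" by (simp add: sum_subtractf)
  have 2: "(\<Sum>j=1..n. (g j - c)\<^sup>2) = (\<Sum>j=1..n. (g j)\<^sup>2) - 2 * c * (\<Sum>j=1..n. g j) + n * c\<^sup>2"
    by (simp add: power2_diff sum.distrib sum_subtractf sum_distrib_left mult_ac)
  show ?thesis unfolding unif_var_def 1 2 using assms
    by (simp add: field_simps power2_eq_square)
qed

lemma unif_var_eq_centered:
  assumes "1 \<le> n"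
  shows "unif_var n g = (\<Sum>j=1..n. (g j - (\<Sum>j=1..n. g j) / n)\<^sup>2) / n"
proof -
  have "unif_var n g = unif_var n (\<lambda>j. g j - (\<Sum>j=1..n. g j) / n)"
    by (rule unif_var_diff_const[OF assms, symmetric])
  also have "\<dots> = (\<Sum>j=1..n. (g j - (\<Sum>j=1..n. g j) / n)\<^sup>2) / n"
    using assms by (simp add: unif_var_def sum_subtractf)
  finally show ?thesis .
qed

text \<open>
  Young's inequality for the mixed term; \<open>\<delta>\<close> remains free.
\<close>

lemma abs_power2_add_diff_le:
  assumes "0 < \<delta>"
  shows "\<bar>(x + y)\<^sup>2 - x\<^sup>2\<bar> \<le> \<delta> * x\<^sup>2 + (1 + 1 / \<delta>) * (y::real)\<^sup>2"
proof -
  have "\<bar>2 * (x * y)\<bar> \<le> \<delta> * x\<^sup>2 + y\<^sup>2 / \<delta>"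
    using abs_mult_le_sum_squares[of "sqrt \<delta> * x" "y / sqrt \<delta>"] assms
    by (simp add: power_mult_distrib power_divide abs_mult)
  moreover have "\<bar>(x + y)\<^sup>2 - x\<^sup>2\<bar> \<le> \<bar>2 * (x * y)\<bar> + y\<^sup>2"
    by (simp add: power2_sum algebra_simps abs_triangle_ineq4) (smt (verit) zero_le_power2)
  ultimately show ?thesis by (simp add: algebra_simps)
qed

text \<open>
  The relative weight \<open>\<delta>\<close> goes to the main term, whose limit is known, at the price of a factor
  \<open>1 / \<delta>\<close> in front of the small one.
\<close>

lemma unif_var_perturb:
  assumes n: "1 \<le> n" and \<delta>: "0 < \<delta>"
  shows "\<bar>unif_var n (\<lambda>j. v j + w j) - unif_var n v\<bar> \<le> \<delta> * unif_var n v + (1 + 1 / \<delta>) * unif_var n w"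
proof -
  let ?v = "\<lambda>j. v j - (\<Sum>j=1..n. v j) / n" and ?w = "\<lambda>j. w j - (\<Sum>j=1..n. w j) / n"
  have "unif_var n (\<lambda>j. v j + w j) = (\<Sum>j=1..n. (?v j + ?w j)\<^sup>2) / n"
    unfolding unif_var_eq_centered[OF n] by (simp add: sum.distrib add_divide_distrib algebra_simps)
  then have "\<bar>unif_var n (\<lambda>j. v j + w j) - unif_var n v\<bar> = \<bar>\<Sum>j=1..n. (?v j + ?w j)\<^sup>2 - (?v j)\<^sup>2\<bar> / n"
    unfolding unif_var_eq_centered[OF n, of v] by (simp add: sum_subtractf diff_divide_distrib[symmetric])
  also have "\<dots> \<le> (\<Sum>j=1..n. \<delta> * (?v j)\<^sup>2 + (1 + 1 / \<delta>) * (?w j)\<^sup>2) / n"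
    by (intro divide_right_mono order_trans[OF sum_abs] sum_mono abs_power2_add_diff_le \<delta>) auto
  also have "\<dots> = \<delta> * unif_var n v + (1 + 1 / \<delta>) * unif_var n w"
    unfolding unif_var_eq_centered[OF n] sum.distrib sum_distrib_left[symmetric] by (simp add: add_divide_distrib)
  finally show ?thesis .
qed

lemma unif_var_le: "unif_var n g \<le> (\<Sum>j=1..n. (g j)\<^sup>2) / n"
  by (simp add: unif_var_def)

text \<open>
  The projection of the kernel under the law of the bootstrap sample given the data \<open>x\<close>: the
  \<open>p\<close>-th argument is \<open>x j\<close>, and the other ones are drawn from the empirical distribution.
\<close>

definition boot_proj :: "nat \<Rightarrow> nat \<Rightarrow> ((nat \<Rightarrow> 'x) \<Rightarrow> real) \<Rightarrow> (nat \<Rightarrow> 'x) \<Rightarrow> nat \<Rightarrow> nat \<Rightarrow> real" where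
  "boot_proj m n h x p j = (\<Sum>J\<in>{1..m} \<rightarrow>\<^sub>E {1..n}. h (at_indices m x (J(p := j)))) / real n ^ m"

abbreviation boot_sum ::
  "nat \<Rightarrow> nat \<Rightarrow> ((nat \<Rightarrow> nat) \<Rightarrow> real) \<Rightarrow> ((nat \<Rightarrow> 'x) \<Rightarrow> real) \<Rightarrow> (nat \<Rightarrow> 'x) \<Rightarrow> nat \<Rightarrow> nat \<Rightarrow> real" where
  "boot_sum m n a h x i j \<equiv> \<Sum>(r, p)\<in>incidences m n i. (tuple_weight m n * a r) * boot_proj m n h x p j"

text \<open>
  A bootstrap sample is the data evaluated at independent uniform indices. Given the data, the
  bootstrap statistic is therefore itself a weighted U-statistic of an independent sample of
  indices, and \<open>variance_wU_approx\<close> applies. The second moment of its kernel is the average of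
  \<open>h\<^sup>2\<close> over all tuples of observations.
\<close>

lemma bootstrap_variance_approx:
  assumes m: "2 \<le> m" "m \<le> n"
  shows "\<bar>bootstrap_variance n x (wU m n a h) -
      (\<Sum>i=1..n. unif_var n (boot_sum m n a h x i))\<bar>
    \<le> ((real m)\<^sup>2 + 1) * ((\<Sum>J\<in>{1..m} \<rightarrow>\<^sub>E {1..n}. (h (at_indices m x J))\<^sup>2) / real n ^ m) * overlap_mass 2 m n a"
proof -
  define Q where "Q = Pi_pmf {1..n} 0 (\<lambda>_. pmf_of_set {1..n})"
  \<comment> \<open>\<open>0\<close> lies outside \<open>{1..n}\<close>, and \<open>x'\<close> sends it to the default value of \<open>bootstrap_law\<close>\<close>
  define x' where "x' = x(0 := undefined)"
  define Y :: "nat \<Rightarrow> (nat \<Rightarrow> nat) \<Rightarrow> nat" where "Y = (\<lambda>i J. J i)"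
  define hx where "hx z = h (\<lambda>k\<in>{1..m}. x' (z k))" for z
  define B where "B = (\<Sum>J\<in>{1..m} \<rightarrow>\<^sub>E {1..n}. (h (at_indices m x J))\<^sup>2) / real n ^ m"
  have n: "1 \<le> n" using m by simp
  have hx: "hx J = h (at_indices m x J)" if "J \<in> {1..m} \<rightarrow>\<^sub>E {1..n}" for J
    unfolding hx_def at_indices_def x'_def using PiE_mem[OF that]
    by (intro arg_cong[of _ _ h] restrict_ext) fastforce
  have law: "distr (measure_pmf Q) (count_space UNIV) (Y i) = measure_pmf (pmf_of_set {1..n})"
    if "i \<in> {1..n}" for i
    unfolding map_pmf_rep_eq[symmetric] Y_def Q_def using that by (simp add: Pi_pmf_component)
  interpret Y: independent_sample "measure_pmf Q" "count_space UNIV" Y m n hx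
  proof
    show "prob_space.indep_vars (measure_pmf Q) (\<lambda>_. count_space UNIV) Y {1..n}"
      unfolding Q_def Y_def by (rule indep_vars_Pi_pmf) simp
    show "hx \<in> borel_measurable (\<Pi>\<^sub>M k\<in>{1..m}. count_space UNIV)"
      by (rule measurable_PiM_nat) auto
  qed (use m in auto)
  have avg: "(\<Sum>J\<in>{1..m} \<rightarrow>\<^sub>E {1..n}. (hx J)\<^sup>2) / real n ^ card {1..m} = B"
    unfolding B_def by (simp add: hx)
  interpret Y: bounded_sample "measure_pmf Q" "count_space UNIV" Y m n hx B
  proof
    show "0 \<le> B" by (simp add: B_def sum_nonneg)
    fix r assume r: "r \<in> distinct_tuples {1..n} m"
    have "(\<integral>\<^sup>+J. ennreal ((hx (at_indices m (\<lambda>j. Y j J) r))\<^sup>2) \<partial>measure_pmf Q) =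
        (\<integral>\<^sup>+z. ennreal ((hx z)\<^sup>2) \<partial>(\<Pi>\<^sub>M k\<in>{1..m}. Y.law (r k)))"
      by (rule Y.nn_integral_h_sq_distinct[OF r, symmetric])
    also have "(\<Pi>\<^sub>M k\<in>{1..m}. Y.law (r k)) = (\<Pi>\<^sub>M k\<in>{1..m}. measure_pmf (pmf_of_set {1..n}))"
      by (intro PiM_cong refl law distinct_tuplesD(4)[OF r])
    also have "(\<integral>\<^sup>+z. ennreal ((hx z)\<^sup>2) \<partial>(\<Pi>\<^sub>M k\<in>{1..m}. measure_pmf (pmf_of_set {1..n}))) = ennreal B"
      using m by (subst nn_integral_PiM_uniform) (auto simp: avg[simplified])
    finally show "(\<integral>\<^sup>+J. ennreal ((hx (at_indices m (\<lambda>j. Y j J) r))\<^sup>2) \<partial>measure_pmf Q) \<le> ennreal B" by simp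
  qed
  have proj: "Y.proj r p j = boot_proj m n h x p j"
    if r: "r \<in> distinct_tuples {1..n} m" and p: "p \<in> {1..m}" and j: "j \<in> {1..n}" for r p j
  proof -
    have rn: "k \<in> {1..m} \<Longrightarrow> r k \<in> {1..n}" for k by (rule distinct_tuplesD(4)[OF r])
    have "Y.proj r p j = (\<integral>z. hx (insert_at m p j z) \<partial>(\<Pi>\<^sub>M k\<in>{1..m - 1}. measure_pmf (pmf_of_set {1..n})))"
      unfolding Y.proj_eq
      by (intro arg_cong2[of _ _ _ _ "integral\<^sup>L"] PiM_cong refl law Y.drop_at_mem[OF p rn])
    also have "\<dots> = (\<Sum>z\<in>{1..m - 1} \<rightarrow>\<^sub>E {1..n}. hx (insert_at m p j z)) / real n ^ card {1..m - 1}"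
      by (rule integral_PiM_uniform) (use m n in auto)
    also have "\<dots> = (\<Sum>z\<in>{1..m - 1} \<rightarrow>\<^sub>E {1..n}. h (at_indices m x (insert_at m p j z))) / real n ^ (m - 1)"
      using hx[OF insert_at_PiE[OF p j]] by simp
    also have "\<dots> = boot_proj m n h x p j"
    proof -
      obtain m' where "m = Suc m'" using m by (cases m) auto
      then have "real n ^ m = real n * real n ^ (m - 1)" by simp
      then show ?thesis
        unfolding boot_proj_def
        using sum_PiE_fun_upd[OF p _ j, of "\<lambda>J. h (at_indices m x J)"] n by simp
    qed
    finally show ?thesis .
  qed
  have E: "measure_pmf.expectation Q (\<lambda>J. g (Y i J)) = (\<Sum>j=1..n. g j) / n" if i: "i \<in> {1..n}" for i and g :: "nat \<Rightarrow> real"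
  proof -
    have "measure_pmf.expectation Q (\<lambda>J. g (Y i J)) = (\<integral>j. g j \<partial>distr (measure_pmf Q) (count_space UNIV) (Y i))"
      by (rule integral_distr[symmetric]) auto
    also have "\<dots> = (\<Sum>j=1..n. g j) / n"
      unfolding law[OF i] using n by (subst integral_pmf_of_set) auto
    finally show ?thesis .
  qed
  have V: "measure_pmf.variance Q (\<lambda>J. g (Y i J)) = unif_var n g" if i: "i \<in> {1..n}" for i and g :: "nat \<Rightarrow> real"
  proof -
    have "measure_pmf.variance Q (\<lambda>J. g (Y i J)) = (\<Sum>j=1..n. (g j - (\<Sum>j=1..n. g j) / n)\<^sup>2) / n"
      unfolding E[OF i] by (rule E[OF i])
    also have "\<dots> = unif_var n (\<lambda>j. g j - (\<Sum>j=1..n. g j) / n)"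
      using n by (simp add: unif_var_def sum_subtractf)
    also have "\<dots> = unif_var n g" by (rule unif_var_diff_const[OF n])
    finally show ?thesis .
  qed
  have H: "measure_pmf.variance Q (\<lambda>J. Y.h1_at a i (Y i J) / real n) =
      unif_var n (boot_sum m n a h x i)"
    if i: "i \<in> {1..n}" for i
  proof -
    define d where "d = (\<Sum>(r, p)\<in>incidences m n i. (tuple_weight m n * a r) * \<theta> (measure_pmf Q) Y m hx r)"
    have "Y.h1_at a i j / real n = (boot_sum m n a h x i j) - d"
      if j: "j \<in> {1..n}" for j
      unfolding Y.h1_divide_n[OF i] d_def sum_subtractf[symmetric]
      by (intro sum.cong refl) (auto simp: incidences_def proj j[simplified] algebra_simps)
    then have "unif_var n (\<lambda>j. Y.h1_at a i j / real n) =
        unif_var n (\<lambda>j. (boot_sum m n a h x i j) - d)"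
      unfolding unif_var_def by simp
    then show ?thesis using V[OF i, of "\<lambda>j. Y.h1_at a i j / real n"] unif_var_diff_const[OF n] by simp
  qed
  have W: "bootstrap_variance n x (wU m n a h) = measure_pmf.variance Q (\<lambda>J. wU m n a hx (\<lambda>i. Y i J))"
  proof -
    have "map_pmf x (pmf_of_set {1..n}) = map_pmf x' (pmf_of_set {1..n})"
      using n by (intro map_pmf_cong refl) (auto simp: x'_def)
    then have law: "bootstrap_law n x = map_pmf (\<lambda>J. x' \<circ> J) Q"
      unfolding bootstrap_law_def empirical_def Q_def by (simp, intro Pi_pmf_map) (simp_all add: x'_def)
    have "wU m n a h (x' \<circ> J) = wU m n a hx (\<lambda>i. Y i J)" for J
      unfolding wU_def hx_def at_indices_def Y_def by (simp cong: restrict_cong)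
    then show ?thesis unfolding bootstrap_variance_def law by simp
  qed
  have HS: "(\<Sum>i=1..n. measure_pmf.variance Q (\<lambda>J. Y.h1_at a i (Y i J) / real n)) =
      (\<Sum>i=1..n. unif_var n (boot_sum m n a h x i))"
    by (rule sum.cong[OF refl H])
  have "\<bar>bootstrap_variance n x (wU m n a h) -
      (\<Sum>i=1..n. unif_var n (boot_sum m n a h x i))\<bar>
    \<le> ((real m)\<^sup>2 + 1) * B * overlap_mass 2 m n a"
    using Y.variance_wU_approx[of a] unfolding W HS .
  then show ?thesis unfolding B_def .
qed

lemma bootstrap_variance_divide:
  "bootstrap_variance n x (\<lambda>y. T y / c) = bootstrap_variance n x T / c\<^sup>2"
proof -
  have "(T y / c - E / c)\<^sup>2 = (T y - E)\<^sup>2 / c\<^sup>2" for y E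
    by (simp add: diff_divide_distrib[symmetric] power_divide)
  then show ?thesis by (simp add: bootstrap_variance_def)
qed

section \<open>The mean square error of the bootstrap projections\<close>

text \<open>
  Two moment bounds are distinguished on purpose: \<open>B\<close>, for distinct indices, enters the estimates
  without any power of \<open>1 / n\<close>, whereas \<open>C\<close>, which also covers repeated indices, is multiplied in
  all averages by a proportion of tuples of order \<open>1 / n\<close>. The number \<open>G\<close> stands for \<open>M2\<close>.
\<close>

locale heterogeneous_sample = bounded_sample +
  fixes C G :: real
  assumes m_ge_2: "2 \<le> m"
    and C_nonneg: "0 \<le> C" and G_nonneg: "0 \<le> G"
    and obs_le: "r \<in> {1..m} \<rightarrow>\<^sub>E {1..n} \<Longrightarrow>
      (\<integral>\<^sup>+\<omega>. ennreal ((h (at_indices m (\<lambda>j. X j \<omega>) r))\<^sup>2) \<partial>P) \<le> ennreal C"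
    and indep_le: "r \<in> {1..m} \<rightarrow>\<^sub>E {1..n} \<Longrightarrow>
      (\<integral>\<^sup>+x. ennreal ((h x)\<^sup>2) \<partial>(\<Pi>\<^sub>M k\<in>{1..m}. distr P N (X (r k)))) \<le> ennreal C"
    and exchange_le: "r \<in> distinct_tuples {1..n} m \<Longrightarrow> s \<in> distinct_tuples {1..n} m \<Longrightarrow>
      k \<in> distinct_tuples {1..n} m \<Longrightarrow> p \<in> {1..m} \<Longrightarrow> q \<in> {1..m} \<Longrightarrow>
      meet_only_at m r s p q \<Longrightarrow> meet_only_at m k s p q \<Longrightarrow>
      \<bar>(\<integral>\<omega>. h (at_indices m (\<lambda>j. X j \<omega>) r) * h (at_indices m (\<lambda>j. X j \<omega>) s) \<partial>P) -
       (\<integral>\<omega>. h (at_indices m (\<lambda>j. X j \<omega>) k) * h (at_indices m (\<lambda>j. X j \<omega>) s) \<partial>P)\<bar> \<le> G"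
begin

abbreviation "avg_obs_sq \<omega> \<equiv> (\<Sum>J\<in>tuples. (obs J \<omega>)\<^sup>2) / real n ^ m"

abbreviation "proj_moment r p j \<equiv> \<integral>\<omega>. (proj r p (X j \<omega>))\<^sup>2 \<partial>P"

lemma n_pos: "0 < n" using m_pos m_le by simp

lemma fun_upd_PiE: "J \<in> tuples \<Longrightarrow> p \<in> {1..m} \<Longrightarrow> j \<in> {1..n} \<Longrightarrow> J(p := j) \<in> tuples"
  using PiE_fun_upd[of j "\<lambda>_. {1..n}" p J "{1..m}"] by (simp add: insert_absorb)

lemma obs_C:
  assumes "r \<in> tuples"
  shows "square_integrable P (obs r)" "(\<integral>\<omega>. (obs r \<omega>)\<^sup>2 \<partial>P) \<le> C"
  using obs_square_integrable[OF assms obs_le[OF assms] C_nonneg] by auto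

lemma proj_C:
  assumes "r \<in> dtuples" "p \<in> {1..m}" "j \<in> {1..n}"
  shows "square_integrable P (\<lambda>\<omega>. proj r p (X j \<omega>))" "proj_moment r p j \<le> C"
  using proj_square_integrable[OF assms(2) distinct_tuplesD(1)[OF assms(1)] assms(3)
    indep_le[OF fun_upd_PiE[OF distinct_tuplesD(1)[OF assms(1)] assms(2,3)]] C_nonneg] by auto

definition proj_error :: "(nat \<Rightarrow> nat) \<Rightarrow> nat \<Rightarrow> nat \<Rightarrow> 'a \<Rightarrow> real" where
  "proj_error r p j \<omega> = boot_proj m n h (\<lambda>i. X i \<omega>) p j - proj r p (X j \<omega>)"

text \<open>
  The contribution of a single tuple \<open>J\<close> to \<open>proj_error\<close>, see \<open>proj_error_eq\<close>.
\<close>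

definition dev :: "(nat \<Rightarrow> nat) \<Rightarrow> nat \<Rightarrow> nat \<Rightarrow> (nat \<Rightarrow> nat) \<Rightarrow> 'a \<Rightarrow> real" where
  "dev r p j J \<omega> = obs (J(p := j)) \<omega> - proj r p (X j \<omega>)"

abbreviation "err_mean r p s q j \<equiv> \<integral>\<omega>. proj_error r p j \<omega> * proj_error s q j \<omega> \<partial>P"

abbreviation "dev_mean r p s q j J J' \<equiv> \<integral>\<omega>. dev r p j J \<omega> * dev s q j J' \<omega> \<partial>P"

lemma dev_square_integrable:
  assumes "r \<in> dtuples" "p \<in> {1..m}" "j \<in> {1..n}" "J \<in> tuples"
  shows "square_integrable P (dev r p j J)"
  unfolding dev_def
  by (intro square_integrable_diff obs_C proj_C fun_upd_PiE assms)

lemma integral_dev_sq_le: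
  assumes "r \<in> dtuples" "p \<in> {1..m}" "j \<in> {1..n}" "J \<in> tuples"
  shows "(\<integral>\<omega>. (dev r p j J \<omega>)\<^sup>2 \<partial>P) \<le>
    2 * (\<integral>\<omega>. (obs (J(p := j)) \<omega>)\<^sup>2 \<partial>P) + 2 * proj_moment r p j"
  unfolding dev_def
  by (intro integral_diff_sq_le obs_C proj_C fun_upd_PiE assms)

lemma proj_error_eq: "proj_error r p j \<omega> = (\<Sum>J\<in>tuples. dev r p j J \<omega>) / real n ^ m"
  using n_pos by (simp add: proj_error_def dev_def boot_proj_def sum_subtractf card_PiE diff_divide_distrib)

lemma proj_error_square_integrable:
  assumes "r \<in> dtuples" "p \<in> {1..m}" "j \<in> {1..n}"
  shows "square_integrable P (proj_error r p j)"
proof -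
  have "square_integrable P (\<lambda>\<omega>. 1 / real n ^ m * (\<Sum>J\<in>tuples. dev r p j J \<omega>))"
    by (intro square_integrable_cmult square_integrable_sum dev_square_integrable assms) (auto intro: finite_PiE)
  then show ?thesis unfolding proj_error_eq[abs_def] by simp
qed

lemma integral_proj_error_mult:
  assumes "r \<in> dtuples" "s \<in> dtuples" "p \<in> {1..m}" "q \<in> {1..m}" "j \<in> {1..n}"
  shows "err_mean r p s q j =
    (\<Sum>J\<in>tuples. \<Sum>J'\<in>tuples. dev_mean r p s q j J J') / (real n ^ m)\<^sup>2"
proof -
  have "err_mean r p s q j =
     (\<integral>\<omega>. (\<Sum>J\<in>tuples. \<Sum>J'\<in>tuples. dev r p j J \<omega> * dev s q j J' \<omega>) / (real n ^ m)\<^sup>2 \<partial>P)"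
    by (simp add: proj_error_eq sum_product power2_eq_square)
  also have "\<dots> = (\<integral>\<omega>. (\<Sum>J\<in>tuples. \<Sum>J'\<in>tuples. dev r p j J \<omega> * dev s q j J' \<omega>) \<partial>P) / (real n ^ m)\<^sup>2"
    by simp
  also have "(\<integral>\<omega>. (\<Sum>J\<in>tuples. \<Sum>J'\<in>tuples. dev r p j J \<omega> * dev s q j J' \<omega>) \<partial>P) =
      (\<Sum>J\<in>tuples. \<Sum>J'\<in>tuples. dev_mean r p s q j J J')"
    by (subst Bochner_Integration.integral_sum)
      (intro Bochner_Integration.integrable_sum square_integrable_mult dev_square_integrable assms sum.cong refl
        Bochner_Integration.integral_sum; assumption)+
  finally show ?thesis .
qed

lemma abs_integral_dev_le:
  assumes r: "r \<in> dtuples" and s: "s \<in> dtuples"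
    and p: "p \<in> {1..m}" and q: "q \<in> {1..m}" and j: "j \<in> {1..n}"
    and J: "J \<in> tuples" and J': "J' \<in> tuples"
  shows "\<bar>dev_mean r p s q j J J'\<bar> \<le> 4 * C"
proof -
  have 1: "(\<integral>\<omega>. (dev r p j J \<omega>)\<^sup>2 \<partial>P) \<le> 4 * C"
    if "r \<in> dtuples" "p \<in> {1..m}" "J \<in> tuples" for r p J
    using integral_dev_sq_le[OF that(1,2) j that(3)] obs_C(2)[OF fun_upd_PiE[OF that(3,2) j]] proj_C(2)[OF that(1,2) j]
    by linarith
  show ?thesis
    using abs_integral_mult_le[OF dev_square_integrable[OF r p j J] dev_square_integrable[OF s q j J']]
      1[OF r p J] 1[OF s q J'] by argo
qed

text \<open>
  All the indices involved are different, except that each of the tuples \<open>J(p := j)\<close>, \<open>r(p := j)\<close> meets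
  each of \<open>J'(q := j)\<close>, \<open>s(q := j)\<close> in \<open>j\<close>. Hence every projection in the product may be replaced by the
  kernel itself, and the expectation becomes an alternating sum of four moments in which \<open>J\<close> and \<open>r\<close>
  are exchanged twice.
\<close>

lemma abs_integral_dev_generic_le:
  assumes r: "r \<in> dtuples" and s: "s \<in> dtuples"
    and p: "p \<in> {1..m}" and q: "q \<in> {1..m}" and j: "j \<in> {1..n}"
    and J: "J \<in> tuples" and J': "J' \<in> tuples"
    and meet: "meet_only_at m r s p q"
    and jR: "j \<notin> r ` {1..m} \<union> s ` {1..m}"
    and gJ: "generic m J (insert j (r ` {1..m} \<union> s ` {1..m}))"
    and gJ': "generic m J' (J ` {1..m} \<union> insert j (r ` {1..m} \<union> s ` {1..m}))"
  shows "\<bar>dev_mean r p s q j J J'\<bar> \<le> 2 * G"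
proof -
  let ?r1 = "J(p := j)" and ?s1 = "J'(q := j)" and ?r = "r(p := j)" and ?s = "s(q := j)"
  have sub: "u ` ({1..m} - {l}) \<subseteq> u ` {1..m}" for u :: "nat \<Rightarrow> nat" and l by auto
  have DJ: "J \<in> dtuples" "J' \<in> dtuples"
    using J J' gJ gJ' by (auto simp: distinct_tuples_def generic_def)
  have jJ: "j \<notin> J ` {1..m}" and jJ': "j \<notin> J' ` {1..m}" using gJ gJ' by (auto simp: generic_def)
  have D: "?r1 \<in> dtuples" "?s1 \<in> dtuples"
      "?r \<in> dtuples" "?s \<in> dtuples"
    using jR jJ jJ' sub by (intro distinct_tuples_fun_upd DJ r s p q j; blast)+
  have rs: "r ` ({1..m} - {p}) \<inter> s ` ({1..m} - {q}) = {}"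
    using meet unfolding distinct_Diff_image[OF r p] distinct_Diff_image[OF s q] meet_only_at_def by blast
  have JJ': "J ` {1..m} \<inter> J' ` {1..m} = {}" and Js: "J ` {1..m} \<inter> s ` {1..m} = {}" and J'r: "r ` {1..m} \<inter> J' ` {1..m} = {}"
    using gJ gJ' unfolding generic_def by blast+
  have disj: "A' \<inter> B' = {}" if "A \<inter> B = {}" "A' \<subseteq> A" "B' \<subseteq> B" for A B A' B' :: "nat set"
    using that by blast
  have jr: "j \<notin> r ` ({1..m} - {p})" "j \<notin> s ` ({1..m} - {q})" "j \<notin> J ` ({1..m} - {p})" "j \<notin> J' ` ({1..m} - {q})"
    using jR jJ jJ' by blast+
  note upd = meet_only_at_fun_upd[OF p q]
  have M: "meet_only_at m ?r1 ?s1 p q" "meet_only_at m ?r1 ?s p q" "meet_only_at m ?r ?s1 p q" "meet_only_at m ?r ?s p q"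
    using upd[OF disj[OF JJ' sub sub] jr(3,4)] upd[OF disj[OF Js sub sub] jr(3,2)]
      upd[OF disj[OF J'r sub sub] jr(1,4)] upd[OF rs jr(1,2)] by blast+
  define F where "F \<omega> = proj r p (X j \<omega>)" for \<omega>
  define H where "H \<omega> = proj s q (X j \<omega>)" for \<omega>
  have F: "F = (\<lambda>\<omega>. proj ?r p (X (?r p) \<omega>))" and H: "H = (\<lambda>\<omega>. proj ?s q (X (?s q) \<omega>))"
    by (simp_all add: F_def H_def fun_eq_iff coord_proj_def drop_at_fun_upd)
  have sq: "square_integrable P F" "square_integrable P H" "square_integrable P (obs ?r1)" "square_integrable P (obs ?s1)"
    unfolding F_def H_def by (intro proj_C r s p q j obs_sq D)+
  have "dev_mean r p s q j J J' =
      (\<integral>\<omega>. obs ?r1 \<omega> * obs ?s1 \<omega> - obs ?r1 \<omega> * H \<omega> - F \<omega> * obs ?s1 \<omega> + F \<omega> * H \<omega> \<partial>P)"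
    by (simp add: dev_def F_def H_def algebra_simps)
  also have "\<dots> = obs_mean ?r1 ?s1 - (\<integral>\<omega>. obs ?r1 \<omega> * H \<omega> \<partial>P)
      - (\<integral>\<omega>. F \<omega> * obs ?s1 \<omega> \<partial>P) + (\<integral>\<omega>. F \<omega> * H \<omega> \<partial>P)"
    using square_integrable_mult[OF sq(3,4)] square_integrable_mult[OF sq(3,2)]
      square_integrable_mult[OF sq(1,4)] square_integrable_mult[OF sq(1,2)] by simp
  also have "(\<integral>\<omega>. obs ?r1 \<omega> * H \<omega> \<partial>P) = obs_mean ?r1 ?s"
    unfolding H by (rule integral_mult_meet_only_at(1)[OF D(1,4) p q M(2), symmetric])
  also have "(\<integral>\<omega>. F \<omega> * obs ?s1 \<omega> \<partial>P) = obs_mean ?r ?s1"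
    unfolding F using integral_mult_meet_only_at(1)[OF D(2,3) q p meet_only_at_sym[OF M(3)]]
    by (simp add: mult.commute)
  also have "(\<integral>\<omega>. F \<omega> * H \<omega> \<partial>P) = obs_mean ?r ?s"
    unfolding F H by (rule integral_mult_meet_only_at(2)[OF D(3,4) p q M(4), symmetric])
  finally show ?thesis
    using exchange_le[OF D(1,2,3) p q M(1,3)] exchange_le[OF D(1,4,3) p q M(2,4)] by linarith
qed

text \<open>
  The indices \<open>j\<close>, \<open>J\<close>, \<open>J'\<close> are chosen one after the other, each avoiding the previous ones and the
  tuples \<open>r\<close>, \<open>s\<close>. The three proportions of failures, at most \<open>2 m / n\<close>, \<open>m (3 m + 1) / n\<close> and
  \<open>m (4 m + 1) / n\<close>, add up to \<open>m (7 m + 4) / n\<close>.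
\<close>

lemma avg_proj_error_meet_le:
  assumes r: "r \<in> dtuples" and s: "s \<in> dtuples"
    and p: "p \<in> {1..m}" and q: "q \<in> {1..m}" and meet: "meet_only_at m r s p q"
  shows "\<bar>(\<Sum>j=1..n. err_mean r p s q j) / n\<bar>
    \<le> 2 * G + 4 * C * (real m * (7 * m + 4)) / n"
proof -
  let ?E = "tuples"
  let ?N = "real n ^ m"
  let ?R = "r ` {1..m} \<union> s ` {1..m}"
  have fE: "finite ?E" by (auto intro: finite_PiE)
  have cE: "real (card ?E) = ?N" by (simp add: card_PiE)
  have N: "0 < ?N" using n_pos by simp
  have cR: "card ?R \<le> 2 * m" "finite ?R"
    using card_Un_le[of "r ` {1..m}" "s ` {1..m}"] card_image_atLeastAtMost_le[of r m] card_image_atLeastAtMost_le[of s m] by auto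
  have T: "\<bar>dev_mean r p s q j J J'\<bar> \<le> 2 * G + 4 * C * (of_bool (j \<in> ?R) +
      of_bool (\<not> generic m J (insert j ?R)) + of_bool (\<not> generic m J' (J ` {1..m} \<union> insert j ?R)))"
    if "j \<in> {1..n}" "J \<in> ?E" "J' \<in> ?E" for j J J'
  proof (cases "j \<notin> ?R \<and> generic m J (insert j ?R) \<and> generic m J' (J ` {1..m} \<union> insert j ?R)")
    case True
    then have "\<bar>dev_mean r p s q j J J'\<bar> \<le> 2 * G"
      by (intro abs_integral_dev_generic_le r s p q that meet) blast+
    then show ?thesis using True by simp
  next
    case False
    then have "1 \<le> (of_bool (j \<in> ?R) + of_bool (\<not> generic m J (insert j ?R)) +
        of_bool (\<not> generic m J' (J ` {1..m} \<union> insert j ?R)) :: real)"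
      by (cases "j \<in> ?R"; cases "generic m J (insert j ?R)"; cases "generic m J' (J ` {1..m} \<union> insert j ?R)"; simp)
    then have "4 * C * 1 \<le> 4 * C * (of_bool (j \<in> ?R) + of_bool (\<not> generic m J (insert j ?R)) +
        of_bool (\<not> generic m J' (J ` {1..m} \<union> insert j ?R)))"
      using C_nonneg by (intro mult_left_mono) auto
    then show ?thesis using abs_integral_dev_le[OF r s p q that] G_nonneg by linarith
  qed
  have avgJ': "(\<Sum>J'\<in>?E. of_bool (\<not> generic m J' (J ` {1..m} \<union> insert j ?R))) / ?N \<le> real m * (4 * m + 1) / n" for j J
  proof -
    have "card (J ` {1..m} \<union> insert j ?R) \<le> 3 * m + 1"
      using card_Un_le[of "J ` {1..m}" "insert j ?R"] card_insert_le_m1[of "2 * m + 1" ?R j]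
        card_image_atLeastAtMost_le[of J m] cR by simp
    from sum_nongeneric_le[OF _ this n_pos, of m] cR(2) show ?thesis by (simp add: algebra_simps)
  qed
  have avgJ: "(\<Sum>J\<in>?E. of_bool (\<not> generic m J (insert j ?R))) / ?N \<le> real m * (3 * m + 1) / n" for j
  proof -
    have "card (insert j ?R) \<le> 2 * m + 1" using card_insert_le_m1[of "2 * m + 1" ?R j] cR by simp
    from sum_nongeneric_le[OF _ this n_pos, of m] cR(2) show ?thesis by (simp add: algebra_simps)
  qed
  have E: "\<bar>err_mean r p s q j\<bar>
      \<le> 2 * G + 4 * C * (of_bool (j \<in> ?R) + real m * (3 * m + 1) / n + real m * (4 * m + 1) / n)"
    if j: "j \<in> {1..n}" for j
  proof -
    let ?b = "of_bool (j \<in> ?R) :: real"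
    let ?g = "\<lambda>J. of_bool (\<not> generic m J (insert j ?R)) :: real"
    let ?g' = "\<lambda>J J'. of_bool (\<not> generic m J' (J ` {1..m} \<union> insert j ?R)) :: real"
    have "\<bar>err_mean r p s q j\<bar> \<le>
      (\<Sum>J\<in>?E. \<Sum>J'\<in>?E. \<bar>dev_mean r p s q j J J'\<bar>) / ?N\<^sup>2"
      unfolding integral_proj_error_mult[OF r s p q j] abs_divide
      by (simp, intro divide_right_mono order_trans[OF sum_abs] sum_mono sum_abs) simp
    also have "\<dots> \<le> (\<Sum>J\<in>?E. \<Sum>J'\<in>?E. 2 * G + 4 * C * (?b + ?g J + ?g' J J')) / ?N\<^sup>2"
      by (intro divide_right_mono sum_mono T j) auto
    also have "\<dots> = (\<Sum>J\<in>?E. (2 * G + 4 * C * (?b + ?g J + (\<Sum>J'\<in>?E. ?g' J J') / ?N))) / ?N"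
    proof -
      have "(\<Sum>J'\<in>?E. 2 * G + 4 * C * (?b + ?g J + ?g' J J')) =
          ?N * (2 * G + 4 * C * (?b + ?g J + (\<Sum>J'\<in>?E. ?g' J J') / ?N))" for J
        using N cE by (simp only: sum.distrib sum_distrib_left[symmetric] sum_constant) (simp add: field_simps)
      then show ?thesis using N by (simp only: sum_distrib_left[symmetric]) (simp add: power2_eq_square)
    qed
    also have "\<dots> \<le> (\<Sum>J\<in>?E. (2 * G + 4 * C * (?b + ?g J + real m * (4 * m + 1) / n))) / ?N"
      using N C_nonneg avgJ' by (intro divide_right_mono sum_mono add_left_mono mult_left_mono) auto
    also have "\<dots> = 2 * G + 4 * C * (?b + (\<Sum>J\<in>?E. ?g J) / ?N + real m * (4 * m + 1) / n)"
      using N cE by (simp only: sum.distrib sum_distrib_left[symmetric] sum_constant) (simp add: field_simps)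
    also have "\<dots> \<le> 2 * G + 4 * C * (?b + real m * (3 * m + 1) / n + real m * (4 * m + 1) / n)"
      using C_nonneg avgJ by (intro add_left_mono mult_left_mono add_right_mono) auto
    finally show ?thesis .
  qed
  have b: "(\<Sum>j=1..n. of_bool (j \<in> ?R)) \<le> (2 * m :: real)"
  proof -
    have "(\<Sum>j=1..n. of_bool (j \<in> ?R)) = real (card ({1..n} \<inter> ?R))"
      by (simp only: of_bool_def sum.If_cases finite_atLeastAtMost Collect_mem_eq) simp
    also have "card ({1..n} \<inter> ?R) \<le> card ?R" by (intro card_mono cR) auto
    finally show ?thesis using cR(1) by simp
  qed
  have "\<bar>(\<Sum>j=1..n. err_mean r p s q j) / n\<bar> \<le>
      (\<Sum>j=1..n. 2 * G + 4 * C * (of_bool (j \<in> ?R) + real m * (3 * m + 1) / n + real m * (4 * m + 1) / n)) / n"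
  proof -
    have "\<bar>\<Sum>j=1..n. err_mean r p s q j\<bar> \<le>
      (\<Sum>j=1..n. 2 * G + 4 * C * (of_bool (j \<in> ?R) + real m * (3 * m + 1) / n + real m * (4 * m + 1) / n))"
      by (intro order_trans[OF sum_abs] sum_mono E)
    from divide_right_mono[OF this, of "real n"] show ?thesis by (simp only: abs_divide abs_of_nat of_nat_0_le_iff)
  qed
  also have "\<dots> = 2 * G + 4 * C * ((\<Sum>j=1..n. of_bool (j \<in> ?R)) / n + real m * (3 * m + 1) / n + real m * (4 * m + 1) / n)"
    using n_pos by (simp only: sum.distrib sum_distrib_left[symmetric] sum_constant) (simp add: field_simps)
  also have "\<dots> \<le> 2 * G + 4 * C * ((2 * m) / n + real m * (3 * m + 1) / n + real m * (4 * m + 1) / n)"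
    using C_nonneg b n_pos by (intro add_left_mono mult_left_mono add_right_mono divide_right_mono) auto
  also have "\<dots> = 2 * G + 4 * C * (real m * (7 * m + 4)) / n"
    using n_pos by (simp add: field_simps)
  finally show ?thesis .
qed

lemma avg_integral_dev_sq_le:
  assumes r: "r \<in> dtuples" and p: "p \<in> {1..m}" and j: "j \<in> {1..n}"
  shows "(\<Sum>J\<in>tuples. \<integral>\<omega>. (dev r p j J \<omega>)\<^sup>2 \<partial>P) / real n ^ m
    \<le> 2 * (B + C * (real m * (m + 1) / n)) + 2 * proj_moment r p j"
proof -
  let ?E = "tuples"
  let ?N = "real n ^ m"
  let ?v = "proj_moment r p j"
  have cE: "real (card ?E) = ?N" by (simp add: card_PiE)
  have N: "0 < ?N" using n_pos by simp
  have obs: "(\<integral>\<omega>. (obs (J(p := j)) \<omega>)\<^sup>2 \<partial>P) \<le> B + C * of_bool (\<not> generic m J {j})" if J: "J \<in> ?E" for J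
  proof (cases "generic m J {j}")
    case True
    then have "J \<in> dtuples" "j \<notin> J ` {1..m}"
      using J by (auto simp: generic_def distinct_tuples_def)
    then have "J(p := j) \<in> dtuples" using p j by (intro distinct_tuples_fun_upd) blast+
    from obs_sq(2)[OF this] show ?thesis using True by simp
  next
    case False
    then show ?thesis using obs_C(2)[OF fun_upd_PiE[OF J p j]] B_nonneg by simp
  qed
  have "(\<Sum>J\<in>?E. \<integral>\<omega>. (dev r p j J \<omega>)\<^sup>2 \<partial>P) / ?N \<le>
      (\<Sum>J\<in>?E. 2 * B + 2 * ?v + 2 * C * of_bool (\<not> generic m J {j})) / ?N"
  proof (intro divide_right_mono sum_mono)
    fix J assume J: "J \<in> ?E"
    show "(\<integral>\<omega>. (dev r p j J \<omega>)\<^sup>2 \<partial>P) \<le> 2 * B + 2 * ?v + 2 * C * of_bool (\<not> generic m J {j})"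
      using integral_dev_sq_le[OF r p j J] obs[OF J] by linarith
  qed (use N in simp)
  also have "\<dots> = 2 * B + 2 * ?v + 2 * C * ((\<Sum>J\<in>?E. of_bool (\<not> generic m J {j})) / ?N)"
    using N cE by (simp only: sum.distrib sum_distrib_left[symmetric] sum_constant) (simp add: field_simps)
  also have "\<dots> \<le> 2 * B + 2 * ?v + 2 * C * (real m * (m + 1) / n)"
    using C_nonneg sum_nongeneric_le[of "{j}" 1 n m] n_pos
    by (intro add_left_mono mult_left_mono) (auto simp: add.commute)
  finally show ?thesis by (simp add: algebra_simps)
qed

lemma avg_integral_proj_sq_le:
  assumes r: "r \<in> dtuples" and p: "p \<in> {1..m}"
  shows "(\<Sum>j=1..n. proj_moment r p j) / n \<le> B + C * m / n"
proof -
  let ?R = "r ` {1..m}"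
  have "proj_moment r p j \<le> B + C * of_bool (j \<in> ?R)" if j: "j \<in> {1..n}" for j
  proof (cases "j \<in> ?R")
    case True then show ?thesis using proj_C(2)[OF r p j] B_nonneg by simp
  next
    case False
    then have "r(p := j) \<in> dtuples" by (intro distinct_tuples_fun_upd r p j) blast
    from proj_sq(2)[OF r p j this] show ?thesis using False by simp
  qed
  then have "(\<Sum>j=1..n. proj_moment r p j) / n \<le> (\<Sum>j=1..n. B + C * of_bool (j \<in> ?R)) / n"
    by (intro divide_right_mono sum_mono) auto
  also have "\<dots> = B + C * (\<Sum>j=1..n. of_bool (j \<in> ?R)) / n"
    using n_pos by (simp only: sum.distrib sum_distrib_left[symmetric] sum_constant) (simp add: field_simps)
  also have "(\<Sum>j=1..n. of_bool (j \<in> ?R)) = real (card ({1..n} \<inter> ?R))"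
    by (simp only: of_bool_def sum.If_cases finite_atLeastAtMost Collect_mem_eq) simp
  also have "B + C * real (card ({1..n} \<inter> ?R)) / n \<le> B + C * m / n"
  proof (intro add_left_mono divide_right_mono mult_left_mono C_nonneg)
    have "card ({1..n} \<inter> ?R) \<le> card ?R" by (intro card_mono) auto
    then show "real (card ({1..n} \<inter> ?R)) \<le> real m" using card_image_atLeastAtMost_le[of r m] by simp
  qed simp
  finally show ?thesis .
qed

lemma abs_integral_proj_error_le:
  assumes "r \<in> dtuples" "s \<in> dtuples" "p \<in> {1..m}" "q \<in> {1..m}" "j \<in> {1..n}"
  shows "\<bar>err_mean r p s q j\<bar> \<le>
    ((\<Sum>J\<in>tuples. \<integral>\<omega>. (dev r p j J \<omega>)\<^sup>2 \<partial>P) / real n ^ m +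
     (\<Sum>J\<in>tuples. \<integral>\<omega>. (dev s q j J \<omega>)\<^sup>2 \<partial>P) / real n ^ m) / 2"
proof -
  let ?E = "tuples"
  let ?N = "real n ^ m"
  have cE: "real (card ?E) = ?N" by (simp add: card_PiE)
  have N: "0 < ?N" using n_pos by simp
  let ?f = "\<lambda>J. \<integral>\<omega>. (dev r p j J \<omega>)\<^sup>2 \<partial>P" and ?g = "\<lambda>J. \<integral>\<omega>. (dev s q j J \<omega>)\<^sup>2 \<partial>P"
  have "\<bar>err_mean r p s q j\<bar> \<le>
      (\<Sum>J\<in>?E. \<Sum>J'\<in>?E. \<bar>dev_mean r p s q j J J'\<bar>) / ?N\<^sup>2"
    unfolding integral_proj_error_mult[OF assms] abs_divide
    by (simp, intro divide_right_mono order_trans[OF sum_abs] sum_mono sum_abs) simp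
  also have "\<dots> \<le> (\<Sum>J\<in>?E. \<Sum>J'\<in>?E. (?f J + ?g J') / 2) / ?N\<^sup>2"
    by (intro divide_right_mono sum_mono abs_integral_mult_le dev_square_integrable assms) auto
  also have "(\<Sum>J\<in>?E. \<Sum>J'\<in>?E. (?f J + ?g J') / 2) = (?N * sum ?f ?E + ?N * sum ?g ?E) / 2"
    using cE by (simp only: sum_divide_distrib[symmetric] sum.distrib sum_distrib_left[symmetric] sum_constant)
  also have "\<dots> / ?N\<^sup>2 = (sum ?f ?E / ?N + sum ?g ?E / ?N) / 2"
    using N by (simp add: field_simps power2_eq_square)
  finally show ?thesis .
qed

text \<open>
  The bound for pairs with several common indices. Here the moments \<open>B\<close> are not small, but such pairs
  carry little weight.
\<close>

lemma avg_proj_error_le: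
  assumes r: "r \<in> dtuples" and s: "s \<in> dtuples"
    and p: "p \<in> {1..m}" and q: "q \<in> {1..m}"
  shows "\<bar>(\<Sum>j=1..n. err_mean r p s q j) / n\<bar>
    \<le> 4 * B + 2 * C * (real m * (m + 2)) / n"
proof -
  let ?f = "\<lambda>j. proj_moment r p j" and ?g = "\<lambda>j. proj_moment s q j"
  let ?k = "2 * (B + C * (real m * (m + 1) / n))"
  have "\<bar>(\<Sum>j=1..n. err_mean r p s q j) / n\<bar> \<le>
      (\<Sum>j=1..n. ?k + ?f j + ?g j) / n"
  proof -
    have "\<bar>err_mean r p s q j\<bar> \<le> ?k + ?f j + ?g j" if j: "j \<in> {1..n}" for j
      using abs_integral_proj_error_le[OF assms j] avg_integral_dev_sq_le[OF r p j] avg_integral_dev_sq_le[OF s q j]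
      by argo
    then show ?thesis unfolding abs_divide
      by (simp, intro divide_right_mono order_trans[OF sum_abs] sum_mono) auto
  qed
  also have "\<dots> = ?k + (\<Sum>j=1..n. ?f j) / n + (\<Sum>j=1..n. ?g j) / n"
    using n_pos by (simp add: sum.distrib add_divide_distrib)
  also have "\<dots> \<le> ?k + (B + C * m / n) + (B + C * m / n)"
    by (intro add_mono avg_integral_proj_sq_le assms order_refl)
  also have "\<dots> = 4 * B + 2 * C * (real m * (m + 2)) / n"
    using n_pos by (simp add: field_simps)
  finally show ?thesis .
qed

text \<open>
  The mean square distance between the sums of weighted projections in \<open>h1\<close> and their bootstrap
  counterparts, summed over \<open>i\<close>.
\<close>

definition total_error :: "((nat \<Rightarrow> nat) \<Rightarrow> real) \<Rightarrow> 'a \<Rightarrow> real" where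
  "total_error a \<omega> = (\<Sum>i=1..n. (\<Sum>j=1..n.
     (\<Sum>(r, p)\<in>incidences m n i. (tuple_weight m n * a r) * proj_error r p j \<omega>)\<^sup>2) / n)"

text \<open>
  After expanding the squares, a pair of tuples with one common index contributes at most the bound of
  \<open>avg_proj_error_meet_le\<close>, and a pair with several the bound of \<open>avg_proj_error_le\<close> for each of its
  at most \<open>m\<^sup>2\<close> coincidences.
\<close>

lemma integrable_total_error: "integrable P (total_error a)"
  and integral_total_error_le: "(\<integral>\<omega>. total_error a \<omega> \<partial>P) \<le>
    (2 * G + 4 * C * (real m * (7 * m + 4)) / n) * overlap_mass 1 m n a +
    ((real m)\<^sup>2 * (4 * B + 2 * C * (real m * (m + 2)) / n)) * overlap_mass 2 m n a"
proof -
  let ?c = "tuple_weight m n" and ?D = "dtuples"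
  let ?w = "\<lambda>x. ?c * a (fst x)"
  let ?e = "\<lambda>j x. proj_error (fst x) (snd x) j"
  let ?I = "\<lambda>j x y. \<integral>\<omega>. ?e j x \<omega> * ?e j y \<omega> \<partial>P"
  have sq: "square_integrable P (?e j x)" if "x \<in> incidences m n i" "j \<in> {1..n}" for x i j
    using that by (intro proj_error_square_integrable) (auto simp: incidences_def)
  have te: "total_error a = (\<lambda>\<omega>. \<Sum>i=1..n. (\<Sum>j=1..n. (\<Sum>x\<in>incidences m n i. ?w x * ?e j x \<omega>)\<^sup>2) / n)"
    by (simp add: total_error_def fun_eq_iff case_prod_beta)
  have int: "integrable P (\<lambda>\<omega>. (\<Sum>x\<in>incidences m n i. ?w x * ?e j x \<omega>)\<^sup>2)" if "j \<in> {1..n}" for i j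
  proof -
    have "square_integrable P (\<lambda>\<omega>. \<Sum>x\<in>incidences m n i. ?w x * ?e j x \<omega>)"
      by (intro square_integrable_sum square_integrable_cmult sq that) auto
    then show ?thesis by (simp add: square_integrable_def)
  qed
  show "integrable P (total_error a)" unfolding te
    by (intro Bochner_Integration.integrable_sum Bochner_Integration.integrable_divide int)
  define Z where "Z r s p q = (\<Sum>j=1..n. err_mean r p s q j) / n" for r s p q
  have "(\<integral>\<omega>. total_error a \<omega> \<partial>P) = (\<Sum>i=1..n. (\<Sum>j=1..n. (\<integral>\<omega>. (\<Sum>x\<in>incidences m n i. ?w x * ?e j x \<omega>)\<^sup>2 \<partial>P)) / n)"
  proof -
    have "(\<integral>\<omega>. total_error a \<omega> \<partial>P) = (\<Sum>i=1..n. \<integral>\<omega>. (\<Sum>j=1..n. (\<Sum>x\<in>incidences m n i. ?w x * ?e j x \<omega>)\<^sup>2) / n \<partial>P)"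
      unfolding te by (intro Bochner_Integration.integral_sum Bochner_Integration.integrable_sum
        Bochner_Integration.integrable_divide int)
    also have "\<dots> = (\<Sum>i=1..n. (\<Sum>j=1..n. (\<integral>\<omega>. (\<Sum>x\<in>incidences m n i. ?w x * ?e j x \<omega>)\<^sup>2 \<partial>P)) / n)"
      using int by (intro sum.cong refl) (simp add: Bochner_Integration.integral_sum)
    finally show ?thesis .
  qed
  also have "\<dots> = (\<Sum>i=1..n. (\<Sum>j=1..n. \<Sum>x\<in>incidences m n i. \<Sum>y\<in>incidences m n i. ?w x * ?w y * ?I j x y) / n)"
    by (intro sum.cong refl arg_cong2[of _ _ _ _ "(/)"] integral_sum_power2 sq) auto
  also have "\<dots> = (\<Sum>i=1..n. \<Sum>x\<in>incidences m n i. \<Sum>y\<in>incidences m n i. ?w x * ?w y * Z (fst x) (fst y) (snd x) (snd y))"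
  proof (rule sum.cong[OF refl])
    fix i
    have "(\<Sum>j=1..n. \<Sum>x\<in>incidences m n i. \<Sum>y\<in>incidences m n i. ?w x * ?w y * ?I j x y) =
        (\<Sum>x\<in>incidences m n i. \<Sum>y\<in>incidences m n i. \<Sum>j=1..n. ?w x * ?w y * ?I j x y)"
      by (subst sum.swap, rule sum.cong[OF refl], rule sum.swap)
    then show "(\<Sum>j=1..n. \<Sum>x\<in>incidences m n i. \<Sum>y\<in>incidences m n i. ?w x * ?w y * ?I j x y) / n =
        (\<Sum>x\<in>incidences m n i. \<Sum>y\<in>incidences m n i. ?w x * ?w y * Z (fst x) (fst y) (snd x) (snd y))"
      unfolding Z_def by (simp add: sum_divide_distrib sum_distrib_left)
  qed
  also have "\<dots> = (\<Sum>r\<in>?D. \<Sum>s\<in>?D. \<Sum>p\<in>{1..m}. \<Sum>q\<in>{1..m}. if r p = s q then (?c * a r) * (?c * a s) * Z r s p q else 0)"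
    unfolding sum_incidences by (simp only: fst_conv snd_conv)
  also have "\<dots> = ?c\<^sup>2 * (\<Sum>r\<in>?D. \<Sum>s\<in>?D. a r * a s * (\<Sum>p\<in>{1..m}. \<Sum>q\<in>{1..m}. if r p = s q then Z r s p q else 0))"
    unfolding sum_distrib_left by (intro sum.cong refl) (simp add: power2_eq_square)
  also have "\<dots> \<le> \<bar>\<dots>\<bar>" by (rule abs_ge_self)
  also have "\<dots> \<le> (2 * G + 4 * C * (real m * (7 * m + 4)) / n) * overlap_mass 1 m n a +
    ((real m)\<^sup>2 * (4 * B + 2 * C * (real m * (m + 2)) / n)) * overlap_mass 2 m n a"
  proof (rule overlap_sum_bound)
    fix r s assume rs: "r \<in> ?D" "s \<in> ?D"
    show "(\<Sum>p\<in>{1..m}. \<Sum>q\<in>{1..m}. if r p = s q then Z r s p q else 0) = 0" if "r ` {1..m} \<inter> s ` {1..m} = {}"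
      by (rule sum_matches_disjoint[OF that])
    show "\<bar>\<Sum>p\<in>{1..m}. \<Sum>q\<in>{1..m}. if r p = s q then Z r s p q else 0\<bar> \<le> 2 * G + 4 * C * (real m * (7 * m + 4)) / n"
      if "p \<in> {1..m}" "q \<in> {1..m}" "meet_only_at m r s p q" for p q
      using avg_proj_error_meet_le[OF rs that] sum_matches_meet_only_at[OF rs that, of "Z r s"]
      unfolding Z_def by simp
    show "\<bar>\<Sum>p\<in>{1..m}. \<Sum>q\<in>{1..m}. if r p = s q then Z r s p q else 0\<bar> \<le>
        (real m)\<^sup>2 * (4 * B + 2 * C * (real m * (m + 2)) / n)"
      unfolding Z_def using B_nonneg C_nonneg by (intro abs_sum_matches_le avg_proj_error_le rs) auto
  qed (use G_nonneg B_nonneg C_nonneg in auto)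
  finally show "(\<integral>\<omega>. total_error a \<omega> \<partial>P) \<le> \<dots>" .
qed

text \<open>
  The second moment of the bootstrap kernel given the data is on average about \<open>B\<close>, because the tuples
  with repetitions form a fraction of at most \<open>m\<^sup>2 / n\<close>.
\<close>

lemma integral_avg_obs_sq_le:
  "(\<Sum>J\<in>tuples. \<integral>\<omega>. (obs J \<omega>)\<^sup>2 \<partial>P) / real n ^ m \<le> B + C * (real m)\<^sup>2 / n"
proof -
  let ?E = "tuples"
  let ?N = "real n ^ m"
  have cE: "real (card ?E) = ?N" by (simp add: card_PiE)
  have N: "0 < ?N" using n_pos by simp
  have obs: "(\<integral>\<omega>. (obs J \<omega>)\<^sup>2 \<partial>P) \<le> B + C * of_bool (\<not> generic m J {})" if J: "J \<in> ?E" for J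
  proof (cases "generic m J {}")
    case True
    then have "J \<in> dtuples"
      using J by (auto simp: generic_def distinct_tuples_def)
    from obs_sq(2)[OF this] show ?thesis using True by simp
  next
    case False
    then show ?thesis using obs_C(2)[OF J] B_nonneg by simp
  qed
  have "(\<Sum>J\<in>?E. \<integral>\<omega>. (obs J \<omega>)\<^sup>2 \<partial>P) / ?N \<le> (\<Sum>J\<in>?E. B + C * of_bool (\<not> generic m J {})) / ?N"
    using N by (intro divide_right_mono sum_mono obs) auto
  also have "\<dots> = B + C * ((\<Sum>J\<in>?E. of_bool (\<not> generic m J {})) / ?N)"
    using N cE by (simp only: sum.distrib sum_distrib_left[symmetric] sum_constant) (simp add: field_simps)
  also have "\<dots> \<le> B + C * (real m * (m + 0) / n)"
    using C_nonneg sum_nongeneric_le[of "{}" 0 n m] n_pos by (intro add_left_mono mult_left_mono) auto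
  finally show ?thesis by (simp add: power2_eq_square)
qed

lemma integral_avg_obs_sq:
  "integrable P (\<lambda>\<omega>. avg_obs_sq \<omega>)"
  "(\<integral>\<omega>. avg_obs_sq \<omega> \<partial>P) \<le> B + C * (real m)\<^sup>2 / n"
proof -
  have i: "integrable P (\<lambda>\<omega>. (obs J \<omega>)\<^sup>2)" if "J \<in> tuples" for J
    using obs_C(1)[OF that] by (simp add: square_integrable_def)
  then show "integrable P (\<lambda>\<omega>. avg_obs_sq \<omega>)"
    by (intro Bochner_Integration.integrable_divide Bochner_Integration.integrable_sum)
  have eq: "(\<integral>\<omega>. avg_obs_sq \<omega> \<partial>P) =
      (\<Sum>J\<in>tuples. \<integral>\<omega>. (obs J \<omega>)\<^sup>2 \<partial>P) / real n ^ m"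
    using i by (simp add: Bochner_Integration.integral_sum)
  show "(\<integral>\<omega>. avg_obs_sq \<omega> \<partial>P) \<le> B + C * (real m)\<^sup>2 / n"
    unfolding eq by (rule integral_avg_obs_sq_le)
qed

section \<open>Comparing the bootstrap variance with the variance\<close>

text \<open>
  The empirical variances with bootstrap projections and with true ones are compared summand by
  summand by \<open>unif_var_perturb\<close>. The constants \<open>\<theta>\<close> in \<open>h1\<close> drop out, as a variance does not see them.
\<close>

lemma bootstrap_variance_pointwise:
  assumes \<delta>: "0 < \<delta>"
  shows "\<bar>bootstrap_variance n (\<lambda>i. X i \<omega>) (wU m n a h) -
      (\<Sum>i=1..n. unif_var n (\<lambda>j. h1_at a i (X j \<omega>) / real n))\<bar>
    \<le> ((real m)\<^sup>2 + 1) * avg_obs_sq \<omega> * overlap_mass 2 m n a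
      + \<delta> * (\<Sum>i=1..n. unif_var n (\<lambda>j. h1_at a i (X j \<omega>) / real n)) + (1 + 1 / \<delta>) * total_error a \<omega>"
proof -
  have n: "1 \<le> n" using n_pos by simp
  let ?g = "\<lambda>i j. h1_at a i (X j \<omega>) / real n"
  let ?w = "\<lambda>i j. \<Sum>(r, p)\<in>incidences m n i. (tuple_weight m n * a r) * proj_error r p j \<omega>"
  let ?b = "\<lambda>i j. boot_sum m n a h (\<lambda>i. X i \<omega>) i j"
  have i: "\<bar>unif_var n (?b i) - unif_var n (?g i)\<bar> \<le> \<delta> * unif_var n (?g i) + (1 + 1 / \<delta>) * ((\<Sum>j=1..n. (?w i j)\<^sup>2) / n)"
    if i: "i \<in> {1..n}" for i
  proof -
    define d where "d = (\<Sum>(r, p)\<in>incidences m n i. (tuple_weight m n * a r) * \<theta> P X m h r)"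
    have "?b i = (\<lambda>j. (?g i j + ?w i j) - (- d))"
      unfolding h1_divide_n[OF i] d_def proj_error_def case_prod_beta
      by (simp add: fun_eq_iff right_diff_distrib sum_subtractf)
    then have "unif_var n (?b i) = unif_var n (\<lambda>j. ?g i j + ?w i j)"
      using unif_var_diff_const[OF n, of "\<lambda>j. ?g i j + ?w i j" "- d"] by (simp only:)
    then have "\<bar>unif_var n (?b i) - unif_var n (?g i)\<bar> \<le> \<delta> * unif_var n (?g i) + (1 + 1 / \<delta>) * unif_var n (?w i)"
      using unif_var_perturb[OF n \<delta>, of "?g i" "?w i"] by simp
    also have "\<dots> \<le> \<delta> * unif_var n (?g i) + (1 + 1 / \<delta>) * ((\<Sum>j=1..n. (?w i j)\<^sup>2) / n)"
      using \<delta> by (intro add_left_mono mult_left_mono unif_var_le) auto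
    finally show ?thesis .
  qed
  have "\<bar>(\<Sum>i=1..n. unif_var n (?b i)) - (\<Sum>i=1..n. unif_var n (?g i))\<bar> \<le>
      (\<Sum>i=1..n. \<delta> * unif_var n (?g i) + (1 + 1 / \<delta>) * ((\<Sum>j=1..n. (?w i j)\<^sup>2) / n))"
    unfolding sum_subtractf[symmetric] by (intro order_trans[OF sum_abs] sum_mono i)
  also have "\<dots> = \<delta> * (\<Sum>i=1..n. unif_var n (?g i)) + (1 + 1 / \<delta>) * total_error a \<omega>"
    unfolding total_error_def sum.distrib sum_distrib_left[symmetric] ..
  finally show ?thesis
    using bootstrap_variance_approx[OF m_ge_2 m_le, of "\<lambda>i. X i \<omega>" a h] by linarith
qed

definition error_const :: "real \<Rightarrow> real" where
  "error_const \<delta> = ((real m)\<^sup>2 + 1) * (1 + C * (real m)\<^sup>2) +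
     (1 + 1 / \<delta>) * (2 + 4 * C * (real m * (7 * m + 4)) + (real m)\<^sup>2 * (4 + 2 * C * (real m * (m + 2))))"

text \<open>
  By Markov's inequality the nonnegative error \<open>Y\<close> exceeds \<open>\<epsilon> / 3\<close> rarely. If neither this happens nor one of
  the two averages in the hypotheses on \<open>h1\<close> is off by more than \<open>\<epsilon> / 12\<close>, the main term is within
  \<open>\<epsilon> / 6\<close> of \<open>1\<close>, and \<open>\<delta> \<le> min 1 (\<epsilon> / 3)\<close> keeps the whole deviation at most \<open>\<epsilon>\<close>.
\<close>

lemma prob_bootstrap_variance_far_le:
  fixes a :: "(nat \<Rightarrow> nat) \<Rightarrow> real" and \<sigma> \<epsilon> \<delta> :: real
  assumes \<sigma>: "0 < \<sigma>" and \<epsilon>: "0 < \<epsilon>" and \<delta>: "0 < \<delta>" "\<delta> \<le> 1" "\<delta> \<le> \<epsilon> / 3"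
  defines "SS \<equiv> \<lambda>\<omega>. 1 / real n * (\<Sum>i=1..n. \<Sum>j=1..n. (h1_at a i (X j \<omega>) / (real n * \<sigma>))\<^sup>2)"
    and "SM \<equiv> \<lambda>\<omega>. 1 / (real n)\<^sup>2 * (\<Sum>i=1..n. (\<Sum>j=1..n. h1_at a i (X j \<omega>) / (real n * \<sigma>))\<^sup>2)"
  shows "measure P {\<omega> \<in> space P. \<bar>bootstrap_variance n (\<lambda>i. X i \<omega>) (wU m n a h) / \<sigma>\<^sup>2 - 1\<bar> > \<epsilon>} \<le>
    measure P {\<omega> \<in> space P. \<bar>SS \<omega> - 1\<bar> > \<epsilon> / 12} + measure P {\<omega> \<in> space P. \<bar>SM \<omega> - 0\<bar> > \<epsilon> / 12} +
    3 / \<epsilon> * error_const \<delta> * ((overlap_mass 2 m n a * B + overlap_mass 1 m n a * (G + 1 / n)) / \<sigma>\<^sup>2)"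
proof -
  let ?ESS = "{\<omega> \<in> space P. \<bar>SS \<omega> - 1\<bar> > \<epsilon> / 12}" and ?ESM = "{\<omega> \<in> space P. \<bar>SM \<omega> - 0\<bar> > \<epsilon> / 12}"
  let ?W1 = "overlap_mass 1 m n a" and ?W2 = "overlap_mass 2 m n a"
  define R where "R \<omega> = avg_obs_sq \<omega>" for \<omega>
  define S where "S \<omega> = (\<Sum>i=1..n. unif_var n (\<lambda>j. h1_at a i (X j \<omega>) / real n))" for \<omega>
  define Y where "Y \<omega> = (((real m)\<^sup>2 + 1) * ?W2 * R \<omega> + (1 + 1 / \<delta>) * total_error a \<omega>) / \<sigma>\<^sup>2" for \<omega>
  have SS_SM: "S \<omega> / \<sigma>\<^sup>2 = SS \<omega> - SM \<omega>" for \<omega>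
  proof -
    have u: "unif_var n (\<lambda>j. g j / real n) / \<sigma>\<^sup>2 =
        1 / real n * (\<Sum>j=1..n. (g j / (real n * \<sigma>))\<^sup>2) - 1 / (real n)\<^sup>2 * (\<Sum>j=1..n. g j / (real n * \<sigma>))\<^sup>2" for g
    proof -
      have 1: "(\<Sum>j=1..n. (g j / (real n * \<sigma>))\<^sup>2) = (\<Sum>j=1..n. (g j / real n)\<^sup>2) / \<sigma>\<^sup>2"
        by (simp add: sum_divide_distrib power_divide power_mult_distrib)
      have 2: "(\<Sum>j=1..n. g j / (real n * \<sigma>)) = (\<Sum>j=1..n. g j / real n) / \<sigma>"
        by (simp add: sum_divide_distrib)
      show ?thesis unfolding unif_var_def 1 2 by (simp add: power_divide diff_divide_distrib mult.commute)
    qed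
    show ?thesis
      unfolding S_def SS_def SM_def sum_divide_distrib u sum_subtractf sum_distrib_left ..
  qed
  have pt: "\<bar>SS \<omega> - 1\<bar> > \<epsilon> / 12 \<or> \<bar>SM \<omega> - 0\<bar> > \<epsilon> / 12 \<or> Y \<omega> \<ge> \<epsilon> / 3"
    if far: "\<bar>bootstrap_variance n (\<lambda>i. X i \<omega>) (wU m n a h) / \<sigma>\<^sup>2 - 1\<bar> > \<epsilon>" for \<omega>
  proof (rule ccontr)
    assume "\<not> ?thesis"
    then have *: "\<bar>SS \<omega> - 1\<bar> \<le> \<epsilon> / 12" "\<bar>SM \<omega>\<bar> \<le> \<epsilon> / 12" "Y \<omega> < \<epsilon> / 3" by auto
    let ?b = "bootstrap_variance n (\<lambda>i. X i \<omega>) (wU m n a h)"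
    have "\<bar>?b - S \<omega>\<bar> \<le> ((real m)\<^sup>2 + 1) * ?W2 * R \<omega> + \<delta> * S \<omega> + (1 + 1 / \<delta>) * total_error a \<omega>"
      using bootstrap_variance_pointwise[OF \<delta>(1), of \<omega> a] unfolding S_def R_def by (simp add: mult_ac)
    from divide_right_mono[OF this, of "\<sigma>\<^sup>2"]
    have "\<bar>?b / \<sigma>\<^sup>2 - S \<omega> / \<sigma>\<^sup>2\<bar> \<le> Y \<omega> + \<delta> * (S \<omega> / \<sigma>\<^sup>2)"
      by (simp add: Y_def add_divide_distrib diff_divide_distrib[symmetric] abs_divide)
    moreover have S: "\<bar>S \<omega> / \<sigma>\<^sup>2 - 1\<bar> \<le> \<epsilon> / 6" using * unfolding SS_SM by linarith
    moreover have "\<delta> * (S \<omega> / \<sigma>\<^sup>2) \<le> \<delta> + \<epsilon> / 6"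
    proof -
      have "S \<omega> / \<sigma>\<^sup>2 \<le> 1 + \<epsilon> / 6" using S by linarith
      then have "\<delta> * (S \<omega> / \<sigma>\<^sup>2) \<le> \<delta> * (1 + \<epsilon> / 6)" using \<delta>(1) by (rule mult_left_mono[OF _ less_imp_le])
      also have "\<dots> = \<delta> + \<delta> * (\<epsilon> / 6)" by (simp add: algebra_simps)
      also have "\<dots> \<le> \<delta> + 1 * (\<epsilon> / 6)" using \<delta> \<epsilon> by (intro add_left_mono mult_right_mono) auto
      finally show ?thesis by simp
    qed
    ultimately have "\<bar>?b / \<sigma>\<^sup>2 - 1\<bar> \<le> \<epsilon>" using *(3) \<delta>(3) by linarith
    then show False using far by simp
  qed
  have hm: "(\<lambda>\<omega>. h1_at a i (X j \<omega>)) \<in> borel_measurable P" if "i \<in> {1..n}" "j \<in> {1..n}" for i j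
    by (rule measurable_compose[OF X_measurable h1_measurable]) (use that in auto)
  have SSm: "SS \<in> borel_measurable P" and SMm: "SM \<in> borel_measurable P"
    unfolding SS_def SM_def
    by (intro borel_measurable_times borel_measurable_const borel_measurable_sum borel_measurable_power
      borel_measurable_divide hm; assumption)+
  have Rint: "integrable P R" "(\<integral>\<omega>. R \<omega> \<partial>P) \<le> B + C * (real m)\<^sup>2 / n"
    using integral_avg_obs_sq unfolding R_def by auto
  have Yint: "integrable P Y"
    unfolding Y_def by (intro Bochner_Integration.integrable_divide Bochner_Integration.integrable_add
      integrable_mult_right Rint integrable_total_error)
  then have Ym: "Y \<in> borel_measurable P" by auto
  have Y0: "0 \<le> Y \<omega>" for \<omega>
    unfolding Y_def R_def total_error_def using \<delta> overlap_mass_nonneg[of 2 m n a]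
    by (intro divide_nonneg_nonneg add_nonneg_nonneg mult_nonneg_nonneg sum_nonneg) auto
  have "measure P {\<omega> \<in> space P. \<bar>bootstrap_variance n (\<lambda>i. X i \<omega>) (wU m n a h) / \<sigma>\<^sup>2 - 1\<bar> > \<epsilon>} \<le>
      measure P ((?ESS \<union> ?ESM) \<union> {\<omega> \<in> space P. Y \<omega> \<ge> \<epsilon> / 3})"
    by (intro finite_measure_mono sets.Un) (use pt SSm SMm Ym in \<open>auto\<close>)
  also have "\<dots> \<le> measure P (?ESS \<union> ?ESM) +
      measure P {\<omega> \<in> space P. Y \<omega> \<ge> \<epsilon> / 3}"
    by (intro measure_Un_le sets.Un) (use SSm SMm Ym in auto)
  also have "\<dots> \<le> (measure P ?ESS + measure P ?ESM) +
      measure P {\<omega> \<in> space P. Y \<omega> \<ge> \<epsilon> / 3}"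
    by (intro add_right_mono measure_Un_le) (use SSm SMm in auto)
  also have "measure P {\<omega> \<in> space P. Y \<omega> \<ge> \<epsilon> / 3} \<le> (\<integral>\<omega>. Y \<omega> \<partial>P) / (\<epsilon> / 3)"
    by (rule integral_Markov_inequality_measure[OF Yint, of "{}"]) (use Y0 \<epsilon> in auto)
  also have "(\<integral>\<omega>. Y \<omega> \<partial>P) \<le> error_const \<delta> * ((?W2 * B + ?W1 * (G + 1 / n)) / \<sigma>\<^sup>2)"
  proof -
    have W: "0 \<le> ?W2" "?W2 \<le> ?W1" by (auto intro: overlap_mass_nonneg overlap_mass_antimono)
    \<comment> \<open>every term of the bound is at most a constant times \<open>Q\<close>, as \<open>?W2 / n \<le> ?W1 / n\<close>\<close>
    define Q where "Q = ?W2 * B + ?W1 * (G + 1 / n)"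
    have q: "?W2 * B \<le> Q" "?W1 * G \<le> Q" "?W1 / n \<le> Q" "0 \<le> Q"
      using W B_nonneg G_nonneg by (auto simp: Q_def distrib_left)
    have q': "?W2 / n \<le> Q" using divide_right_mono[OF W(2), of "real n"] q(3) by simp
    have 1: "?W2 * (\<integral>\<omega>. R \<omega> \<partial>P) \<le> (1 + C * (real m)\<^sup>2) * Q"
    proof -
      have "?W2 * (\<integral>\<omega>. R \<omega> \<partial>P) \<le> ?W2 * (B + C * (real m)\<^sup>2 / n)" by (intro mult_left_mono Rint W)
      also have "\<dots> = ?W2 * B + C * (real m)\<^sup>2 * (?W2 / n)" by (simp add: algebra_simps)
      also have "\<dots> \<le> Q + C * (real m)\<^sup>2 * Q" using q q' C_nonneg by (intro add_mono mult_left_mono) auto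
      finally show ?thesis by (simp add: algebra_simps)
    qed
    have 2: "(\<integral>\<omega>. total_error a \<omega> \<partial>P) \<le> (2 + 4 * C * (real m * (7 * m + 4)) + (real m)\<^sup>2 * (4 + 2 * C * (real m * (m + 2)))) * Q"
    proof -
      have "(\<integral>\<omega>. total_error a \<omega> \<partial>P) \<le> 2 * (?W1 * G) + 4 * C * (real m * (7 * m + 4)) * (?W1 / n) +
          (real m)\<^sup>2 * (4 * (?W2 * B) + 2 * C * (real m * (m + 2)) * (?W2 / n))"
        using integral_total_error_le[of a] by (simp add: algebra_simps add_divide_distrib)
      also have "\<dots> \<le> 2 * Q + 4 * C * (real m * (7 * m + 4)) * Q +
          (real m)\<^sup>2 * (4 * Q + 2 * C * (real m * (m + 2)) * Q)"
        using q q' C_nonneg by (intro add_mono mult_left_mono) auto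
      finally show ?thesis by (simp add: algebra_simps)
    qed
    have "(\<integral>\<omega>. Y \<omega> \<partial>P) = (((real m)\<^sup>2 + 1) * (?W2 * (\<integral>\<omega>. R \<omega> \<partial>P)) + (1 + 1 / \<delta>) * (\<integral>\<omega>. total_error a \<omega> \<partial>P)) / \<sigma>\<^sup>2"
      unfolding Y_def using Rint(1) integrable_total_error[of a] by (simp add: mult.assoc)
    also have "\<dots> \<le> (((real m)\<^sup>2 + 1) * ((1 + C * (real m)\<^sup>2) * Q) + (1 + 1 / \<delta>) *
        ((2 + 4 * C * (real m * (7 * m + 4)) + (real m)\<^sup>2 * (4 + 2 * C * (real m * (m + 2)))) * Q)) / \<sigma>\<^sup>2"
      using \<delta> by (intro divide_right_mono add_mono mult_left_mono 1 2) auto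
    also have "\<dots> = error_const \<delta> * (Q / \<sigma>\<^sup>2)"
      by (simp add: error_const_def algebra_simps add_divide_distrib)
    finally show ?thesis by (simp add: Q_def)
  qed
  finally show ?thesis using \<epsilon> by (simp add: divide_right_mono field_simps)
qed

end

theorem theorem2p6:
  fixes m :: nat
    and P :: "nat \<Rightarrow> 'w measure"
    and N :: "'x measure"
    and X :: "nat \<Rightarrow> nat \<Rightarrow> 'w \<Rightarrow> 'x"
    and a :: "nat \<Rightarrow> (nat \<Rightarrow> nat) \<Rightarrow> real"
    and h :: "nat \<Rightarrow> (nat \<Rightarrow> 'x) \<Rightarrow> real"
    and M \<sigma> V :: "nat \<Rightarrow> real"
  assumes m: "m \<ge> 2"
    and prob: "\<And>n. prob_space (P n)"
    and indep: "\<And>n. prob_space.indep_vars (P n) (\<lambda>_. N) (X n) {1..n}"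
    and h_meas: "\<And>n. h n \<in> borel_measurable (\<Pi>\<^sub>M k\<in>{1..m}. N)"
    and \<sigma>: "\<And>n. \<sigma> n = sqrt (prob_space.variance (P n) (\<lambda>\<omega>. wU m n (a n) (h n) (\<lambda>i. X n i \<omega>)))"
    and V: "\<And>n. V n = prob_space.variance (P n)
              (\<lambda>\<omega>. 1 / real n * (\<Sum>i=1..n. h1 (P n) N (X n) m n (a n) (h n) i (X n i \<omega>)))"
    and V_pos: "\<forall>\<^sub>F n in sequentially. V n > 0"
    and M_pos: "\<And>n. M n > 0"
    and fourth_moment: "\<And>n i. i \<in> distinct_tuples {1..n} m \<Longrightarrow>
          (\<integral>\<^sup>+\<omega>. ennreal (h n (at_indices m (\<lambda>j. X n j \<omega>) i) ^ 4) \<partial>P n) \<le> ennreal (M n)"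
    and rate2: "(\<lambda>n. real n powr (-2) * V n powr (-1) * A_avg 2 2 m n (a n) * M n powr (1/2))
          \<longlonglongrightarrow> 0"
    and rate3: "(\<lambda>n. real n powr (-2) * V n powr (-3/2) * A_avg 3 1 m n (a n) * M n powr (3/4))
          \<longlonglongrightarrow> 0"
    and second_moment: "limsup (\<lambda>n. max_sq_obs (P n) (X n) m n (h n)) < \<infinity>"
    and second_moment_indep: "limsup (\<lambda>n. max_sq_indep (P n) N (X n) m n (h n)) < \<infinity>"
    and proj_sq: "tendsto_in_prob P
          (\<lambda>n \<omega>. 1 / real n * (\<Sum>i=1..n. \<Sum>j=1..n.
             (h1 (P n) N (X n) m n (a n) (h n) i (X n j \<omega>) / (real n * \<sigma> n))\<^sup>2)) 1"
    and proj_mean: "tendsto_in_prob P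
          (\<lambda>n \<omega>. 1 / (real n)\<^sup>2 * (\<Sum>i=1..n. (\<Sum>j=1..n.
             h1 (P n) N (X n) m n (a n) (h n) i (X n j \<omega>) / (real n * \<sigma> n))\<^sup>2)) 0"
    and heterogeneity: "(\<lambda>n. real n powr (-1) * \<sigma> n powr (-2) * A_avg 2 1 m n (a n) *
          ((M1 (P n) (X n) m n (h n))\<^sup>2 + M2 (P n) N (X n) m n (h n) + 1 / real n)) \<longlonglongrightarrow> 0"
  shows "tendsto_in_prob P
          (\<lambda>n \<omega>. \<bar>bootstrap_variance n (\<lambda>i. X n i \<omega>) (\<lambda>y. wU m n (a n) (h n) y / \<sigma> n)
             - prob_space.variance (P n) (\<lambda>\<omega>'. wU m n (a n) (h n) (\<lambda>i. X n i \<omega>') / \<sigma> n)\<bar>) 0"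
proof -
  \<comment> \<open>the second moment bound that follows from the fourth moment bound\<close>
  define B where "B n = sqrt (M n)" for n
  define G where "G n = M2 (P n) N (X n) m n (h n)" for n
  define W where "W q n = overlap_mass q m n (a n)" for q n
  define K where "K = 8 ^ m * real m ^ m"
  have "limsup (\<lambda>n. max_sq_obs (P n) (X n) m n (h n)) < top" "limsup (\<lambda>n. max_sq_indep (P n) N (X n) m n (h n)) < top"
    using second_moment second_moment_indep by auto
  then obtain c1 c2 where c: "limsup (\<lambda>n. max_sq_obs (P n) (X n) m n (h n)) < c1" "c1 < top"
      "limsup (\<lambda>n. max_sq_indep (P n) N (X n) m n (h n)) < c2" "c2 < top"
    using dense by meson
  define C where "C = enn2real (max c1 c2)"
  have C: "ennreal C = max c1 c2" "0 \<le> C" using c by (auto simp: C_def)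
  have ev: "\<forall>\<^sub>F n in sequentially. 2 * m \<le> n \<and> 0 < V n \<and> max_sq_obs (P n) (X n) m n (h n) \<le> ennreal C \<and>
      max_sq_indep (P n) N (X n) m n (h n) \<le> ennreal C"
    using eventually_ge_at_top[of "2 * m"] V_pos Limsup_lessD[OF c(1)] Limsup_lessD[OF c(3)]
    by eventually_elim (auto simp: C(1) le_max_iff_disj)
  have bounded: "bounded_sample (P n) N (X n) m n (h n) (B n)" if n: "2 * m \<le> n" for n
  proof -
    interpret P: independent_sample "P n" N "X n" m n "h n"
      using prob[of n] indep[of n] h_meas[of n] m n
      by (auto simp: independent_sample_def independent_sample_axioms_def)
    show ?thesis
    proof
      show "0 \<le> B n" using M_pos[of n] by (simp add: B_def)
      fix r assume r: "r \<in> distinct_tuples {1..n} m"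
      show "(\<integral>\<^sup>+\<omega>. ennreal ((h n (at_indices m (\<lambda>j. X n j \<omega>) r))\<^sup>2) \<partial>P n) \<le> ennreal (B n)"
        unfolding B_def
        by (intro P.second_moment_le_sqrt_fourth P.obs_measurable distinct_tuplesD(4)[OF r] fourth_moment[OF r]
          less_imp_le[OF M_pos])
    qed
  qed
  have hetero: "heterogeneous_sample (P n) N (X n) m n (h n) (B n) C (G n)"
    if n: "2 * m \<le> n" and c: "max_sq_obs (P n) (X n) m n (h n) \<le> ennreal C"
      "max_sq_indep (P n) N (X n) m n (h n) \<le> ennreal C" for n
  proof -
    interpret P: bounded_sample "P n" N "X n" m n "h n" "B n" by (rule bounded[OF n])
    show ?thesis
    proof
      show "0 \<le> G n" unfolding G_def by (rule P.M2_nonneg[OF n])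
      fix r assume r: "r \<in> {1..m} \<rightarrow>\<^sub>E {1..n}"
      show "(\<integral>\<^sup>+\<omega>. ennreal ((h n (at_indices m (\<lambda>j. X n j \<omega>) r))\<^sup>2) \<partial>P n) \<le> ennreal C"
        using c(1) unfolding max_sq_obs_def by (rule order_trans[OF SUP_upper[OF r]])
      show "(\<integral>\<^sup>+x. ennreal ((h n x)\<^sup>2) \<partial>(\<Pi>\<^sub>M k\<in>{1..m}. distr (P n) N (X n (r k)))) \<le> ennreal C"
        using c(2) unfolding max_sq_indep_def by (rule order_trans[OF SUP_upper[OF r]])
    qed (use m C P.abs_integral_diff_le_M2 in \<open>auto simp: G_def\<close>)
  qed
  have \<sigma>2: "(\<sigma> n)\<^sup>2 = prob_space.variance (P n) (\<lambda>\<omega>. wU m n (a n) (h n) (\<lambda>i. X n i \<omega>))" for n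
    unfolding \<sigma> by (intro real_sqrt_pow2 prob_space.variance_positive prob)
  have W0: "0 \<le> W q n" for q n by (simp add: W_def overlap_mass_nonneg)
  have W_le: "W q n \<le> K / real n ^ q * A_avg 2 q m n (a n)" if "q \<le> m" "2 * m \<le> n" for q n
    unfolding W_def K_def using that m by (intro overlap_mass_le_A_avg) auto

  have lim2: "(\<lambda>n. W 2 n * B n / V n) \<longlonglongrightarrow> 0"
  proof (rule tendsto_sandwich[OF _ _ tendsto_const])
    show "(\<lambda>n. K * (real n powr (-2) * V n powr (-1) * A_avg 2 2 m n (a n) * M n powr (1/2))) \<longlonglongrightarrow> 0"
      using tendsto_mult_left[OF rate2, of K] by simp
    show "\<forall>\<^sub>F n in sequentially. 0 \<le> W 2 n * B n / V n"
      using V_pos by eventually_elim (use W0 M_pos in \<open>auto simp: B_def less_imp_le\<close>)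
    show "\<forall>\<^sub>F n in sequentially. W 2 n * B n / V n \<le>
        K * (real n powr (-2) * V n powr (-1) * A_avg 2 2 m n (a n) * M n powr (1/2))"
      using ev
    proof eventually_elim
      case (elim n)
      then have n: "0 < real n" "0 < V n" using m by auto
      have "W 2 n * B n / V n \<le> K / real n ^ 2 * A_avg 2 2 m n (a n) * B n / V n"
        using W_le[of 2 n] elim m n M_pos[of n] by (intro divide_right_mono mult_right_mono) (auto simp: B_def)
      also have "\<dots> = K * (real n powr (-2) * V n powr (-1) * A_avg 2 2 m n (a n) * M n powr (1/2))"
        using n M_pos[of n] by (simp add: powr_neg_numeral powr_neg_one powr_half_sqrt B_def)
      finally show ?case .
    qed
  qed

  \<comment> \<open>the left-hand side bounds \<open>\<bar>\<sigma>\<^sup>2 - V\<bar> / V\<close>, so \<open>V \<le> 2 \<sigma>\<^sup>2\<close> as soon as it is below \<open>1 / 2\<close>\<close>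
  have "(\<lambda>n. ((real m)\<^sup>2 + 1) * (W 2 n * B n / V n)) \<longlonglongrightarrow> 0"
    using tendsto_mult_left[OF lim2, of "(real m)\<^sup>2 + 1"] by simp
  then have "\<forall>\<^sub>F n in sequentially. ((real m)\<^sup>2 + 1) * (W 2 n * B n / V n) < 1 / 2"
    by (rule order_tendstoD) simp
  then have ev_\<sigma>: "\<forall>\<^sub>F n in sequentially. V n \<le> 2 * (\<sigma> n)\<^sup>2 \<and> 0 < \<sigma> n"
    using ev
  proof eventually_elim
    case (elim n)
    interpret P: bounded_sample "P n" N "X n" m n "h n" "B n" by (rule bounded) (use elim in simp)
    have "\<bar>(\<sigma> n)\<^sup>2 - V n\<bar> \<le> ((real m)\<^sup>2 + 1) * B n * W 2 n"
      unfolding \<sigma>2 V W_def P.variance_sum_h1 by (rule P.variance_wU_approx)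
    also have "\<dots> \<le> V n / 2"
      using elim by (simp add: field_simps)
    finally have le: "V n \<le> 2 * (\<sigma> n)\<^sup>2" by linarith
    then have "0 < (\<sigma> n)\<^sup>2" using elim by linarith
    moreover have "0 \<le> \<sigma> n" unfolding \<sigma> by (intro real_sqrt_ge_zero P.variance_positive)
    ultimately show ?case using le by (auto simp: less_le)
  qed

  define Q where "Q n = (W 2 n * B n + W 1 n * (G n + 1 / n)) / (\<sigma> n)\<^sup>2" for n
  have limQ: "Q \<longlonglongrightarrow> 0"
  proof (rule tendsto_sandwich[OF _ _ tendsto_const])
    let ?R = "\<lambda>n. real n powr (-1) * \<sigma> n powr (-2) * A_avg 2 1 m n (a n) *
          ((M1 (P n) (X n) m n (h n))\<^sup>2 + M2 (P n) N (X n) m n (h n) + 1 / real n)"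
    show "(\<lambda>n. 2 * (W 2 n * B n / V n) + K * ?R n) \<longlonglongrightarrow> 0"
      using tendsto_add[OF tendsto_mult_left[OF lim2, of 2] tendsto_mult_left[OF heterogeneity, of K]] by simp
    show "\<forall>\<^sub>F n in sequentially. 0 \<le> Q n"
      using ev
    proof eventually_elim
      case (elim n)
      interpret P: heterogeneous_sample "P n" N "X n" m n "h n" "B n" C "G n" by (rule hetero) (use elim in auto)
      show ?case unfolding Q_def using W0 P.G_nonneg P.B_nonneg by auto
    qed
    show "\<forall>\<^sub>F n in sequentially. Q n \<le> 2 * (W 2 n * B n / V n) + K * ?R n"
      using ev ev_\<sigma>
    proof eventually_elim
      case (elim n)
      interpret P: heterogeneous_sample "P n" N "X n" m n "h n" "B n" C "G n" by (rule hetero) (use elim in auto)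
      have n: "0 < real n" "0 < V n" "0 < \<sigma> n" using elim m by auto
      have "W 2 n * B n / (\<sigma> n)\<^sup>2 \<le> W 2 n * B n / (V n / 2)"
        using n elim W0 P.B_nonneg by (intro divide_left_mono) auto
      then have V: "W 2 n * B n / (\<sigma> n)\<^sup>2 \<le> 2 * (W 2 n * B n / V n)" by (simp add: mult.commute)
      have R: "W 1 n * (G n + 1 / n) / (\<sigma> n)\<^sup>2 \<le> K * ?R n"
      proof -
        have "W 1 n * (G n + 1 / n) / (\<sigma> n)\<^sup>2 \<le>
          (K / real n * A_avg 2 1 m n (a n)) * ((M1 (P n) (X n) m n (h n))\<^sup>2 + G n + 1 / real n) / (\<sigma> n)\<^sup>2"
          using W_le[of 1 n] elim m P.G_nonneg W0[of 1 n]
          by (intro divide_right_mono mult_mono) auto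
        also have "\<dots> = K * ?R n"
          using n by (simp add: powr_neg_numeral powr_neg_one G_def)
        finally show ?thesis .
      qed
      show ?case unfolding Q_def add_divide_distrib by (rule add_mono[OF V R])
    qed
  qed

  \<comment> \<open>\<open>Q\<close> is the error relative to \<open>\<sigma>\<^sup>2\<close>, so for every fixed \<open>\<epsilon>\<close> each part of the bound on the
    probability of a deviation tends to \<open>0\<close>\<close>
  show ?thesis unfolding tendsto_in_prob_def
  proof (intro allI impI)
    fix \<epsilon> :: real assume \<epsilon>: "0 < \<epsilon>"
    define \<delta> where "\<delta> = min 1 (\<epsilon> / 3)"
    have \<delta>: "0 < \<delta>" "\<delta> \<le> 1" "\<delta> \<le> \<epsilon> / 3" using \<epsilon> by (auto simp: \<delta>_def)
    define L where "L = ((real m)\<^sup>2 + 1) * (1 + C * (real m)\<^sup>2) +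
     (1 + 1 / \<delta>) * (2 + 4 * C * (real m * (7 * m + 4)) + (real m)\<^sup>2 * (4 + 2 * C * (real m * (m + 2))))"
    let ?SS = "\<lambda>n \<omega>. 1 / real n * (\<Sum>i=1..n. \<Sum>j=1..n.
             (h1 (P n) N (X n) m n (a n) (h n) i (X n j \<omega>) / (real n * \<sigma> n))\<^sup>2)"
    let ?SM = "\<lambda>n \<omega>. 1 / (real n)\<^sup>2 * (\<Sum>i=1..n. (\<Sum>j=1..n.
             h1 (P n) N (X n) m n (a n) (h n) i (X n j \<omega>) / (real n * \<sigma> n))\<^sup>2)"
    let ?far = "\<lambda>n. measure (P n) {\<omega> \<in> space (P n).
        \<bar>\<bar>bootstrap_variance n (\<lambda>i. X n i \<omega>) (\<lambda>y. wU m n (a n) (h n) y / \<sigma> n)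
             - prob_space.variance (P n) (\<lambda>\<omega>'. wU m n (a n) (h n) (\<lambda>i. X n i \<omega>') / \<sigma> n)\<bar> - 0\<bar> > \<epsilon>}"
    let ?bound = "\<lambda>n. measure (P n) {\<omega> \<in> space (P n). \<bar>?SS n \<omega> - 1\<bar> > \<epsilon> / 12} +
      measure (P n) {\<omega> \<in> space (P n). \<bar>?SM n \<omega> - 0\<bar> > \<epsilon> / 12} + 3 / \<epsilon> * L * Q n"
    show "(\<lambda>n. ?far n) \<longlonglongrightarrow> 0"
    proof (rule tendsto_sandwich[OF _ _ tendsto_const])
      have "\<epsilon> / 12 > 0" using \<epsilon> by simp
      then have "(\<lambda>n. measure (P n) {\<omega> \<in> space (P n). \<bar>?SS n \<omega> - 1\<bar> > \<epsilon> / 12}) \<longlonglongrightarrow> 0"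
          "(\<lambda>n. measure (P n) {\<omega> \<in> space (P n). \<bar>?SM n \<omega> - 0\<bar> > \<epsilon> / 12}) \<longlonglongrightarrow> 0"
        using proj_sq proj_mean unfolding tendsto_in_prob_def by blast+
      from tendsto_add[OF tendsto_add[OF this] tendsto_mult_left[OF limQ, of "3 / \<epsilon> * L"]]
      show "?bound \<longlonglongrightarrow> 0" by simp
      show "\<forall>\<^sub>F n in sequentially. ?far n \<le> ?bound n"
        using ev ev_\<sigma>
      proof eventually_elim
        case (elim n)
        interpret P: heterogeneous_sample "P n" N "X n" m n "h n" "B n" C "G n" by (rule hetero) (use elim in auto)
        have "P.variance (\<lambda>\<omega>'. wU m n (a n) (h n) (\<lambda>i. X n i \<omega>') / \<sigma> n) =
            P.variance (\<lambda>\<omega>'. wU m n (a n) (h n) (\<lambda>i. X n i \<omega>')) / (\<sigma> n)\<^sup>2"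
          by (simp add: diff_divide_distrib[symmetric] power_divide)
        also have "\<dots> = 1" unfolding \<sigma>2[symmetric] using elim by simp
        finally have one: "P.variance (\<lambda>\<omega>'. wU m n (a n) (h n) (\<lambda>i. X n i \<omega>') / \<sigma> n) = 1" .
        have "measure (P n) {\<omega> \<in> space (P n). \<bar>bootstrap_variance n (\<lambda>i. X n i \<omega>) (wU m n (a n) (h n)) / (\<sigma> n)\<^sup>2 - 1\<bar> > \<epsilon>}
            \<le> ?bound n"
          using P.prob_bootstrap_variance_far_le[of "\<sigma> n" \<epsilon> \<delta> "a n"] elim \<epsilon> \<delta>
          unfolding P.error_const_def L_def[symmetric] Q_def W_def by simp
        then show ?case unfolding one bootstrap_variance_divide by simp
      qed
    qed (simp add: always_eventually)
  qed
qed

end
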